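(* Let $\Lambda=\mathbb{Z}\times\{\mathrm{H},\mathrm{V},\mathrm{D}\}$ and let $(u_{j,l})_{(j,l)\in\Lambda}$ be a TI-frame for $L^2(\mathbb{R}^2)$ with the multi-scale structure $$u_{j,l}(x)=2^{2j}\,u_{0,l}(2^j x)\qquad\text{for all }(j,l)\in\Lambda .$$ Suppose there are $a,b>0$ such that $\operatorname{supp}(\widehat{u}_{0,l})=\{\xi\in\mathbb{R}^2 : a\le\|\xi\|_2\le b\}$ for each $l\in\{\mathrm{H},\mathrm{V},\mathrm{D}\}$. For $(j,l)\in\Lambda$ define $$v_{j,l}:=2^{-j/2}\,\mathcal{I}_1\mathcal{R}u_{j,l},\qquad \mathcal{V}_{j,l}^*(g):=\mathcal{R}^*(v_{j,l}^*\ast g)\quad\text{for } g\in L^2(\mathbb{S}^1\times\mathbb{R}).$$ Then the system $(u_{j,l},\mathcal{V}_{j,l}^*,2^{-j/2})_{(j,l)\in\Lambda}$ is a translation invariant diagonal frame decomposition (TI-DFD) for the Radon transform $\mathcal{R}$.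
   Context: Fourier transform: $\widehat f(\xi)=\mathbf{F}f(\xi)=\int_{\mathbb{R}^d}f(x)e^{-i\langle\xi,x\rangle}\,dx$ for $f\in L^1(\mathbb{R}^d)\cap L^2(\mathbb{R}^d)$, extended to $L^2(\mathbb{R}^d)$. For $g\in L^2(\mathbb{S}^1\times\mathbb{R})$, $\mathbf{F}_2 g=\widehat g$ is the one-dimensional Fourier transform in the second variable. Involution: $u^*(x)=\overline{u(-x)}$ on $\mathbb{R}^2$, and $v^*(\theta,s)=\overline{v(\theta,-s)}$ on $\mathbb{S}^1\times\mathbb{R}$. Convolution $\ast$ on $\mathbb{R}^2$ is the usual one; for functions on $\mathbb{S}^1\times\mathbb{R}$ it is convolution in the second variable. Radon transform on $L^2$: $\mathcal{R}:\mathcal{D}(\mathcal{R})\subseteq L^2(\mathbb{R}^2)\to L^2(\mathbb{S}^1\times\mathbb{R})$, $\mathcal{R}=\mathbf{F}_2^{-1}\circ\mathbf{B}\circ\mathbf{F}$, where $\mathbf{B}f(\theta,\sigma)=f(\sigma\theta)$, with domain $\mathcal{D}(\mathcal{R})=\{f\in L^2(\mathbb{R}^2): \|\cdot\|_2^{-1/2}\widehat f\in L^2(\mathbb{R}^2)\}$. Equivalently, $\mathbf{F}_2\mathcal{R}f(\theta,\sigma)=\widehat f(\sigma\theta)$ for almost every $(\theta,\sigma)\in\mathbb{S}^1\times\mathbb{R}$. This is a closed operator. The operator $\mathcal{R}^*$ is given by $\mathcal{R}^*=\mathbf{F}^{-1}\circ\mathbf{B}^*\circ\mathbf{F}_2$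 with $\mathbf{B}^*g(\xi)=\|\xi\|_2^{-1}\,g(\xi/\|\xi\|_2,\|\xi\|_2)$, on the domain $\{g\in L^2(\mathbb{S}^1\times\mathbb{R}): |\sigma|^{-1/2}\,\mathbf{F}_2g(\theta,\sigma)\in L^2(\mathbb{S}^1\times\mathbb{R})\}$. Riesz potential: $\mathcal{I}_1 g=\mathbf{F}_2^{-1}(|\sigma|\,\mathbf{F}_2 g(\theta,\sigma))$ for functions $g$ on $\mathbb{S}^1\times\mathbb{R}$. TI-frame: for an at most countable set $\Lambda$, a family $(u_\lambda)_{\lambda\in\Lambda}$ in $L^2(\mathbb{R}^d)$ is a TI-frame for $L^2(\mathbb{R}^d)$ if $\widehat u_\lambda\in L^\infty(\mathbb{R}^d)$ for all $\lambda$ and there are constants $A,B>0$ with $A\|f\|_2^2\le\sum_{\lambda\in\Lambda}\|u_\lambda^*\ast f\|_2^2\le B\|f\|_2^2$ for all $f\in L^2(\mathbb{R}^d)$. TI-DFD: let $\mathbf{K}:\mathcal{D}(\mathbf{K})\subseteq L^2(\mathbb{R}^d)\to\mathbb{Y}$ be a closed linear operator into a Hilbert space $\mathbb{Y}$. A system $(u_\lambda,\mathcal{V}_\lambda^*,\kappa_\lambda)_{\lambda\in\Lambda}$ is a TI-DFD for $\mathbf{K}$ if: (TI1) $(u_\lambda)_{\lambda\in\Lambda}$ is a TI-frame for $L^2(\mathbb{R}^d)$; (TI2) each $\mathcal{V}_\lambda^*$ is a bounded linear operator from $\mathbb{Y}$ to $L^2(\mathbb{R}^d)$, and there are constants $c_1,c_2>0$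 with $c_1\|g\|_{\mathbb{Y}}^2\le\sum_{\lambda\in\Lambda}\|\mathcal{V}_\lambda^*g\|_2^2\le c_2\|g\|_{\mathbb{Y}}^2$ for all $g\in\overline{\operatorname{ran}\mathbf{K}}$; (TI3) for all $\lambda\in\Lambda$, $\kappa_\lambda\in(0,\infty)$ and $\mathcal{V}_\lambda^*(\mathbf{K}f)=\kappa_\lambda\,(u_\lambda^*\ast f)$ for all $f\in\mathcal{D}(\mathbf{K})$. Here $\mathbf{K}=\mathcal{R}$, $d=2$ and $\mathbb{Y}=L^2(\mathbb{S}^1\times\mathbb{R})$. *)

theory Defs
  imports "HOL-Analysis.Analysis"
begin

section \<open>Square integrable functions\<close>

text \<open>
  Elements of \<open>L\<^sup>2(M)\<close> are represented by functions, and identities between them are stated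
  almost everywhere. The squared norm is a nonnegative Lebesgue integral, hence \<open>\<infinity>\<close> (and not a
  junk value) for functions that are not square integrable.
\<close>

definition sqnorm :: "'a measure \<Rightarrow> ('a \<Rightarrow> complex) \<Rightarrow> ennreal" where
  "sqnorm M f = (\<integral>\<^sup>+x. ennreal ((cmod (f x))\<^sup>2) \<partial>M)"

definition L2 :: "'a measure \<Rightarrow> ('a \<Rightarrow> complex) set" where
  "L2 M = {f \<in> borel_measurable M. sqnorm M f < \<infinity>}"

definition Linfty :: "'a measure \<Rightarrow> ('a \<Rightarrow> complex) set" where
  "Linfty M = {f \<in> borel_measurable M. \<exists>C::real. AE x in M. cmod (f x) \<le> C}"

definition L2_tendsto :: "'a measure \<Rightarrow> (nat \<Rightarrow> 'a \<Rightarrow> complex) \<Rightarrow> ('a \<Rightarrow> complex) \<Rightarrow> bool" where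
  "L2_tendsto M F f \<longleftrightarrow> (\<lambda>n. sqnorm M (\<lambda>x. F n x - f x)) \<longlonglongrightarrow> 0"

definition L2_closure :: "'a measure \<Rightarrow> ('a \<Rightarrow> complex) set \<Rightarrow> ('a \<Rightarrow> complex) set" where
  "L2_closure M S = {f \<in> L2 M. \<exists>F. (\<forall>n. F n \<in> S) \<and> L2_tendsto M F f}"

text \<open>
  A linear operator \<open>D \<subseteq> L\<^sup>2(M) \<rightarrow> L\<^sup>2(N)\<close>, the first two lines saying that \<open>D\<close> and \<open>T\<close>
  are well defined on almost-everywhere classes.
\<close>

definition L2_linear_op ::
  "'a measure \<Rightarrow> 'b measure \<Rightarrow> ('a \<Rightarrow> complex) set \<Rightarrow> (('a \<Rightarrow> complex) \<Rightarrow> 'b \<Rightarrow> complex) \<Rightarrow> bool"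
where
  "L2_linear_op M N D T \<longleftrightarrow>
     (\<forall>f\<in>D. \<forall>g\<in>L2 M. (AE x in M. f x = g x) \<longrightarrow> g \<in> D \<and> (AE y in N. T f y = T g y)) \<and>
     D \<subseteq> L2 M \<and> (\<forall>f\<in>D. T f \<in> L2 N) \<and>
     (\<lambda>_. 0) \<in> D \<and>
     (\<forall>f\<in>D. \<forall>g\<in>D. (\<lambda>x. f x + g x) \<in> D \<and>
        (AE y in N. T (\<lambda>x. f x + g x) y = T f y + T g y)) \<and>
     (\<forall>c. \<forall>f\<in>D. (\<lambda>x. c * f x) \<in> D \<and> (AE y in N. T (\<lambda>x. c * f x) y = c * T f y))"

definition L2_closed_op ::
  "'a measure \<Rightarrow> 'b measure \<Rightarrow> ('a \<Rightarrow> complex) set \<Rightarrow> (('a \<Rightarrow> complex) \<Rightarrow> 'b \<Rightarrow> complex) \<Rightarrow> bool"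
where
  "L2_closed_op M N D T \<longleftrightarrow>
     L2_linear_op M N D T \<and>
     (\<forall>F. \<forall>f\<in>L2 M. \<forall>g\<in>L2 N.
        (\<forall>n. F n \<in> D) \<and> L2_tendsto M F f \<and> L2_tendsto N (\<lambda>n. T (F n)) g \<longrightarrow>
        f \<in> D \<and> (AE y in N. T f y = g y))"

definition L2_bounded_op ::
  "'a measure \<Rightarrow> 'b measure \<Rightarrow> (('a \<Rightarrow> complex) \<Rightarrow> 'b \<Rightarrow> complex) \<Rightarrow> bool"
where
  "L2_bounded_op M N T \<longleftrightarrow>
     L2_linear_op M N (L2 M) T \<and>
     (\<exists>C\<ge>0. \<forall>f\<in>L2 M. sqnorm N (T f) \<le> ennreal (C\<^sup>2) * sqnorm M f)"

text \<open>Support of an almost-everywhere class (the usual support for continuous functions).\<close>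

definition ess_support :: "('a::euclidean_space \<Rightarrow> complex) \<Rightarrow> 'a set" where
  "ess_support f = {x. \<forall>U. open U \<and> x \<in> U \<longrightarrow> \<not> (AE y in lborel. y \<in> U \<longrightarrow> f y = 0)}"


section \<open>Fourier transform, involution and convolution on Euclidean space\<close>

definition fourier_integral :: "('a::euclidean_space \<Rightarrow> complex) \<Rightarrow> 'a \<Rightarrow> complex" where
  "fourier_integral f \<xi> = (LINT x|lborel. f x * exp (- (\<i> * complex_of_real (\<xi> \<bullet> x))))"

text \<open>
  The extension by continuity of the Fourier integral from \<open>L\<^sup>1 \<inter> L\<^sup>2\<close> to \<open>L\<^sup>2\<close>. The limit is
  determined up to a null set; since the predicate below only depends on the
  almost-everywhere class of \<open>f\<close>, so does the chosen representative.
\<close>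

definition fourier :: "('a::euclidean_space \<Rightarrow> complex) \<Rightarrow> 'a \<Rightarrow> complex" where
  "fourier f = (SOME g. g \<in> L2 lborel \<and>
     (\<exists>F. (\<forall>n. F n \<in> L2 lborel \<and> integrable lborel (F n)) \<and>
          L2_tendsto lborel F f \<and> L2_tendsto lborel (\<lambda>n. fourier_integral (F n)) g))"

definition fourier_inv :: "('a::euclidean_space \<Rightarrow> complex) \<Rightarrow> 'a \<Rightarrow> complex" where
  "fourier_inv g = (SOME f. f \<in> L2 lborel \<and> (AE \<xi> in lborel. fourier f \<xi> = g \<xi>))"

definition invol :: "('a::euclidean_space \<Rightarrow> complex) \<Rightarrow> 'a \<Rightarrow> complex" where
  "invol u x = cnj (u (- x))"

definition conv :: "('a::euclidean_space \<Rightarrow> complex) \<Rightarrow> ('a \<Rightarrow> complex) \<Rightarrow> 'a \<Rightarrow> complex" where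
  "conv f g x = (LINT y|lborel. f (x - y) * g y)"


section \<open>The cylinder \<open>S\<^sup>1 \<times> \<real>\<close>\<close>

text \<open>Arc length on the unit circle, as the image of Lebesgue measure on \<open>[0, 2\<pi>)\<close>.\<close>

definition circle :: "(real^2) measure" where
  "circle = distr (restrict_space lborel {0..<2 * pi}) (restrict_space borel (sphere 0 1))
              (\<lambda>t. vector [cos t, sin t])"

definition cyl :: "((real^2) \<times> real) measure" where
  "cyl = circle \<Otimes>\<^sub>M lborel"

definition fourier2 :: "((real^2) \<times> real \<Rightarrow> complex) \<Rightarrow> (real^2) \<times> real \<Rightarrow> complex" where
  "fourier2 g = (SOME h. h \<in> L2 cyl \<and>
     (AE \<theta> in circle. AE \<sigma> in lborel. h (\<theta>, \<sigma>) = fourier (\<lambda>s. g (\<theta>, s)) \<sigma>))"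

definition fourier2_inv :: "((real^2) \<times> real \<Rightarrow> complex) \<Rightarrow> (real^2) \<times> real \<Rightarrow> complex" where
  "fourier2_inv h = (SOME g. g \<in> L2 cyl \<and> (AE p in cyl. fourier2 g p = h p))"

definition invol2 :: "((real^2) \<times> real \<Rightarrow> complex) \<Rightarrow> (real^2) \<times> real \<Rightarrow> complex" where
  "invol2 v = (\<lambda>(\<theta>, s). cnj (v (\<theta>, - s)))"

definition conv2 ::
  "((real^2) \<times> real \<Rightarrow> complex) \<Rightarrow> ((real^2) \<times> real \<Rightarrow> complex) \<Rightarrow> (real^2) \<times> real \<Rightarrow> complex"
where
  "conv2 v g = (\<lambda>(\<theta>, s). LINT t|lborel. v (\<theta>, s - t) * g (\<theta>, t))"


section \<open>The Radon transform and related operators\<close>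

text \<open>
  Operators with a domain are \<open>undefined\<close> outside of it, so that statements about their values
  implicitly assert membership in the domain.
\<close>

definition radon_dom :: "(real^2 \<Rightarrow> complex) set" where
  "radon_dom = {f \<in> L2 lborel.
     (\<lambda>\<xi>. complex_of_real (norm \<xi> powr (-1/2)) * fourier f \<xi>) \<in> L2 lborel}"

definition radon :: "(real^2 \<Rightarrow> complex) \<Rightarrow> (real^2) \<times> real \<Rightarrow> complex" where
  "radon = (\<lambda>f\<in>radon_dom. fourier2_inv (\<lambda>(\<theta>, \<sigma>). fourier f (\<sigma> *\<^sub>R \<theta>)))"

definition radon_adj_dom :: "((real^2) \<times> real \<Rightarrow> complex) set" where
  "radon_adj_dom = {g \<in> L2 cyl.
     (\<lambda>(\<theta>, \<sigma>). complex_of_real (\<bar>\<sigma>\<bar> powr (-1/2)) * fourier2 g (\<theta>, \<sigma>)) \<in> L2 cyl}"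

text \<open>
  \<open>\<R>\<^sup>* = F\<inverse> \<circ> B\<^sup>* \<circ> F\<^sub>2\<close>, where \<open>B\<^sup>*\<close> only evaluates its argument at the polar coordinates
  \<open>(\<xi>/\<parallel>\<xi>\<parallel>, \<parallel>\<xi>\<parallel>)\<close> of \<open>\<xi>\<close> and does not add the value at \<open>(-\<xi>/\<parallel>\<xi>\<parallel>, -\<parallel>\<xi>\<parallel>)\<close>. The Hilbert
  space adjoint for arc length on the circle would include the latter term and, the Fourier
  transforms being unnormalised, a factor \<open>2\<pi>\<close>.
\<close>

definition radon_adj :: "((real^2) \<times> real \<Rightarrow> complex) \<Rightarrow> real^2 \<Rightarrow> complex" where
  "radon_adj = (\<lambda>g\<in>radon_adj_dom.
     fourier_inv (\<lambda>\<xi>. complex_of_real (inverse (norm \<xi>)) * fourier2 g (\<xi> /\<^sub>R norm \<xi>, norm \<xi>)))"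

definition riesz_dom :: "((real^2) \<times> real \<Rightarrow> complex) set" where
  "riesz_dom = {g \<in> L2 cyl. (\<lambda>(\<theta>, \<sigma>). complex_of_real \<bar>\<sigma>\<bar> * fourier2 g (\<theta>, \<sigma>)) \<in> L2 cyl}"

definition riesz :: "((real^2) \<times> real \<Rightarrow> complex) \<Rightarrow> (real^2) \<times> real \<Rightarrow> complex" where
  "riesz = (\<lambda>g\<in>riesz_dom.
     fourier2_inv (\<lambda>(\<theta>, \<sigma>). complex_of_real \<bar>\<sigma>\<bar> * fourier2 g (\<theta>, \<sigma>)))"


section \<open>Translation invariant frames and diagonal frame decompositions\<close>

definition TI_frame :: "'i set \<Rightarrow> ('i \<Rightarrow> 'a::euclidean_space \<Rightarrow> complex) \<Rightarrow> bool" where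
  "TI_frame \<Lambda> u \<longleftrightarrow>
     countable \<Lambda> \<and>
     (\<forall>i\<in>\<Lambda>. u i \<in> L2 lborel \<and> fourier (u i) \<in> Linfty lborel) \<and>
     (\<exists>A>0. \<exists>B>0. \<forall>f\<in>L2 lborel.
        ennreal A * sqnorm lborel f \<le> (\<Sum>\<^sub>\<infinity>i\<in>\<Lambda>. sqnorm lborel (conv (invol (u i)) f)) \<and>
        (\<Sum>\<^sub>\<infinity>i\<in>\<Lambda>. sqnorm lborel (conv (invol (u i)) f)) \<le> ennreal B * sqnorm lborel f)"

text \<open>
  The operator \<open>K\<close> has domain \<open>D\<close> and takes values in the Hilbert space \<open>L\<^sup>2(N)\<close>. The standing
  assumption that \<open>K\<close> is a closed linear operator is part of the predicate.
\<close>

definition TI_DFD ::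
  "'y measure \<Rightarrow> ('a::euclidean_space \<Rightarrow> complex) set \<Rightarrow> (('a \<Rightarrow> complex) \<Rightarrow> 'y \<Rightarrow> complex) \<Rightarrow>
   'i set \<Rightarrow> ('i \<Rightarrow> 'a \<Rightarrow> complex) \<Rightarrow> ('i \<Rightarrow> ('y \<Rightarrow> complex) \<Rightarrow> 'a \<Rightarrow> complex) \<Rightarrow> ('i \<Rightarrow> real) \<Rightarrow> bool"
where
  "TI_DFD N D K \<Lambda> u V \<kappa> \<longleftrightarrow>
     L2_closed_op lborel N D K \<and>
     TI_frame \<Lambda> u \<and>
     ((\<forall>i\<in>\<Lambda>. L2_bounded_op N lborel (V i)) \<and>
      (\<exists>c1>0. \<exists>c2>0. \<forall>g\<in>L2_closure N (K ` D).
         ennreal c1 * sqnorm N g \<le> (\<Sum>\<^sub>\<infinity>i\<in>\<Lambda>. sqnorm lborel (V i g)) \<and>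
         (\<Sum>\<^sub>\<infinity>i\<in>\<Lambda>. sqnorm lborel (V i g)) \<le> ennreal c2 * sqnorm N g)) \<and>
     (\<forall>i\<in>\<Lambda>. \<kappa> i > 0 \<and>
        (\<forall>f\<in>D. AE x in lborel. V i (K f) x = complex_of_real (\<kappa> i) * conv (invol (u i)) f x))"

datatype orientation = Horizontal | Vertical | Diagonal

end

theory Submission
  imports Defs "HOL-Probability.Characteristic_Functions"
begin

text \<open>
  On the Fourier side everything is a multiplication operator. Convolution with \<open>u\<^sub>i\<^sup>*\<close> multiplies by
  \<open>cnj U\<^sub>i\<close>, where \<open>U\<^sub>i\<close> is the Fourier transform of \<open>u\<^sub>i\<close>, so the frame inequalities say that
  \<open>A \<le> \<Sum>\<^sub>i \<bar>U\<^sub>i\<bar>\<^sup>2 \<le> B\<close> almost everywhere. The operator \<open>V\<^sub>i\<close> multiplies the transform of \<open>g\<close>,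
  read in polar coordinates, by \<open>2\<^sup>-\<^sup>j\<^sup>/\<^sup>2 cnj U\<^sub>i\<close>: the factors \<open>\<bar>\<sigma>\<bar>\<close> of the Riesz potential and \<open>\<parallel>\<xi>\<parallel>\<^sup>-\<^sup>1\<close> of the adjoint
  cancel. The polar Jacobian then produces the weight \<open>2\<^sup>-\<^sup>j \<sigma>\<close>, which lies in \<open>[a, b]\<close> wherever \<open>U\<^sub>i\<close> does not
  vanish. Transforms of functions in the closure of the range are even on the cylinder, so the half
  \<open>\<sigma> > 0\<close> that polar coordinates see carries half of the norm.
\<close>

section \<open>Square integrable functions\<close>

lemma L2_measurable [measurable_dest]: "f \<in> L2 M \<Longrightarrow> f \<in> borel_measurable M"
  by (simp add: L2_def)

lemma L2_finite: "f \<in> L2 M \<Longrightarrow> sqnorm M f < \<infinity>"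
  by (simp add: L2_def)

lemma sqnorm_cong_AE: "AE x in M. f x = g x \<Longrightarrow> sqnorm M f = sqnorm M g"
  unfolding sqnorm_def by (intro nn_integral_cong_AE) auto

lemma sqnorm_mono_AE: "AE x in M. cmod (f x) \<le> cmod (g x) \<Longrightarrow> sqnorm M f \<le> sqnorm M g"
  unfolding sqnorm_def by (intro nn_integral_mono_AE)
      (auto elim!: eventually_mono intro!: ennreal_leI power_mono)

lemma sqnorm_zero [simp]: "sqnorm M (\<lambda>x. 0) = 0"
  by (simp add: sqnorm_def)

lemma sqnorm_cnj [simp]: "sqnorm M (\<lambda>x. cnj (f x)) = sqnorm M f"
  by (simp add: sqnorm_def)

lemma sqnorm_uminus [simp]: "sqnorm M (\<lambda>x. - f x) = sqnorm M f"
  by (simp add: sqnorm_def)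

lemma sqnorm_minus_commute: "sqnorm M (\<lambda>x. f x - g x) = sqnorm M (\<lambda>x. g x - f x)"
  by (simp add: sqnorm_def norm_minus_commute)

lemma sqnorm_cmult:
  assumes "f \<in> borel_measurable M"
  shows "sqnorm M (\<lambda>x. c * f x) = ennreal ((cmod c)\<^sup>2) * sqnorm M f"
  using assms unfolding sqnorm_def
  by (simp add: norm_mult power_mult_distrib ennreal_mult nn_integral_cmult)

lemma sqnorm_0_iff:
  assumes [measurable]: "f \<in> borel_measurable M"
  shows "sqnorm M f = 0 \<longleftrightarrow> (AE x in M. f x = 0)"
proof -
  have "(AE x in M. ennreal ((cmod (f x))\<^sup>2) = 0) \<longleftrightarrow> (AE x in M. f x = 0)"
    by (intro AE_cong) (auto simp: ennreal_eq_0_iff)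
  thus ?thesis unfolding sqnorm_def by (subst nn_integral_0_iff_AE) auto
qed

lemma norm_add_sq_le: "(cmod (x + y))\<^sup>2 \<le> 2 * (cmod x)\<^sup>2 + 2 * (cmod y)\<^sup>2"
proof -
  have "(cmod (x + y))\<^sup>2 \<le> (cmod x + cmod y)\<^sup>2"
    by (intro power_mono norm_triangle_ineq) auto
  also have "\<dots> \<le> 2 * (cmod x)\<^sup>2 + 2 * (cmod y)\<^sup>2"
    using sum_squares_ge_zero[of "cmod x - cmod y" 0] by (simp add: power2_eq_square algebra_simps)
  finally show ?thesis .
qed

lemma sqnorm_add_le:
  assumes [measurable]: "f \<in> borel_measurable M" "g \<in> borel_measurable M"
  shows "sqnorm M (\<lambda>x. f x + g x) \<le> 2 * sqnorm M f + 2 * sqnorm M g"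
proof -
  have "sqnorm M (\<lambda>x. f x + g x) \<le> (\<integral>\<^sup>+x. 2 * ennreal ((cmod (f x))\<^sup>2)
      + 2 * ennreal ((cmod (g x))\<^sup>2) \<partial>M)"
    unfolding sqnorm_def
  proof (intro nn_integral_mono)
    fix x show "ennreal ((cmod (f x + g x))\<^sup>2) \<le> 2 * ennreal ((cmod (f x))\<^sup>2)
        + 2 * ennreal ((cmod (g x))\<^sup>2)"
      using ennreal_leI[OF norm_add_sq_le[of "f x" "g x"]]
      by (simp add: ennreal_mult)
  qed
  also have "\<dots> = 2 * sqnorm M f + 2 * sqnorm M g"
    unfolding sqnorm_def by (simp add: nn_integral_add nn_integral_cmult)
  finally show ?thesis .
qed

lemma sqnorm_diff_le:
  assumes "f \<in> borel_measurable M" "g \<in> borel_measurable M"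
  shows "sqnorm M (\<lambda>x. f x - g x) \<le> 2 * sqnorm M f + 2 * sqnorm M g"
  using sqnorm_add_le[OF assms(1), of "\<lambda>x. - g x"] assms(2) by simp

lemma sqnorm_triangle3:
  assumes [measurable]: "f \<in> borel_measurable M" "g \<in> borel_measurable M" "h \<in> borel_measurable M"
  shows "sqnorm M (\<lambda>x. f x - h x) \<le> 2 * sqnorm M (\<lambda>x. f x - g x) + 2 * sqnorm M (\<lambda>x. g x - h x)"
  using sqnorm_add_le[of "\<lambda>x. f x - g x" M "\<lambda>x. g x - h x"] by simp

lemma borel_measurable_cnj [measurable (raw)]:
  "f \<in> borel_measurable M \<Longrightarrow> (\<lambda>x. cnj (f x)) \<in> borel_measurable M"
  by (rule measurable_compose[OF _ borel_measurable_continuous_onI[OF continuous_on_cnj[OF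
      continuous_on_id]]])

lemma L2_zero [simp]: "(\<lambda>x. 0) \<in> L2 M"
  by (simp add: L2_def)

lemma L2_add: "f \<in> L2 M \<Longrightarrow> g \<in> L2 M \<Longrightarrow> (\<lambda>x. f x + g x) \<in> L2 M"
  using sqnorm_add_le[of f M g]
  by (auto simp: L2_def ennreal_mult_less_top intro: le_less_trans)

lemma L2_diff: "f \<in> L2 M \<Longrightarrow> g \<in> L2 M \<Longrightarrow> (\<lambda>x. f x - g x) \<in> L2 M"
  using sqnorm_diff_le[of f M g]
  by (auto simp: L2_def ennreal_mult_less_top intro: le_less_trans)

lemma L2_cmult: "f \<in> L2 M \<Longrightarrow> (\<lambda>x. c * f x) \<in> L2 M"
  using sqnorm_cmult[of f M c] by (auto simp: L2_def ennreal_mult_less_top)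

lemma L2_cnj: "f \<in> L2 M \<Longrightarrow> (\<lambda>x. cnj (f x)) \<in> L2 M"
  by (auto simp: L2_def)

lemma L2_dominated:
  assumes "g \<in> L2 M" "f \<in> borel_measurable M" "AE x in M. cmod (f x) \<le> cmod (g x)"
  shows "f \<in> L2 M"
  using sqnorm_mono_AE[OF assms(3)] assms by (auto simp: L2_def intro: le_less_trans)

lemma L2_cong_AE:
  assumes "g \<in> L2 M" "f \<in> borel_measurable M" "AE x in M. f x = g x"
  shows "f \<in> L2 M"
  using sqnorm_cong_AE[OF assms(3)] assms by (auto simp: L2_def)

lemma L2_bounded_mult:
  assumes f: "f \<in> L2 M" and [measurable]: "h \<in> borel_measurable M" and h: "AE x in M. cmod (h x)
      \<le> C"
  shows "(\<lambda>x. h x * f x) \<in> L2 M"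
proof (rule L2_dominated)
  show "(\<lambda>x. complex_of_real \<bar>C\<bar> * f x) \<in> L2 M" by (rule L2_cmult[OF f])
  show "(\<lambda>x. h x * f x) \<in> borel_measurable M" using f by measurable
  show "AE x in M. cmod (h x * f x) \<le> cmod (complex_of_real \<bar>C\<bar> * f x)"
    using h by eventually_elim (auto simp: norm_mult intro!: mult_right_mono)
qed

lemma L2_integrable_sq: "f \<in> L2 M \<Longrightarrow> integrable M (\<lambda>x. (cmod (f x))\<^sup>2)"
  by (auto simp: L2_def integrable_iff_bounded sqnorm_def)

lemma sqnorm_eq_integral: "f \<in> L2 M \<Longrightarrow> sqnorm M f = ennreal (LINT x|M. (cmod (f x))\<^sup>2)"
  unfolding sqnorm_def by (intro nn_integral_eq_integral L2_integrable_sq) auto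

lemma L2_mult_nn_integral:
  assumes f: "f \<in> L2 M" and g: "g \<in> L2 M"
  shows "(\<integral>\<^sup>+x. ennreal (cmod (f x * g x)) \<partial>M)\<^sup>2 \<le> sqnorm M f * sqnorm M g"
proof -
  note [measurable] = f[THEN L2_measurable] g[THEN L2_measurable]
  show ?thesis
    using Cauchy_Schwarz_nn_integral[of "\<lambda>x. ennreal (cmod (f x))" M "\<lambda>x. ennreal (cmod (g x))"]
    by (simp add: sqnorm_def norm_mult ennreal_mult ennreal_power)
qed

lemma L2_mult_integrable:
  assumes f: "f \<in> L2 M" and g: "g \<in> L2 M"
  shows "integrable M (\<lambda>x. f x * g x)"
proof -
  note [measurable] = f[THEN L2_measurable] g[THEN L2_measurable]
  have "sqnorm M f * sqnorm M g < \<infinity>"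
    using f g by (auto simp: L2_def ennreal_mult_less_top)
  hence "(\<integral>\<^sup>+x. ennreal (cmod (f x * g x)) \<partial>M)\<^sup>2 < \<infinity>"
    using L2_mult_nn_integral[OF f g] by (rule le_less_trans[rotated])
  hence "(\<integral>\<^sup>+x. ennreal (cmod (f x * g x)) \<partial>M) < \<infinity>"
    by (auto simp: power2_eq_square ennreal_mult_less_top top.not_eq_extremum[symmetric]
        ennreal_mult_eq_top_iff)
  thus ?thesis by (auto simp: integrable_iff_bounded)
qed

lemma L2_Cauchy_Schwarz:
  assumes f: "f \<in> L2 M" and g: "g \<in> L2 M"
  shows "(ennreal (cmod (LINT x|M. f x * g x)))\<^sup>2 \<le> sqnorm M f * sqnorm M g"
proof -
  have "ennreal (cmod (LINT x|M. f x * g x)) \<le> (\<integral>\<^sup>+x. ennreal (cmod (f x * g x)) \<partial>M)"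
    by (intro integral_norm_bound_ennreal L2_mult_integrable assms)
  from power_mono[OF this, of 2] L2_mult_nn_integral[OF assms] show ?thesis
    by simp
qed

lemma sqnorm_eq_inner:
  assumes f: "f \<in> L2 M"
  shows "complex_of_real (enn2real (sqnorm M f)) = (LINT x|M. f x * cnj (f x))"
proof -
  have "enn2real (sqnorm M f) = (LINT x|M. (cmod (f x))\<^sup>2)"
    by (simp add: sqnorm_eq_integral[OF f])
  hence "complex_of_real (enn2real (sqnorm M f)) = complex_of_real (LINT x|M. (cmod (f x))\<^sup>2)"
    by simp
  also have "\<dots> = (LINT x|M. complex_of_real ((cmod (f x))\<^sup>2))"
    by (rule integral_complex_of_real[symmetric])
  finally show ?thesis by (simp only: complex_norm_square)
qed

lemma sqnorm_conv_enn2real: "f \<in> L2 M \<Longrightarrow> sqnorm M f = ennreal (enn2real (sqnorm M f))"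
  using L2_finite by (metis ennreal_enn2real infinity_ennreal_def)

lemma tendsto_integral_L2_0:
  assumes F: "\<And>n. F n \<in> L2 M" and "L2_tendsto M F (\<lambda>_. 0)"
    and G: "\<And>n. G n \<in> L2 M" and B: "\<And>n. sqnorm M (G n) \<le> ennreal B"
  shows "(\<lambda>n. LINT x|M. F n x * G n x) \<longlonglongrightarrow> 0"
proof -
  have "(\<lambda>n. ennreal B * sqnorm M (F n)) \<longlonglongrightarrow> ennreal B * 0"
    using assms(2) unfolding L2_tendsto_def by (intro ennreal_tendsto_cmult) auto
  hence lim: "(\<lambda>n. sqnorm M (F n) * ennreal B) \<longlonglongrightarrow> 0" by (simp add: mult.commute)
  have "(\<lambda>n. ennreal ((cmod (LINT x|M. F n x * G n x))\<^sup>2)) \<longlonglongrightarrow> 0"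
  proof (rule tendsto_sandwich[OF _ _ tendsto_const lim])
    show "\<forall>\<^sub>F n in sequentially. ennreal ((cmod (LINT x|M. F n x * G n x))\<^sup>2)
        \<le> sqnorm M (F n) * ennreal B"
    proof (intro always_eventually allI)
      fix n show "ennreal ((cmod (LINT x|M. F n x * G n x))\<^sup>2) \<le> sqnorm M (F n) * ennreal B"
        using order_trans[OF L2_Cauchy_Schwarz[OF F[of n] G[of n]] mult_left_mono[OF B[of n]]]
        by (simp add: ennreal_power)
    qed
  qed simp
  hence "(\<lambda>n. (cmod (LINT x|M. F n x * G n x))\<^sup>2) \<longlonglongrightarrow> 0"
    by (subst (asm) ennreal_0[symmetric], subst (asm) tendsto_ennreal_iff) auto
  hence "(\<lambda>n. sqrt ((cmod (LINT x|M. F n x * G n x))\<^sup>2)) \<longlonglongrightarrow> sqrt 0"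
    by (intro tendsto_real_sqrt)
  thus ?thesis by (simp add: tendsto_norm_zero_iff)
qed

lemma L2_tendsto_bounded:
  assumes F: "\<And>n. F n \<in> L2 M" and f: "f \<in> L2 M" and lim: "L2_tendsto M F f"
  shows "\<exists>B. \<forall>n. sqnorm M (F n) \<le> ennreal B"
proof -
  have "\<forall>\<^sub>F n in sequentially. sqnorm M (\<lambda>x. F n x - f x) < 1"
    using lim unfolding L2_tendsto_def by (rule order_tendstoD) simp
  then obtain N where N: "\<And>n. n \<ge> N \<Longrightarrow> sqnorm M (\<lambda>x. F n x - f x) < 1"
    by (auto simp: eventually_sequentially)
  define b where "b = 2 + 2 * sqnorm M f + (\<Sum>n<N. sqnorm M (F n))"
  have "sqnorm M (F n) \<le> b" for n
  proof (cases "n < N")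
    case True
    hence "sqnorm M (F n) \<le> (\<Sum>n<N. sqnorm M (F n))"
      by (intro member_le_sum) auto
    thus ?thesis unfolding b_def by (simp add: add_increasing)
  next
    case False
    have "sqnorm M (F n) \<le> 2 * sqnorm M (\<lambda>x. F n x - f x) + 2 * sqnorm M f"
      using sqnorm_add_le[of "\<lambda>x. F n x - f x" M f] F[of n] f by (simp add: L2_def)
    also have "\<dots> \<le> 2 * 1 + 2 * sqnorm M f"
      using N[of n] False by (intro add_right_mono mult_left_mono) auto
    also have "\<dots> \<le> b" unfolding b_def by (simp add: add_increasing2)
    finally show ?thesis .
  qed
  moreover have "b < \<infinity>"
    unfolding b_def using F f by (auto simp: L2_def ennreal_mult_less_top)
  ultimately show ?thesis
    by (intro exI[of _ "enn2real b"]) (auto)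
qed

lemma L2_tendsto_integral:
  assumes F: "\<And>n. F n \<in> L2 M" and f: "f \<in> L2 M" and lF: "L2_tendsto M F f"
    and G: "\<And>n. G n \<in> L2 M" and g: "g \<in> L2 M" and lG: "L2_tendsto M G g"
  shows "(\<lambda>n. LINT x|M. F n x * G n x) \<longlonglongrightarrow> (LINT x|M. f x * g x)"
proof -
  obtain B where B: "\<And>n. sqnorm M (G n) \<le> ennreal B"
    using L2_tendsto_bounded[OF G g lG] by auto
  have 1: "(\<lambda>n. LINT x|M. (F n x - f x) * G n x) \<longlonglongrightarrow> 0"
    using lF by (intro tendsto_integral_L2_0[OF _ _ G B] L2_diff F f) (auto simp: L2_tendsto_def)
  have 2: "(\<lambda>n. LINT x|M. (G n x - g x) * f x) \<longlonglongrightarrow> 0"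
    using lG f sqnorm_conv_enn2real[OF f]
    by (intro tendsto_integral_L2_0[where B = "enn2real (sqnorm M f)"] L2_diff G g)
        (auto simp: L2_tendsto_def)
  have "(\<lambda>n. (LINT x|M. (F n x - f x) * G n x) + (LINT x|M. (G n x - g x) * f x)
      + (LINT x|M. f x * g x))
      \<longlonglongrightarrow> 0 + 0 + (LINT x|M. f x * g x)"
    by (intro tendsto_add 1 2 tendsto_const)
  moreover have "(LINT x|M. (F n x - f x) * G n x) + (LINT x|M. (G n x - g x) * f x)
      + (LINT x|M. f x * g x)
      = (LINT x|M. F n x * G n x)" for n
  proof -
    have i: "integrable M (\<lambda>x. (F n x - f x) * G n x)" "integrable M (\<lambda>x. (G n x - g x) * f x)"
      "integrable M (\<lambda>x. f x * g x)"
      by (intro L2_mult_integrable L2_diff F f G g)+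
    show ?thesis
      by (subst Bochner_Integration.integral_add[symmetric], intro i, intro i,
          subst Bochner_Integration.integral_add[symmetric], intro
              Bochner_Integration.integrable_add i, intro i,
          intro Bochner_Integration.integral_cong) (auto simp: algebra_simps)
  qed
  ultimately show ?thesis by simp
qed

lemma L2_tendsto_cnj: "L2_tendsto M F f \<Longrightarrow> L2_tendsto M (\<lambda>n x. cnj (F n x)) (\<lambda>x. cnj (f x))"
  unfolding L2_tendsto_def using sqnorm_cnj[of M "\<lambda>x. F _ x - f x"] by simp

lemma L2_tendsto_const: "L2_tendsto M (\<lambda>n. f) f"
  by (simp add: L2_tendsto_def)

lemma L2_tendsto_add:
  assumes [measurable]: "\<And>n. F n \<in> borel_measurable M" "f \<in> borel_measurable M"
    "\<And>n. G n \<in> borel_measurable M" "g \<in> borel_measurable M"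
    and "L2_tendsto M F f" "L2_tendsto M G g"
  shows "L2_tendsto M (\<lambda>n x. F n x + G n x) (\<lambda>x. f x + g x)"
  unfolding L2_tendsto_def
proof (rule tendsto_sandwich[OF _ _ tendsto_const])
  have "(\<lambda>n. 2 * sqnorm M (\<lambda>x. F n x - f x) + 2 * sqnorm M (\<lambda>x. G n x - g x)) \<longlonglongrightarrow> 2 * 0 + 2 * 0"
    using assms(5,6) unfolding L2_tendsto_def
    by (intro tendsto_add ennreal_tendsto_cmult) auto
  thus "(\<lambda>n. 2 * sqnorm M (\<lambda>x. F n x - f x) + 2 * sqnorm M (\<lambda>x. G n x - g x)) \<longlonglongrightarrow> 0" by simp
  show "\<forall>\<^sub>F n in sequentially. sqnorm M (\<lambda>x. F n x + G n x - (f x + g x))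
      \<le> 2 * sqnorm M (\<lambda>x. F n x - f x) + 2 * sqnorm M (\<lambda>x. G n x - g x)"
  proof (intro always_eventually allI)
    fix n
    have "(\<lambda>x. F n x + G n x - (f x + g x)) = (\<lambda>x. (F n x - f x) + (G n x - g x))" by auto
    thus "sqnorm M (\<lambda>x. F n x + G n x - (f x + g x))
      \<le> 2 * sqnorm M (\<lambda>x. F n x - f x) + 2 * sqnorm M (\<lambda>x. G n x - g x)"
      using sqnorm_add_le[of "\<lambda>x. F n x - f x" M "\<lambda>x. G n x - g x"] by simp
  qed
qed simp

lemma L2_tendsto_cmult:
  assumes [measurable]: "\<And>n. F n \<in> borel_measurable M" "f \<in> borel_measurable M"
    and "L2_tendsto M F f"
  shows "L2_tendsto M (\<lambda>n x. c * F n x) (\<lambda>x. c * f x)"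
proof -
  have eq: "sqnorm M (\<lambda>x. c * F n x - c * f x) = ennreal ((cmod c)\<^sup>2)
      * sqnorm M (\<lambda>x. F n x - f x)" for n
    using sqnorm_cmult[of "\<lambda>x. F n x - f x" M c] by (simp add: algebra_simps)
  have "(\<lambda>n. ennreal ((cmod c)\<^sup>2) * sqnorm M (\<lambda>x. F n x - f x)) \<longlonglongrightarrow> ennreal ((cmod c)\<^sup>2) * 0"
    using assms(3) unfolding L2_tendsto_def by (intro ennreal_tendsto_cmult) auto
  thus ?thesis unfolding L2_tendsto_def eq by simp
qed

lemma L2_tendsto_unique:
  assumes [measurable]: "\<And>n. F n \<in> borel_measurable M" "f \<in> borel_measurable M" "g \<in>
      borel_measurable M"
    and lf: "L2_tendsto M F f" and lg: "L2_tendsto M F g"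
  shows "AE x in M. f x = g x"
proof -
  have "(\<lambda>n. 2 * sqnorm M (\<lambda>x. F n x - f x) + 2 * sqnorm M (\<lambda>x. F n x - g x)) \<longlonglongrightarrow> 2 * 0 + 2 * 0"
    using lf lg unfolding L2_tendsto_def by (intro tendsto_add ennreal_tendsto_cmult) auto
  moreover have "sqnorm M (\<lambda>x. f x - g x) \<le> 2 * sqnorm M (\<lambda>x. F n x - f x)
      + 2 * sqnorm M (\<lambda>x. F n x - g x)" for n
    using sqnorm_triangle3[of f M "F n" g] by (simp add: sqnorm_minus_commute)
  ultimately have "sqnorm M (\<lambda>x. f x - g x) \<le> 0"
    by (intro tendsto_le[OF _ _ tendsto_const, of sequentially]) auto
  thus ?thesis by (subst (asm) le_zero_eq, subst (asm) sqnorm_0_iff) auto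
qed

lemma L2_tendsto_dominated:
  assumes [measurable]: "\<And>n. F n \<in> borel_measurable M" "f \<in> borel_measurable M" and g: "g \<in> L2 M"
    and bound: "\<And>n. AE x in M. cmod (F n x - f x) \<le> cmod (g x)"
    and lim: "AE x in M. (\<lambda>n. F n x) \<longlonglongrightarrow> f x"
  shows "L2_tendsto M F f"
proof -
  have [measurable]: "g \<in> borel_measurable M" using g by (rule L2_measurable)
  have "(\<lambda>n. \<integral>\<^sup>+x. ennreal ((cmod (F n x - f x))\<^sup>2) \<partial>M) \<longlonglongrightarrow> (\<integral>\<^sup>+x. 0 \<partial>M)"
  proof (rule nn_integral_dominated_convergence[where w = "\<lambda>x. ennreal ((cmod (g x))\<^sup>2)"])
    show "\<And>j. AE x in M. ennreal ((cmod (F j x - f x))\<^sup>2) \<le> ennreal ((cmod (g x))\<^sup>2)"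
      using bound by (auto elim!: eventually_mono intro!: ennreal_leI power_mono)
    show "(\<integral>\<^sup>+ x. ennreal ((cmod (g x))\<^sup>2) \<partial>M) < \<infinity>" using L2_finite[OF g] by (simp add: sqnorm_def)
    show "AE x in M. (\<lambda>i. ennreal ((cmod (F i x - f x))\<^sup>2)) \<longlonglongrightarrow> 0"
      using lim
    proof eventually_elim
      case (elim x)
      hence "(\<lambda>i. ennreal ((cmod (F i x - f x))\<^sup>2)) \<longlonglongrightarrow> ennreal ((cmod (f x - f x))\<^sup>2)"
        by (intro tendsto_intros)
      thus ?case by simp
    qed
  qed auto
  thus ?thesis by (simp add: L2_tendsto_def sqnorm_def)
qed

lemma nn_integral_subseq_AE:
  assumes [measurable]: "\<And>n. f n \<in> borel_measurable M"
    and lim: "(\<lambda>n. \<integral>\<^sup>+x. f n x \<partial>M) \<longlonglongrightarrow> 0"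
  shows "\<exists>r. strict_mono r \<and> (AE x in M. (\<lambda>n. f (r n) x) \<longlonglongrightarrow> 0)"
proof -
  have "\<exists>r. strict_mono r \<and> (\<forall>n. (\<integral>\<^sup>+x. f (r n) x \<partial>M) < ennreal ((1/2) ^ n))"
  proof -
    have ex: "\<exists>m\<ge>k. (\<integral>\<^sup>+x. f m x \<partial>M) < ennreal ((1/2) ^ n)" for n k
    proof -
      have "\<forall>\<^sub>F m in sequentially. (\<integral>\<^sup>+x. f m x \<partial>M) < ennreal ((1/2) ^ n)"
        using lim by (rule order_tendstoD) simp
      from eventually_conj[OF this eventually_ge_at_top[of k]] show ?thesis
        by (auto simp: eventually_sequentially)
    qed
    have "\<exists>r. \<forall>n. (\<integral>\<^sup>+x. f (r n) x \<partial>M) < ennreal ((1/2) ^ n) \<and> r n < r (Suc n)"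
    proof (rule dependent_nat_choice)
      show "\<exists>m. (\<integral>\<^sup>+x. f m x \<partial>M) < ennreal ((1/2) ^ 0)" using ex by blast
      fix x n show "\<exists>y. (\<integral>\<^sup>+ x. f y x \<partial>M) < ennreal ((1 / 2) ^ Suc n) \<and> x < y"
        using ex[of "Suc x" "Suc n"] by (auto simp: Suc_le_eq)
    qed
    thus ?thesis by (auto simp: strict_mono_Suc_iff)
  qed
  then obtain r where r: "strict_mono r" "\<And>n. (\<integral>\<^sup>+x. f (r n) x \<partial>M) < ennreal ((1/2) ^ n)" by auto
  have "(\<integral>\<^sup>+x. (\<Sum>n. f (r n) x) \<partial>M) = (\<Sum>n. \<integral>\<^sup>+x. f (r n) x \<partial>M)"
    by (intro nn_integral_suminf) auto
  also have "\<dots> \<le> (\<Sum>n. ennreal ((1/2) ^ n))"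
    using r by (intro suminf_le) (auto intro: less_imp_le)
  also have "\<dots> < \<infinity>"
    by (subst suminf_ennreal2) (auto intro!: summable_geometric)
  finally have "AE x in M. (\<Sum>n. f (r n) x) \<noteq> \<infinity>"
    by (intro nn_integral_PInf_AE) auto
  hence "AE x in M. (\<lambda>n. f (r n) x) \<longlonglongrightarrow> 0"
  proof eventually_elim
    case (elim x)
    have "summable (\<lambda>n. enn2real (f (r n) x))" and fin: "\<And>n. f (r n) x \<noteq> \<infinity>"
    proof -
      show fin: "f (r n) x \<noteq> \<infinity>" for n
        using elim sum_le_suminf[of "\<lambda>n. f (r n) x" "{n}"] by (auto simp: top_unique)
      hence "(\<Sum>n. ennreal (enn2real (f (r n) x))) \<noteq> \<infinity>"
        using elim by (simp add: less_top)
      thus "summable (\<lambda>n. enn2real (f (r n) x))" by (intro summable_suminf_not_top) auto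
    qed
    hence "(\<lambda>n. ennreal (enn2real (f (r n) x))) \<longlonglongrightarrow> ennreal 0"
      by (intro tendsto_ennrealI summable_LIMSEQ_zero)
    thus ?case using fin by (simp add: top.not_eq_extremum)
  qed
  thus ?thesis using r by blast
qed

lemma ennreal_Cauchy_fast:
  fixes d :: "nat \<Rightarrow> nat \<Rightarrow> ennreal"
  assumes "\<And>e. e > 0 \<Longrightarrow> \<exists>K. \<forall>m\<ge>K. \<forall>n\<ge>K. d m n < ennreal e"
  shows "\<exists>r. strict_mono r \<and> (\<forall>n. d (r (Suc n)) (r n) < ennreal ((1/4) ^ n))"
proof -
  obtain K where K: "\<And>e m n. e > 0 \<Longrightarrow> m \<ge> K e \<Longrightarrow> n \<ge> K e \<Longrightarrow> d m n < ennreal e"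
    using assms by metis
  have "\<exists>r. \<forall>n. r n \<ge> K ((1/4) ^ n) \<and> r n < r (Suc n)"
  proof (rule dependent_nat_choice)
    show "\<exists>x. K ((1/4) ^ 0) \<le> x" by blast
    fix x n :: nat show "\<exists>y::nat. K ((1 / 4) ^ Suc n) \<le> y \<and> x < y"
      by (rule exI[of _ "max (K ((1 / 4) ^ Suc n)) (Suc x)"]) auto
  qed
  then obtain r where r: "\<And>n. r n \<ge> K ((1/4) ^ n)" "\<And>n. r n < r (Suc n)" by auto
  have "d (r (Suc n)) (r n) < ennreal ((1/4) ^ n)" for n
    using r(1)[of n] r(2)[of n] by (intro K) auto
  thus ?thesis using r(2) by (auto simp: strict_mono_Suc_iff)
qed

text \<open>
  Along a subsequence whose increments \<open>D n\<close> satisfy \<open>\<parallel>D n\<parallel>\<^sup>2 < 4\<^sup>-\<^sup>n\<close>, the sum of \<open>2\<^sup>n \<bar>D n\<bar>\<^sup>2\<close> is integrable,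
  hence \<open>D n\<close> decays geometrically almost everywhere.
\<close>

lemma L2_complete:
  assumes F: "\<And>n. F n \<in> L2 M"
    and Cauchy: "\<And>e. e > 0 \<Longrightarrow> \<exists>K. \<forall>m\<ge>K. \<forall>n\<ge>K. sqnorm M (\<lambda>x. F m x - F n x) < ennreal e"
  shows "\<exists>f\<in>L2 M. L2_tendsto M F f"
proof -
  note [measurable] = F[THEN L2_measurable]
  obtain r where r: "strict_mono r" "\<And>n. sqnorm M (\<lambda>x. F (r (Suc n)) x - F (r n) x)
      < ennreal ((1/4) ^ n)"
    using ennreal_Cauchy_fast[OF Cauchy] by auto
  define D where "D n x = F (r (Suc n)) x - F (r n) x" for n x
  have [measurable]: "D n \<in> borel_measurable M" for n unfolding D_def by measurable
  have "(\<integral>\<^sup>+x. (\<Sum>n. ennreal (2 ^ n * (cmod (D n x))\<^sup>2)) \<partial>M)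
      = (\<Sum>n. \<integral>\<^sup>+x. ennreal (2 ^ n * (cmod (D n x))\<^sup>2) \<partial>M)"
    by (intro nn_integral_suminf) auto
  also have "\<dots> \<le> (\<Sum>n. ennreal ((1/2) ^ n))"
  proof (intro suminf_le)
    fix n
    have "(\<integral>\<^sup>+x. ennreal (2 ^ n * (cmod (D n x))\<^sup>2) \<partial>M) = ennreal (2 ^ n) * sqnorm M (D n)"
      unfolding sqnorm_def by (simp add: ennreal_mult nn_integral_cmult)
    also have "\<dots> \<le> ennreal (2 ^ n) * ennreal ((1/4) ^ n)"
      using r(2)[of n] unfolding D_def by (intro mult_left_mono) auto
    also have "\<dots> = ennreal ((1/2) ^ n)"
      by (subst ennreal_mult[symmetric]) (auto simp flip: power_mult_distrib)
    finally show "(\<integral>\<^sup>+x. ennreal (2 ^ n * (cmod (D n x))\<^sup>2) \<partial>M) \<le> ennreal ((1/2) ^ n)" .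
  qed auto
  also have "\<dots> < \<infinity>"
    by (subst suminf_ennreal2) (auto intro!: summable_geometric)
  finally have "AE x in M. (\<Sum>n. ennreal (2 ^ n * (cmod (D n x))\<^sup>2)) \<noteq> \<infinity>"
    by (intro nn_integral_PInf_AE) auto
  hence conv: "AE x in M. convergent (\<lambda>n. F (r n) x)"
  proof eventually_elim
    case (elim x)
    have s: "summable (\<lambda>n. 2 ^ n * (cmod (D n x))\<^sup>2)"
      using elim by (intro summable_suminf_not_top) auto
    have "(\<lambda>n. 2 ^ n * (cmod (D n x))\<^sup>2) \<longlonglongrightarrow> 0"
      using summable_LIMSEQ_zero[OF s] .
    hence "Bseq (\<lambda>n. 2 ^ n * (cmod (D n x))\<^sup>2)"
      by (intro convergent_imp_Bseq) (auto simp: convergent_def)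
    then obtain C where C: "C > 0" "\<And>n. 2 ^ n * (cmod (D n x))\<^sup>2 \<le> C"
      by (auto simp: Bseq_def)
    have "summable (\<lambda>n. sqrt C * (sqrt (1/2)) ^ n)"
      by (intro summable_mult summable_geometric) (auto simp: real_sqrt_divide)
    hence "summable (\<lambda>n. D n x)"
    proof (rule summable_comparison_test'[where N = 0])
      fix n :: nat
      have "(cmod (D n x))\<^sup>2 \<le> C * (1/2) ^ n"
        using C(2)[of n] by (simp add: field_simps power_divide)
      hence "sqrt ((cmod (D n x))\<^sup>2) \<le> sqrt (C * (1/2) ^ n)" by (rule real_sqrt_le_mono)
      thus "norm (D n x) \<le> sqrt C * (sqrt (1/2)) ^ n"
        by (simp add: real_sqrt_mult real_sqrt_power)
    qed
    hence "convergent (\<lambda>n. \<Sum>k<n. D k x)"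
      by (simp add: summable_iff_convergent)
    hence "convergent (\<lambda>n. F (r 0) x + (\<Sum>k<n. D k x))"
      by (intro convergent_add convergent_const)
    moreover have "F (r 0) x + (\<Sum>k<n. D k x) = F (r n) x" for n
      using sum_lessThan_telescope[of "\<lambda>k. F (r k) x" n] by (simp add: D_def)
    ultimately show ?case by simp
  qed
  define f where "f x = lim (\<lambda>n. F (r n) x)" for x
  have [measurable]: "f \<in> borel_measurable M"
    unfolding f_def by measurable
  have lim: "AE x in M. (\<lambda>n. F (r n) x) \<longlonglongrightarrow> f x"
    using conv by eventually_elim (simp add: f_def convergent_LIMSEQ_iff)
  have bnd: "sqnorm M (\<lambda>x. F m x - f x) \<le> ennreal e" if "e > 0" "\<And>n. n \<ge> K
      \<Longrightarrow> sqnorm M (\<lambda>x. F m x - F n x) < ennreal e" for m K e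
  proof -
    have "sqnorm M (\<lambda>x. F m x - f x) = (\<integral>\<^sup>+x. liminf (\<lambda>n.
        ennreal ((cmod (F m x - F (r n) x))\<^sup>2)) \<partial>M)"
      unfolding sqnorm_def
    proof (intro nn_integral_cong_AE)
      show "AE x in M. ennreal ((cmod (F m x - f x))\<^sup>2)
          = liminf (\<lambda>n. ennreal ((cmod (F m x - F (r n) x))\<^sup>2))"
        using lim
      proof eventually_elim
        case (elim x)
        hence "(\<lambda>n. ennreal ((cmod (F m x - F (r n) x))\<^sup>2)) \<longlonglongrightarrow> ennreal ((cmod (F m x - f x))\<^sup>2)"
          by (intro tendsto_intros)
        thus ?case using lim_imp_Liminf by (metis sequentially_bot)
      qed
    qed
    also have "\<dots> \<le> liminf (\<lambda>n. sqnorm M (\<lambda>x. F m x - F (r n) x))"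
      unfolding sqnorm_def by (intro nn_integral_liminf) auto
    also have "\<dots> \<le> ennreal e"
    proof (rule Liminf_le)
      show "\<forall>\<^sub>F n in sequentially. sqnorm M (\<lambda>x. F m x - F (r n) x) \<le> ennreal e"
        using eventually_ge_at_top[of K]
      proof eventually_elim
        case (elim n)
        have "K \<le> r n" using elim seq_suble[OF r(1), of n] by simp
        thus ?case using that(2) by (intro less_imp_le)
      qed
    qed auto
    finally show ?thesis .
  qed
  have tends: "L2_tendsto M F f"
    unfolding L2_tendsto_def
  proof (rule order_tendstoI)
    fix a :: ennreal assume a: "0 < a"
    then obtain e where e: "e > 0" "ennreal e < a"
      by (metis ennreal_less_zero_iff infinity_ennreal_def less_imp_le dense ennreal_cases
          neq_top_trans order.strict_trans top.not_eq_extremum)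
    obtain K where "\<And>m n. m \<ge> K \<Longrightarrow> n \<ge> K \<Longrightarrow> sqnorm M (\<lambda>x. F m x - F n x) < ennreal e"
      using Cauchy[OF e(1)] by auto
    hence "sqnorm M (\<lambda>x. F m x - f x) \<le> ennreal e" if "m \<ge> K" for m
      using that by (intro bnd[OF e(1)]) auto
    thus "\<forall>\<^sub>F n in sequentially. sqnorm M (\<lambda>x. F n x - f x) < a"
      using e(2) by (auto simp: eventually_sequentially intro: le_less_trans)
  qed auto
  have "f \<in> L2 M"
  proof -
    obtain K where K: "\<And>m n. m \<ge> K \<Longrightarrow> n \<ge> K \<Longrightarrow> sqnorm M (\<lambda>x. F m x - F n x) < ennreal 1"
      using Cauchy[of 1] by auto
    have "sqnorm M (\<lambda>x. F K x - f x) \<le> ennreal 1"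
      using K by (intro bnd[of 1 K K]) auto
    hence "(\<lambda>x. F K x - f x) \<in> L2 M" by (auto simp: L2_def intro: le_less_trans)
    from L2_diff[OF F[of K] this] show ?thesis by simp
  qed
  thus ?thesis using tends by blast
qed

section \<open>The Fourier integral and Gaussian regularisation\<close>

lemma nn_integral_lborel_affine:
  fixes t :: "'a::euclidean_space"
  assumes [measurable]: "f \<in> borel_measurable borel" and c: "c \<noteq> 0"
  shows "(\<integral>\<^sup>+x. f x \<partial>lborel) = ennreal (\<bar>c\<bar> ^ DIM('a)) * (\<integral>\<^sup>+x. f (t + c *\<^sub>R x) \<partial>lborel)"
  by (subst lborel_affine[OF c, of t]) (simp add: nn_integral_density nn_integral_distr
      nn_integral_cmult)

lemma integrable_lborel_affine:
  fixes t :: "'a::euclidean_space" and f :: "'a \<Rightarrow> 'b::{banach, second_countable_topology}"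
  assumes f: "integrable lborel f" and c: "c \<noteq> 0"
  shows "integrable lborel (\<lambda>x. f (t + c *\<^sub>R x))"
proof -
  have [measurable]: "f \<in> borel_measurable borel" using borel_measurable_integrable[OF f] by simp
  have "(\<integral>\<^sup>+x. ennreal (norm (f x)) \<partial>lborel) < \<infinity>" using f by (simp add: integrable_iff_bounded)
  hence "ennreal (\<bar>c\<bar> ^ DIM('a)) * (\<integral>\<^sup>+x. ennreal (norm (f (t + c *\<^sub>R x))) \<partial>lborel) < \<infinity>"
    by (subst (asm) nn_integral_lborel_affine[OF _ c, where t = t]) auto
  thus ?thesis using c by (auto simp: integrable_iff_bounded ennreal_mult_less_top)
qed

lemma integral_lborel_affine:
  fixes t :: "'a::euclidean_space" and f :: "'a \<Rightarrow> 'b::{banach, second_countable_topology}"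
  assumes f: "f \<in> borel_measurable borel" and c: "c \<noteq> 0"
  shows "(LINT x|lborel. f x) = \<bar>c\<bar> ^ DIM('a) *\<^sub>R (LINT x|lborel. f (t + c *\<^sub>R x))"
  using f c by (subst lborel_affine[OF c, of t]) (simp add: integral_density integral_distr)

lemma sqnorm_lborel_affine:
  fixes t :: "'a::euclidean_space"
  assumes [measurable]: "f \<in> borel_measurable borel" and c: "c \<noteq> 0"
  shows "sqnorm lborel f = ennreal (\<bar>c\<bar> ^ DIM('a)) * sqnorm lborel (\<lambda>x. f (t + c *\<^sub>R x))"
  unfolding sqnorm_def by (rule nn_integral_lborel_affine[OF _ c]) simp

lemma L2_lborel_affine:
  fixes t :: "'a::euclidean_space"
  assumes f: "f \<in> L2 lborel" and c: "c \<noteq> 0"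
  shows "(\<lambda>x. f (t + c *\<^sub>R x)) \<in> L2 lborel"
proof -
  have [measurable]: "f \<in> borel_measurable borel" using L2_measurable[OF f] by simp
  have "sqnorm lborel f < \<infinity>" using f by (simp add: L2_def)
  hence "ennreal (\<bar>c\<bar> ^ DIM('a)) * sqnorm lborel (\<lambda>x. f (t + c *\<^sub>R x)) < \<infinity>"
    by (subst (asm) sqnorm_lborel_affine[OF _ c, where t = t]) auto
  thus ?thesis using c by (auto simp: L2_def ennreal_mult_less_top)
qed

lemma AE_lborel_affine:
  fixes t :: "'a::euclidean_space"
  assumes P: "AE x in lborel. P x" and c: "c \<noteq> 0"
  shows "AE x in lborel. P (t + c *\<^sub>R x)"
proof -
  obtain N where N: "N \<in> null_sets lborel" "{x. \<not> P x} \<subseteq> N"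
    using P by (auto simp: eventually_ae_filter)
  have [measurable]: "N \<in> sets borel" using N by auto
  have "emeasure lborel N = 0" using N by auto
  hence "(\<integral>\<^sup>+x. indicator N x \<partial>lborel) = 0" by simp
  hence "ennreal (\<bar>c\<bar> ^ DIM('a)) * (\<integral>\<^sup>+x. indicator N (t + c *\<^sub>R x) \<partial>lborel) = 0"
    by (subst (asm) nn_integral_lborel_affine[OF _ c, where t = t]) auto
  moreover have "ennreal (\<bar>c\<bar> ^ DIM('a)) \<noteq> 0" using c by (simp add: ennreal_eq_0_iff not_le)
  ultimately have "(\<integral>\<^sup>+x. indicator N (t + c *\<^sub>R x) \<partial>lborel) = (0::ennreal)"
    using mult_eq_0_iff by blast
  hence "AE x in lborel. indicator N (t + c *\<^sub>R x) = (0::ennreal)"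
    by (subst (asm) nn_integral_0_iff_AE) auto
  thus ?thesis by eventually_elim (use N in \<open>auto simp: indicator_def split: if_splits\<close>)
qed

abbreviation fexp :: "'a::euclidean_space \<Rightarrow> 'a \<Rightarrow> complex" where
  "fexp \<xi> x \<equiv> exp (- (\<i> * complex_of_real (\<xi> \<bullet> x)))"

lemma cmod_fexp [simp]: "cmod (fexp \<xi> x) = 1"
  by (simp add: norm_exp_eq_Re)

lemma integrable_mult_fexp:
  assumes f: "integrable lborel f"
  shows "integrable lborel (\<lambda>x. f x * fexp \<xi> x)"
proof -
  note [measurable] = borel_measurable_integrable[OF f]
  show ?thesis by (rule Bochner_Integration.integrable_bound[OF f]) (auto simp: norm_mult)
qed

lemma fourier_integral_measurable [measurable]:
  fixes f :: "'a::euclidean_space \<Rightarrow> complex"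
  assumes [measurable]: "f \<in> borel_measurable borel"
  shows "fourier_integral f \<in> borel_measurable borel"
proof -
  have "(\<lambda>\<xi>. LINT x|lborel. f x * fexp \<xi> x) \<in> borel_measurable lborel"
    by (rule lborel.borel_measurable_lebesgue_integral) measurable
  thus ?thesis by (simp add: fourier_integral_def[abs_def])
qed

lemma fourier_integral_bound:
  assumes f: "integrable lborel f"
  shows "cmod (fourier_integral f \<xi>) \<le> (LINT x|lborel. cmod (f x))"
proof -
  have "cmod (fourier_integral f \<xi>) \<le> (LINT x|lborel. cmod (f x * fexp \<xi> x))"
    unfolding fourier_integral_def by (rule integral_norm_bound)
  thus ?thesis by (simp add: norm_mult)
qed

lemma fourier_integral_mult_formula:
  fixes f h :: "'a::euclidean_space \<Rightarrow> complex"
  assumes f: "integrable lborel f" and h: "integrable lborel h"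
  shows "(LINT \<xi>|lborel. fourier_integral f \<xi> * h \<xi>) = (LINT x|lborel. f x * fourier_integral h x)"
proof -
  have [measurable]: "f \<in> borel_measurable borel" "h \<in> borel_measurable borel"
    using borel_measurable_integrable[OF f] borel_measurable_integrable[OF h] by auto
  let ?g = "\<lambda>(x, \<xi>). f x * h \<xi> * fexp \<xi> x"
  have int: "integrable (lborel \<Otimes>\<^sub>M lborel) ?g"
  proof (rule lborel_pair.Fubini_integrable)
    show "?g \<in> borel_measurable (lborel \<Otimes>\<^sub>M lborel)" by measurable
    have "integrable lborel (\<lambda>x. cmod (f x) * (LINT \<xi>|lborel. cmod (h \<xi>)))"
      using f by (intro integrable_mult_left) auto
    thus "integrable lborel (\<lambda>x. LINT y|lborel. cmod (case (x, y) of (x, \<xi>) \<Rightarrow> f x * h \<xi>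
        * fexp \<xi> x))"
      by (simp add: norm_mult)
    show "AE x in lborel. integrable lborel (\<lambda>y. case (x, y) of (x, \<xi>) \<Rightarrow> f x * h \<xi> * fexp \<xi> x)"
    proof (intro AE_I2)
      fix x
      have "integrable lborel (\<lambda>\<xi>. f x * (h \<xi> * fexp x \<xi>))"
        by (intro integrable_mult_right integrable_mult_fexp h)
      thus "integrable lborel (\<lambda>y. case (x, y) of (x, \<xi>) \<Rightarrow> f x * h \<xi> * fexp \<xi> x)"
        by (simp add: mult.assoc inner_commute)
    qed
  qed
  have "(LINT \<xi>|lborel. fourier_integral f \<xi> * h \<xi>)
      = (LINT \<xi>|lborel. LINT x|lborel. f x * h \<xi> * fexp \<xi> x)"
    unfolding fourier_integral_def
    by (subst integral_mult_left_zero[symmetric]) (simp add: algebra_simps)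
  also have "\<dots> = (LINT x|lborel. LINT \<xi>|lborel. f x * h \<xi> * fexp \<xi> x)"
    by (rule lborel_pair.Fubini_integral[OF int])
  also have "\<dots> = (LINT x|lborel. f x * fourier_integral h x)"
    unfolding fourier_integral_def
    by (subst integral_mult_right_zero[symmetric]) (simp add: algebra_simps inner_commute)
  finally show ?thesis .
qed

lemma cnj_fourier_integral:
  assumes [measurable]: "g \<in> borel_measurable borel"
  shows "fourier_integral (invol g) \<xi> = cnj (fourier_integral g \<xi>)"
proof -
  have "cnj (fourier_integral g \<xi>) = (LINT x|lborel. cnj (g x * fexp \<xi> x))"
    unfolding fourier_integral_def by (rule Bochner_Integration.integral_cnj[symmetric])
  also have "\<dots> = (LINT x|lborel. cnj (g x) * exp (\<i> * complex_of_real (\<xi> \<bullet> x)))"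
    by (simp add: exp_cnj)
  also have "\<dots> = \<bar>-1\<bar> ^ DIM('a) *\<^sub>R (LINT x|lborel. cnj (g (0
      + (-1) *\<^sub>R x)) * exp (\<i> * complex_of_real (\<xi> \<bullet> (0 + (-1) *\<^sub>R x))))"
    by (rule integral_lborel_affine) auto
  also have "\<dots> = fourier_integral (invol g) \<xi>"
    by (simp add: fourier_integral_def invol_def)
  finally show ?thesis by simp
qed

definition gaussian :: "'a::euclidean_space \<Rightarrow> real" where
  "gaussian z = (\<Prod>b\<in>Basis. std_normal_density (z \<bullet> b))"

lemma gaussian_eq: "gaussian (z::'a::euclidean_space)
    = (1 / sqrt (2 * pi)) ^ DIM('a) * exp (- (norm z)\<^sup>2 / 2)"
proof -
  have "(norm z)\<^sup>2 = (\<Sum>b\<in>Basis. (z \<bullet> b)\<^sup>2)"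
    unfolding power2_norm_eq_inner by (subst euclidean_inner) (simp add: power2_eq_square)
  thus ?thesis
    unfolding gaussian_def std_normal_density_def prod.distrib
    by (simp add: exp_sum[symmetric] sum_divide_distrib sum_negf)
qed

lemma gaussian_nonneg [simp]: "gaussian z \<ge> 0"
  by (simp add: gaussian_eq)

lemma gaussian_measurable [measurable]: "gaussian \<in> borel_measurable borel"
  unfolding gaussian_eq[abs_def] by measurable

lemma nn_integral_gaussian: "(\<integral>\<^sup>+z. ennreal (gaussian (z::'a::euclidean_space)) \<partial>lborel) = 1"
proof -
  have "(\<integral>\<^sup>+x. ennreal (std_normal_density x) \<partial>lborel) = 1"
    by (subst nn_integral_eq_integral) (auto intro: integrable_normal_density simp:
        integral_normal_density)
  moreover have "(\<integral>\<^sup>+z. ennreal (gaussian (z::'a)) \<partial>lborel)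
      = (\<integral>\<^sup>+z. (\<Prod>b\<in>Basis. ennreal (std_normal_density (z \<bullet> (b::'a)))) \<partial>lborel)"
    by (simp add: gaussian_def prod_ennreal)
  ultimately show ?thesis
    by (simp add: nn_integral_lborel_prod[where f = "\<lambda>_ x. ennreal (std_normal_density x)"])
qed

lemma integrable_gaussian: "integrable lborel (gaussian :: 'a::euclidean_space \<Rightarrow> real)"
  by (auto simp: integrable_iff_bounded nn_integral_gaussian)

lemma fourier_integral_gaussian:
  fixes t :: "'a::euclidean_space"
  shows "fourier_integral (\<lambda>z. complex_of_real (gaussian z)) t
      = complex_of_real (exp (- (norm t)\<^sup>2 / 2))"
proof -
  interpret product_sigma_finite "\<lambda>_::'a. lborel::real measure" ..
  have one: "(LINT x|lborel. complex_of_real (std_normal_density x) * exp (- (\<i>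
      * complex_of_real (s * x))))
      = complex_of_real (exp (- s\<^sup>2 / 2))" for s
  proof -
    have "complex_of_real (exp (- (-s)\<^sup>2 / 2)) = (LINT x|std_normal_distribution. iexp ((-s) * x))"
      using fun_cong[OF char_std_normal_distribution, of "-s"] by (simp add: char_def)
    also have "\<dots> = (LINT x|lborel. std_normal_density x *\<^sub>R iexp ((-s) * x))"
      by (subst integral_density) auto
    finally show ?thesis by (simp add: scaleR_conv_of_real)
  qed
  have int: "integrable lborel (\<lambda>x. complex_of_real (std_normal_density x) * exp (- (\<i>
      * complex_of_real (s * x))))" for s
    by (rule Bochner_Integration.integrable_bound[OF integrable_normal_density[of 1 0]])
       (auto simp: norm_mult norm_exp_eq_Re)
  have "fourier_integral (\<lambda>z. complex_of_real (gaussian z)) t =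
     (LINT z|lborel. (\<Prod>b\<in>Basis. complex_of_real (std_normal_density (z \<bullet> b)) * exp (- (\<i>
         * complex_of_real ((t \<bullet> b) * (z \<bullet> b))))))"
    unfolding fourier_integral_def
  proof (intro Bochner_Integration.integral_cong refl)
    fix z :: 'a
    have "t \<bullet> z = (\<Sum>b\<in>Basis. (t \<bullet> b) * (z \<bullet> b))" by (rule euclidean_inner)
    thus "complex_of_real (gaussian z) * fexp t z = (\<Prod>b\<in>Basis.
        complex_of_real (std_normal_density (z \<bullet> b)) * exp (- (\<i> * complex_of_real ((t \<bullet> b)
        * (z \<bullet> b)))))"
      by (simp add: gaussian_def prod.distrib exp_sum[symmetric] sum_distrib_left sum_negf)
  qed
  also have "\<dots> = (LINT f|(\<Pi>\<^sub>M b\<in>Basis. lborel). (\<Prod>b\<in>Basis.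
      complex_of_real (std_normal_density (f b)) * exp (- (\<i> * complex_of_real ((t \<bullet> b) * f b)))))"
    by (subst lborel_eq, subst integral_distr) (auto simp: inner_sum_left inner_Basis if_distrib
        cong: if_cong)
  also have "\<dots> = (\<Prod>b\<in>Basis. (LINT x|lborel. complex_of_real (std_normal_density x) * exp (- (\<i>
      * complex_of_real ((t \<bullet> b) * x)))))"
    by (rule product_integral_prod[OF finite_Basis int])
  also have "\<dots> = complex_of_real (\<Prod>b\<in>Basis. exp (- (t \<bullet> b)\<^sup>2 / 2))"
    by (simp only: one of_real_prod)
  also have "(\<Prod>b\<in>Basis. exp (- (t \<bullet> b)\<^sup>2 / 2)) = exp (- (norm t)\<^sup>2 / 2)"
  proof -
    have "(norm t)\<^sup>2 = (\<Sum>b\<in>Basis. (t \<bullet> b)\<^sup>2)"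
      unfolding power2_norm_eq_inner by (subst euclidean_inner) (simp add: power2_eq_square)
    thus ?thesis by (simp add: exp_sum[symmetric] sum_divide_distrib sum_negf)
  qed
  finally show ?thesis .
qed

lemma fourier_integral_scaled_gaussian:
  fixes x :: "'a::euclidean_space"
  assumes s: "s > 0"
  shows "fourier_integral (\<lambda>\<xi>. complex_of_real (exp (- (norm (s *\<^sub>R \<xi>))\<^sup>2 / 2))) x
       = complex_of_real ((2 * pi) ^ DIM('a) / s ^ DIM('a) * gaussian (x /\<^sub>R s))"
proof -
  define k where "k = sqrt (2 * pi) ^ DIM('a)"
  have k: "k * k = (2 * pi) ^ DIM('a)" "k > 0"
    unfolding k_def by (subst power_mult_distrib[symmetric]) simp_all
  have g: "exp (- (norm z)\<^sup>2 / 2) = k * gaussian z" for z :: 'a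
    by (simp add: gaussian_eq k_def power_one_over)
  have "complex_of_real (exp (- (norm (x /\<^sub>R s))\<^sup>2 / 2))
      = (LINT z|lborel. complex_of_real (gaussian z) * fexp (x /\<^sub>R s) z)"
    using fourier_integral_gaussian[of "x /\<^sub>R s"] by (simp add: fourier_integral_def)
  also have "\<dots> = \<bar>s\<bar> ^ DIM('a) *\<^sub>R (LINT z|lborel. complex_of_real (gaussian (0
      + s *\<^sub>R z)) * fexp (x /\<^sub>R s) (0 + s *\<^sub>R z))"
    using s by (intro integral_lborel_affine) auto
  also have "\<dots> = complex_of_real (s ^ DIM('a)) * (LINT z|lborel.
      complex_of_real (gaussian (s *\<^sub>R z)) * fexp x z)"
  proof -
    have "(x /\<^sub>R s) \<bullet> (0 + s *\<^sub>R z) = x \<bullet> z" for z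
      using s by (simp add: field_simps)
    thus ?thesis using s by (simp only: scaleR_conv_of_real) simp
  qed
  finally have *: "complex_of_real (s ^ DIM('a)) * (LINT z|lborel.
      complex_of_real (gaussian (s *\<^sub>R z)) * fexp x z) = complex_of_real (k * gaussian (x /\<^sub>R s))"
    unfolding g by simp
  have "fourier_integral (\<lambda>\<xi>. complex_of_real (exp (- (norm (s *\<^sub>R \<xi>))\<^sup>2 / 2))) x =
      complex_of_real k * (LINT z|lborel. complex_of_real (gaussian (s *\<^sub>R z)) * fexp x z)"
    unfolding g fourier_integral_def by (subst integral_mult_right_zero[symmetric])
        (simp add: mult.assoc)
  also have "(LINT z|lborel. complex_of_real (gaussian (s *\<^sub>R z)) * fexp x z)
      = complex_of_real (k * gaussian (x /\<^sub>R s)) / complex_of_real (s ^ DIM('a))"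
    using * s by (simp add: field_simps)
  finally show ?thesis unfolding k(1)[symmetric] by simp
qed

lemma integrable_scaled_gaussian:
  assumes s: "s > 0"
  shows "integrable lborel (\<lambda>\<xi>::'a::euclidean_space. exp (- (norm (s *\<^sub>R \<xi>))\<^sup>2 / 2))"
proof -
  have "integrable lborel (\<lambda>\<xi>::'a. gaussian (0 + s *\<^sub>R \<xi>))"
    using s by (intro integrable_lborel_affine integrable_gaussian) auto
  hence "integrable lborel (\<lambda>\<xi>::'a. sqrt (2 * pi) ^ DIM('a) * gaussian (s *\<^sub>R \<xi>))"
    by (intro integrable_mult_right) auto
  thus ?thesis by (simp add: gaussian_eq power_one_over)
qed

lemma fourier_integral_modulated:
  "fourier_integral (\<lambda>\<xi>. w \<xi> * fexp x \<xi>) y = fourier_integral w (x + y)"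
  unfolding fourier_integral_def
  by (intro Bochner_Integration.integral_cong) (auto simp: inner_add_left exp_add[symmetric]
      algebra_simps)

lemma fourier_integral_regularized:
  fixes f g :: "'a::euclidean_space \<Rightarrow> complex"
  assumes f: "integrable lborel f" and g: "integrable lborel g" and s: "s > 0"
  shows "(LINT \<xi>|lborel. fourier_integral f \<xi> * cnj (fourier_integral g \<xi>)
      * complex_of_real (exp (- (norm (s *\<^sub>R \<xi>))\<^sup>2 / 2)))
       = complex_of_real ((2 * pi) ^ DIM('a)) *
         (LINT x|lborel. f x * (LINT z|lborel. cnj (g (x - s *\<^sub>R z))
             * complex_of_real (gaussian z)))"
proof -
  have [measurable]: "f \<in> borel_measurable borel" "g \<in> borel_measurable borel"
    using borel_measurable_integrable[OF f] borel_measurable_integrable[OF g] by auto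
  define w where "w \<xi> = complex_of_real (exp (- (norm (s *\<^sub>R \<xi>))\<^sup>2 / 2))" for \<xi> :: 'a
  have w: "integrable lborel w"
    unfolding w_def by (rule integrable_of_real[OF integrable_scaled_gaussian[OF s]])
  note [measurable] = borel_measurable_integrable[OF w]
  define h where "h \<xi> = cnj (fourier_integral g \<xi>) * w \<xi>" for \<xi>
  have h: "integrable lborel h"
  proof (rule Bochner_Integration.integrable_bound)
    show "integrable lborel (\<lambda>\<xi>. complex_of_real (LINT x|lborel. cmod (g x)) * w \<xi>)"
      by (rule integrable_mult_right[OF w])
    show "h \<in> borel_measurable lborel" unfolding h_def by measurable
    show "AE \<xi> in lborel. norm (h \<xi>) \<le> norm (complex_of_real (LINT x|lborel. cmod (g x)) * w \<xi>)"
      using fourier_integral_bound[OF g] unfolding h_def norm_mult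
      by (intro AE_I2 mult_right_mono) (auto simp: abs_of_nonneg intro: order_trans[OF _
          abs_ge_self])
  qed
  have ginv: "integrable lborel (invol g)"
    unfolding invol_def using integrable_lborel_affine[OF g, of "-1" 0] by simp
  have Phih: "fourier_integral h x = complex_of_real ((2 * pi) ^ DIM('a))
      * (LINT z|lborel. cnj (g (x - s *\<^sub>R z)) * complex_of_real (gaussian z))" for x
  proof -
    let ?c = "(2 * pi) ^ DIM('a) / s ^ DIM('a)"
    have "fourier_integral h x = (LINT \<xi>|lborel. fourier_integral (invol g) \<xi> * (w \<xi> * fexp x \<xi>))"
      unfolding fourier_integral_def[of h] h_def by (simp add: cnj_fourier_integral mult.assoc)
    also have "\<dots> = (LINT y|lborel. invol g y * fourier_integral (\<lambda>\<xi>. w \<xi> * fexp x \<xi>) y)"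
      by (rule fourier_integral_mult_formula[OF ginv integrable_mult_fexp[OF w]])
    also have "\<dots> = (LINT y|lborel. cnj (g (- y)) * complex_of_real (?c * gaussian ((x + y) /\<^sub>R s)))"
      unfolding fourier_integral_modulated w_def fourier_integral_scaled_gaussian[OF s] invol_def ..
    also have "\<dots> = \<bar>s\<bar> ^ DIM('a) *\<^sub>R (LINT z|lborel. cnj (g (- (- x
        + s *\<^sub>R z))) * complex_of_real (?c * gaussian ((x + (- x + s *\<^sub>R z)) /\<^sub>R s)))"
      using s by (intro integral_lborel_affine) auto
    also have "\<dots> = complex_of_real (s ^ DIM('a)) * (LINT z|lborel. complex_of_real ?c
        * (cnj (g (x - s *\<^sub>R z)) * complex_of_real (gaussian z)))"
      using s by (simp add: scaleR_conv_of_real algebra_simps)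
    also have "\<dots> = complex_of_real (s ^ DIM('a) * ?c) * (LINT z|lborel. cnj (g (x - s *\<^sub>R z))
        * complex_of_real (gaussian z))"
      by (subst integral_mult_right_zero) simp
    also have "s ^ DIM('a) * ?c = (2 * pi) ^ DIM('a)" using s by simp
    finally show ?thesis .
  qed
  have "(LINT \<xi>|lborel. fourier_integral f \<xi> * cnj (fourier_integral g \<xi>) * w \<xi>)
      = (LINT \<xi>|lborel. fourier_integral f \<xi> * h \<xi>)"
    by (simp add: h_def mult.assoc)
  also have "\<dots> = (LINT x|lborel. f x * fourier_integral h x)"
    by (rule fourier_integral_mult_formula[OF f h])
  also have "\<dots> = (LINT x|lborel. complex_of_real ((2 * pi) ^ DIM('a)) * (f x
      * (LINT z|lborel. cnj (g (x - s *\<^sub>R z)) * complex_of_real (gaussian z))))"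
    unfolding Phih by (simp add: algebra_simps)
  also have "\<dots> = complex_of_real ((2 * pi) ^ DIM('a)) * (LINT x|lborel. f x
      * (LINT z|lborel. cnj (g (x - s *\<^sub>R z)) * complex_of_real (gaussian z)))"
    by (rule integral_mult_right_zero)
  finally show ?thesis unfolding w_def .
qed

text \<open>
  After regularisation the right-hand side is an average of autocorrelations of \<open>f\<close> against the
  probability density \<open>gaussian\<close>, and each autocorrelation is at most \<open>\<parallel>f\<parallel>\<^sup>2\<close>.
\<close>

lemma fourier_integral_sqnorm_le:
  fixes f :: "'a::euclidean_space \<Rightarrow> complex"
  assumes f: "integrable lborel f" and f2: "f \<in> L2 lborel"
  shows "sqnorm lborel (fourier_integral f) \<le> ennreal ((2 * pi) ^ DIM('a)) * sqnorm lborel f"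
proof -
  have [measurable]: "f \<in> borel_measurable borel"
    using borel_measurable_integrable[OF f] by auto
  have shift: "(\<integral>\<^sup>+x. ennreal (cmod (f x) * cmod (f (x - y))) \<partial>lborel) \<le> sqnorm lborel f" for y
  proof -
    have f2': "(\<lambda>x. f (x - y)) \<in> L2 lborel"
      using L2_lborel_affine[OF f2, of 1 "-y"] by simp
    have eq: "(LINT x|lborel. (cmod (f (x - y)))\<^sup>2) = (LINT x|lborel. (cmod (f x))\<^sup>2)"
      using integral_lborel_affine[of "\<lambda>x. (cmod (f x))\<^sup>2" 1 "-y"] by simp
    have "(\<integral>\<^sup>+x. ennreal (cmod (f x) * cmod (f (x - y))) \<partial>lborel)
        \<le> (\<integral>\<^sup>+x. ennreal (((cmod (f x))\<^sup>2 + (cmod (f (x - y)))\<^sup>2) / 2) \<partial>lborel)"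
    proof (intro nn_integral_mono ennreal_leI)
      fix x show "cmod (f x) * cmod (f (x - y)) \<le> ((cmod (f x))\<^sup>2 + (cmod (f (x - y)))\<^sup>2) / 2"
        using sum_squares_ge_zero[of "cmod (f x) - cmod (f (x - y))" 0]
            by (simp add: power2_eq_square algebra_simps)
    qed
    also have "\<dots> = ennreal (LINT x|lborel. ((cmod (f x))\<^sup>2 + (cmod (f (x - y)))\<^sup>2) / 2)"
      by (intro nn_integral_eq_integral integrable_divide Bochner_Integration.integrable_add
          L2_integrable_sq f2 f2') auto
    also have "(LINT x|lborel. ((cmod (f x))\<^sup>2 + (cmod (f (x - y)))\<^sup>2) / 2)
        = (LINT x|lborel. (cmod (f x))\<^sup>2)"
      by (subst integral_divide_zero, subst Bochner_Integration.integral_add)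
         (auto intro: L2_integrable_sq f2 f2' simp: eq)
    also have "ennreal \<dots> = sqnorm lborel f" by (simp add: sqnorm_eq_integral[OF f2])
    finally show ?thesis .
  qed
  have reg: "(\<integral>\<^sup>+\<xi>. ennreal ((cmod (fourier_integral f \<xi>))\<^sup>2
      * exp (- (norm (s *\<^sub>R \<xi>))\<^sup>2 / 2)) \<partial>lborel) \<le> ennreal ((2 * pi) ^ DIM('a))
      * sqnorm lborel f" if s: "s > 0" for s
  proof -
    let ?I = "\<lambda>x. LINT z|lborel. cnj (f (x - s *\<^sub>R z)) * complex_of_real (gaussian z)"
    have "integrable lborel (\<lambda>\<xi>. (cmod (fourier_integral f \<xi>))\<^sup>2 * exp (- (norm (s *\<^sub>R \<xi>))\<^sup>2 / 2))"
    proof (rule Bochner_Integration.integrable_bound)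
      show "integrable lborel (\<lambda>\<xi>::'a. (LINT x|lborel. cmod (f x))\<^sup>2
          * exp (- (norm (s *\<^sub>R \<xi>))\<^sup>2 / 2))"
        by (rule integrable_mult_right[OF integrable_scaled_gaussian[OF s]])
      show "AE \<xi> in lborel. norm ((cmod (fourier_integral f \<xi>))\<^sup>2
          * exp (- (norm (s *\<^sub>R \<xi>))\<^sup>2 / 2)) \<le> norm ((LINT x|lborel. cmod (f x))\<^sup>2
          * exp (- (norm (s *\<^sub>R \<xi>))\<^sup>2 / 2))"
        using fourier_integral_bound[OF f] by (intro AE_I2)
            (auto intro!: mult_right_mono power_mono)
    qed measurable
    hence "(\<integral>\<^sup>+\<xi>. ennreal ((cmod (fourier_integral f \<xi>))\<^sup>2
        * exp (- (norm (s *\<^sub>R \<xi>))\<^sup>2 / 2)) \<partial>lborel) =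
        ennreal (LINT \<xi>|lborel. (cmod (fourier_integral f \<xi>))\<^sup>2 * exp (- (norm (s *\<^sub>R \<xi>))\<^sup>2 / 2))"
      by (rule nn_integral_eq_integral) auto
    also have "\<dots> = ennreal (cmod (complex_of_real (LINT \<xi>|lborel. (cmod (fourier_integral f \<xi>))\<^sup>2
        * exp (- (norm (s *\<^sub>R \<xi>))\<^sup>2 / 2))))"
      by (simp add: abs_of_nonneg)
    also have "complex_of_real (LINT \<xi>|lborel. (cmod (fourier_integral f \<xi>))\<^sup>2
        * exp (- (norm (s *\<^sub>R \<xi>))\<^sup>2 / 2))
       = (LINT \<xi>|lborel. fourier_integral f \<xi> * cnj (fourier_integral f \<xi>)
           * complex_of_real (exp (- (norm (s *\<^sub>R \<xi>))\<^sup>2 / 2)))"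
      by (subst integral_complex_of_real[symmetric]) (simp only: of_real_mult complex_norm_square)
    also have "\<dots> = complex_of_real ((2 * pi) ^ DIM('a)) * (LINT x|lborel. f x * ?I x)"
      by (rule fourier_integral_regularized[OF f f s])
    also have "ennreal (cmod \<dots>) = ennreal ((2 * pi) ^ DIM('a)) * ennreal (cmod (LINT x|lborel. f x
        * ?I x))"
      by (simp add: norm_mult norm_power ennreal_mult)
    also have "ennreal (cmod (LINT x|lborel. f x * ?I x))
        \<le> (\<integral>\<^sup>+x. ennreal (cmod (f x * ?I x)) \<partial>lborel)"
    proof (cases "integrable lborel (\<lambda>x. f x * ?I x)")
      case True thus ?thesis by (rule integral_norm_bound_ennreal)
    qed (simp add: not_integrable_integral_eq)
    also have "\<dots> \<le> (\<integral>\<^sup>+x. (\<integral>\<^sup>+z. ennreal (gaussian z) * ennreal (cmod (f x)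
        * cmod (f (x - s *\<^sub>R z))) \<partial>lborel) \<partial>lborel)"
    proof (intro nn_integral_mono)
      fix x
      have "ennreal (cmod (?I x)) \<le> (\<integral>\<^sup>+z. ennreal (cmod (cnj (f (x - s *\<^sub>R z))
          * complex_of_real (gaussian z))) \<partial>lborel)"
      proof (cases "integrable lborel (\<lambda>z. cnj (f (x - s *\<^sub>R z)) * complex_of_real (gaussian z))")
        case True thus ?thesis by (rule integral_norm_bound_ennreal)
      qed (simp add: not_integrable_integral_eq)
      hence "ennreal (cmod (f x * ?I x)) \<le> ennreal (cmod (f x))
          * (\<integral>\<^sup>+z. ennreal (cmod (cnj (f (x - s *\<^sub>R z)) * complex_of_real (gaussian z))) \<partial>lborel)"
        by (simp add: norm_mult ennreal_mult mult_left_mono)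
      also have "\<dots> = (\<integral>\<^sup>+z. ennreal (gaussian z) * ennreal (cmod (f x)
          * cmod (f (x - s *\<^sub>R z))) \<partial>lborel)"
        by (subst nn_integral_cmult[symmetric])
           (auto simp: norm_mult ennreal_mult abs_of_nonneg mult_ac intro!: nn_integral_cong)
      finally show "ennreal (cmod (f x * ?I x)) \<le> \<dots>" .
    qed
    also have "\<dots> = (\<integral>\<^sup>+z. (\<integral>\<^sup>+x. ennreal (gaussian z) * ennreal (cmod (f x)
        * cmod (f (x - s *\<^sub>R z))) \<partial>lborel) \<partial>lborel)"
      by (rule lborel_pair.Fubini') measurable
    also have "\<dots> = (\<integral>\<^sup>+z. ennreal (gaussian z) * (\<integral>\<^sup>+x. ennreal (cmod (f x)
        * cmod (f (x - s *\<^sub>R z))) \<partial>lborel) \<partial>lborel)"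
      by (intro nn_integral_cong nn_integral_cmult) measurable
    also have "\<dots> \<le> (\<integral>\<^sup>+z. ennreal (gaussian (z::'a)) * sqnorm lborel f \<partial>lborel)"
      by (intro nn_integral_mono mult_left_mono shift) auto
    also have "\<dots> = sqnorm lborel f"
      by (simp add: nn_integral_multc nn_integral_gaussian)
    finally show ?thesis by (simp add: mult_left_mono)
  qed
  have "sqnorm lborel (fourier_integral f) = (\<integral>\<^sup>+\<xi>. liminf (\<lambda>n.
      ennreal ((cmod (fourier_integral f \<xi>))\<^sup>2 * exp (- (norm ((1 / real (Suc n)) *\<^sub>R \<xi>))\<^sup>2 / 2)))
      \<partial>lborel)"
    unfolding sqnorm_def
  proof (intro nn_integral_cong)
    fix \<xi> :: 'a
    have "(\<lambda>n. 1 / real (Suc n)) \<longlonglongrightarrow> 0"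
      using LIMSEQ_inverse_real_of_nat by (simp add: inverse_eq_divide)
    hence "(\<lambda>n. ennreal ((cmod (fourier_integral f \<xi>))\<^sup>2
        * exp (- (norm ((1 / real (Suc n)) *\<^sub>R \<xi>))\<^sup>2 / 2))) \<longlonglongrightarrow>
        ennreal ((cmod (fourier_integral f \<xi>))\<^sup>2 * exp (- (norm (0 *\<^sub>R \<xi>))\<^sup>2 / 2))"
      by (intro tendsto_intros) auto
    from lim_imp_Liminf[OF _ this] show "ennreal ((cmod (fourier_integral f \<xi>))\<^sup>2)
        = liminf (\<lambda>n. ennreal ((cmod (fourier_integral f \<xi>))\<^sup>2
        * exp (- (norm ((1 / real (Suc n)) *\<^sub>R \<xi>))\<^sup>2 / 2)))"
      by simp
  qed
  also have "\<dots> \<le> liminf (\<lambda>n. \<integral>\<^sup>+\<xi>. ennreal ((cmod (fourier_integral f \<xi>))\<^sup>2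
      * exp (- (norm ((1 / real (Suc n)) *\<^sub>R \<xi>))\<^sup>2 / 2)) \<partial>lborel)"
    by (intro nn_integral_liminf) measurable
  also have "\<dots> \<le> ennreal ((2 * pi) ^ DIM('a)) * sqnorm lborel f"
  proof (rule Liminf_le)
    show "\<forall>\<^sub>F n in sequentially. (\<integral>\<^sup>+\<xi>. ennreal ((cmod (fourier_integral f \<xi>))\<^sup>2
        * exp (- (norm ((1 / real (Suc n)) *\<^sub>R \<xi>))\<^sup>2 / 2)) \<partial>lborel)
        \<le> ennreal ((2 * pi) ^ DIM('a)) * sqnorm lborel f"
      by (intro always_eventually allI reg) simp
  qed simp
  finally show ?thesis .
qed

section \<open>Plancherel's identity for integrable functions\<close>

lemma L2_cball_bounded:
  fixes h :: "'a::euclidean_space \<Rightarrow> complex"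
  assumes [measurable]: "h \<in> borel_measurable borel"
    and "\<And>x. cmod (h x) \<le> B" "\<And>x. norm x > R \<Longrightarrow> h x = 0"
  shows "h \<in> L2 lborel" "integrable lborel h"
proof -
  have B: "B \<ge> 0" using assms(2)[of 0] norm_ge_zero[of "h 0"] by linarith
  have le: "norm (h x) \<le> B * indicator (cball 0 R) x" for x
    using assms(2)[of x] assms(3)[of x] B by (auto simp: indicator_def)
  have int: "integrable lborel (indicator (cball (0::'a) R) :: 'a \<Rightarrow> real)"
    using emeasure_bounded_finite[of "cball (0::'a) R"]
    by (intro integrable_real_indicator) (auto simp: less_top)
  show "integrable lborel h"
    by (rule Bochner_Integration.integrable_bound[OF integrable_mult_right[OF int, of B]])
       (use le B in \<open>auto intro: order_trans[OF _ abs_ge_self]\<close>)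
  have "integrable lborel (\<lambda>x. B\<^sup>2 * indicator (cball (0::'a) R) x :: real)"
    by (rule integrable_mult_right[OF int])
  hence "integrable lborel (\<lambda>x. (cmod (h x))\<^sup>2)"
  proof (rule Bochner_Integration.integrable_bound)
    show "AE x in lborel. norm ((cmod (h x))\<^sup>2) \<le> norm (B\<^sup>2
        * indicator (cball (0::'a) R) x :: real)"
    proof (intro AE_I2)
      fix x
      have "(cmod (h x))\<^sup>2 \<le> (B * indicator (cball 0 R) x)\<^sup>2" by (intro power_mono le) auto
      thus "norm ((cmod (h x))\<^sup>2) \<le> norm (B\<^sup>2 * indicator (cball (0::'a) R) x :: real)"
        by (auto simp: indicator_def)
    qed
  qed measurable
  thus "h \<in> L2 lborel"
    by (auto simp: L2_def sqnorm_def integrable_iff_bounded)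
qed

lemma L2_tendsto_truncation:
  assumes f: "f \<in> L2 M" and [measurable]: "\<And>n. A n \<in> sets M"
    and ev: "\<And>x. x \<in> space M \<Longrightarrow> \<forall>\<^sub>F n in sequentially. x \<in> A n"
  shows "L2_tendsto M (\<lambda>n x. indicator (A n) x * f x) f"
proof -
  note [measurable] = L2_measurable[OF f]
  show ?thesis
  proof (rule L2_tendsto_dominated[OF _ _ f])
    show "AE x in M. (\<lambda>n. indicator (A n) x * f x) \<longlonglongrightarrow> f x"
    proof (intro AE_I2 tendsto_eventually)
      fix x assume "x \<in> space M"
      from ev[OF this] show "\<forall>\<^sub>F n in sequentially. indicator (A n) x * f x = f x"
        by eventually_elim simp
    qed
    show "AE x in M. cmod (indicator (A n) x * f x - f x) \<le> cmod (f x)" for n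
      by (auto simp: indicator_def)
  qed measurable
qed

lemma eventually_norm_le: "\<forall>\<^sub>F n in sequentially. norm (x::'a::real_normed_vector) \<le> real n"
  using eventually_ge_at_top[of "nat \<lceil>norm x\<rceil>"]
  by eventually_elim linarith

lemma L2_indicator_mult:
  assumes f: "f \<in> L2 M" and [measurable]: "A \<in> sets M"
  shows "(\<lambda>x. indicator A x * f x) \<in> L2 M"
  using f by (intro L2_dominated[OF f]) (auto simp: indicator_def)

lemma L2_dense_continuous:
  fixes f :: "'a::euclidean_space \<Rightarrow> complex"
  assumes f: "f \<in> L2 lborel" and e: "e > 0"
  obtains g B where "g \<in> L2 lborel" "integrable lborel g" "continuous_on UNIV g" "\<And>x. cmod (g x)
      \<le> B"
    "sqnorm lborel (\<lambda>x. g x - f x) < e"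
proof -
  note [measurable] = L2_measurable[OF f]
  define A where "A n = {x. norm x \<le> real n \<and> cmod (f x) \<le> real n}" for n :: nat
  have Am[measurable]: "A n \<in> sets lborel" for n
  proof -
    have "{x \<in> space lborel. norm x \<le> real n \<and> cmod (f x) \<le> real n} \<in> sets lborel" by measurable
    thus ?thesis by (simp add: A_def)
  qed
  have "\<forall>\<^sub>F n in sequentially. x \<in> A n" for x
    using eventually_conj[OF eventually_norm_le[of x] eventually_norm_le[of "f x"]]
        by (simp add: A_def)
  hence lim: "L2_tendsto lborel (\<lambda>n x. indicator (A n) x * f x) f"
    by (rule L2_tendsto_truncation[OF f Am])
  have e4: "\<exists>e'>0. 2 * e' + 2 * e' \<le> e"
  proof (cases e)
    case (real r)
    have "2 * ennreal (r/4) + 2 * ennreal (r/4) = ennreal r"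
      using real by (simp add: mult_2 flip: ennreal_plus)
    thus ?thesis using real e by (intro exI[of _ "ennreal (r/4)"]) auto
  qed (auto intro: exI[of _ 1])
  then obtain e' where e': "e' > 0" "2 * e' + 2 * e' \<le> e" by auto
  from order_tendstoD(2)[OF lim[unfolded L2_tendsto_def] e'(1)]
  obtain n where n: "sqnorm lborel (\<lambda>x. indicator (A n) x * f x - f x) < e'"
    by (auto simp: eventually_sequentially)
  define h where "h x = indicator (A n) x * f x" for x
  have [measurable]: "h \<in> borel_measurable borel" unfolding h_def by measurable
  have hb: "cmod (h x) \<le> real n" for x by (auto simp: h_def A_def indicator_def)
  have hs: "h x = 0" if "norm x > real n" for x using that by (auto simp: h_def A_def indicator_def)
  have "h \<in> borel_measurable lebesgue" by (rule measurable_completion) simp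
  hence "h measurable_on UNIV" by (rule lebesgue_measurable_imp_measurable_on) auto
  then obtain N g where N: "negligible N" and gc: "\<And>k. continuous_on UNIV (g k)"
    and g: "\<And>x. x \<notin> N \<Longrightarrow> (\<lambda>k. g k x) \<longlonglongrightarrow> h x"
    unfolding measurable_on_def by auto
  \<comment> \<open>\<open>g k\<close> clamped to modulus \<open>n + 1\<close> and cut off outside the ball of radius \<open>n + 1\<close>\<close>
  define c where "c k x = complex_of_real (max 0 (min 1 (real n
      + 1 - norm x)) / max 1 (cmod (g k x) / (real n + 1))) * g k x" for k x
  have cc: "continuous_on UNIV (c k)" for k
    unfolding c_def by (intro continuous_intros gc) auto
  hence [measurable]: "c k \<in> borel_measurable borel" for k
    by (rule borel_measurable_continuous_onI)
  have cb: "cmod (c k x) \<le> real n + 1" for k x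
  proof -
    let ?m = "max 1 (cmod (g k x) / (real n + 1))"
    have "cmod (c k x) = max 0 (min 1 (real n + 1 - norm x)) * (cmod (g k x) / ?m)"
      unfolding c_def by (simp add: norm_mult norm_divide)
    also have "\<dots> \<le> 1 * (cmod (g k x) / ?m)"
      by (intro mult_right_mono) auto
    also have "cmod (g k x) / ?m \<le> real n + 1"
    proof -
      have "cmod (g k x) / (real n + 1) \<le> ?m" "?m > 0" by auto
      hence "cmod (g k x) \<le> (real n + 1) * ?m"
        by (subst (asm) pos_divide_le_eq) (auto simp: mult.commute)
      thus ?thesis using \<open>?m > 0\<close> by (subst pos_divide_le_eq)
    qed
    finally show ?thesis by simp
  qed
  have cs: "c k x = 0" if "norm x > real n + 1" for k x
    using that by (simp add: c_def)
  have hc: "(\<lambda>k. c k x) \<longlonglongrightarrow> h x" if x: "x \<notin> N" for x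
  proof -
    have "(\<lambda>k. c k x) \<longlonglongrightarrow> complex_of_real (max 0 (min 1 (real n
        + 1 - norm x)) / max 1 (cmod (h x) / (real n + 1))) * h x"
      unfolding c_def by (intro tendsto_intros g[OF x]) auto
    also have "complex_of_real (max 0 (min 1 (real n + 1 - norm x)) / max 1 (cmod (h x) / (real n
        + 1))) * h x = h x"
    proof (cases "norm x > real n")
      case False
      have "cmod (h x) / (real n + 1) \<le> 1" using hb[of x] by (simp add: field_simps)
      thus ?thesis using False by (simp add: max_def min_def)
    qed (simp add: hs)
    finally show ?thesis .
  qed
  define w :: "'a \<Rightarrow> complex" where "w x = complex_of_real (2 * real n
      + 1) * indicator (cball 0 (real n + 1)) x" for x
  have [measurable]: "w \<in> borel_measurable borel"
    unfolding w_def by (intro borel_measurable_times borel_measurable_const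
        borel_measurable_indicator) auto
  have "L2_tendsto lborel c h"
  proof (rule L2_tendsto_dominated)
    show "w \<in> L2 lborel"
      by (rule L2_cball_bounded(1)[where B = "2 * real n + 1" and R
          = "real n + 1"]) (auto simp: w_def indicator_def norm_mult simp del: of_real_mult
          of_real_add)
    show "AE x in lborel. cmod (c k x - h x) \<le> cmod (w x)" for k
    proof (intro AE_I2)
      fix x
      show "cmod (c k x - h x) \<le> cmod (w x)"
      proof (cases "norm x > real n + 1")
        case True thus ?thesis by (simp add: cs hs)
      next
        case False
        have "cmod (c k x - h x) \<le> cmod (c k x) + cmod (h x)" by (rule norm_triangle_ineq4)
        thus ?thesis using cb[of k x] hb[of x] False
          by (simp add: w_def norm_mult abs_of_nonneg del: of_real_add of_real_mult)
      qed
    qed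
    have "N \<in> null_sets lebesgue" using N by (simp add: negligible_iff_null_sets)
    hence "AE x in lborel. x \<notin> N"
      using AE_not_in AE_completion_iff by blast
    thus "AE x in lborel. (\<lambda>k. c k x) \<longlonglongrightarrow> h x"
      by eventually_elim (rule hc)
  qed measurable
  from order_tendstoD(2)[OF this[unfolded L2_tendsto_def] e'(1)]
  obtain k where k: "sqnorm lborel (\<lambda>x. c k x - h x) < e'"
    by (auto simp: eventually_sequentially)
  have "sqnorm lborel (\<lambda>x. c k x - f x) \<le> 2 * sqnorm lborel (\<lambda>x. c k x - h x)
      + 2 * sqnorm lborel (\<lambda>x. h x - f x)"
    by (rule sqnorm_triangle3) auto
  also have "\<dots> < 2 * e' + 2 * e'"
    using k n unfolding h_def by (intro add_strict_mono ennreal_mult_strict_left_mono) auto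
  also have "\<dots> \<le> e" by (rule e')
  finally show ?thesis
    using cb cc by (intro that[of "c k" "real n + 1"] L2_cball_bounded[OF _ cb cs]) auto
qed

lemma fourier_integral_diff:
  assumes "integrable lborel f" "integrable lborel g"
  shows "fourier_integral (\<lambda>x. f x - g x) \<xi> = fourier_integral f \<xi> - fourier_integral g \<xi>"
  using integrable_mult_fexp[OF assms(1), of \<xi>] integrable_mult_fexp[OF assms(2), of \<xi>]
  unfolding fourier_integral_def by (simp add: left_diff_distrib)

lemma fourier_integral_add:
  assumes "integrable lborel f" "integrable lborel g"
  shows "fourier_integral (\<lambda>x. f x + g x) \<xi> = fourier_integral f \<xi> + fourier_integral g \<xi>"
  using integrable_mult_fexp[OF assms(1), of \<xi>] integrable_mult_fexp[OF assms(2), of \<xi>]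
  unfolding fourier_integral_def by (simp add: distrib_right)

lemma fourier_integral_cmult: "fourier_integral (\<lambda>x. c * f x) \<xi> = c * fourier_integral f \<xi>"
  unfolding fourier_integral_def by (subst integral_mult_right_zero[symmetric])
      (simp add: mult.assoc)

lemma fourier_integral_L2:
  fixes f :: "'a::euclidean_space \<Rightarrow> complex"
  assumes f: "f \<in> L2 lborel" "integrable lborel f"
  shows "fourier_integral f \<in> L2 lborel"
proof -
  note [measurable] = L2_measurable[OF f(1)]
  have "sqnorm lborel (fourier_integral f) \<le> ennreal ((2 * pi) ^ DIM('a)) * sqnorm lborel f"
    by (rule fourier_integral_sqnorm_le[OF f(2,1)])
  also have "\<dots> < \<infinity>" using L2_finite[OF f(1)] by (simp add: ennreal_mult_less_top)
  finally show ?thesis by (simp add: L2_def)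
qed

lemma fourier_integral_Parseval_continuous:
  fixes f g :: "'a::euclidean_space \<Rightarrow> complex"
  assumes f: "f \<in> L2 lborel" "integrable lborel f" and g: "g \<in> L2 lborel" "integrable lborel g"
    and gc: "continuous_on UNIV g" and gb: "\<And>x. cmod (g x) \<le> B"
  shows "(LINT \<xi>|lborel. fourier_integral f \<xi> * cnj (fourier_integral g \<xi>))
      = complex_of_real ((2 * pi) ^ DIM('a)) * (LINT x|lborel. f x * cnj (g x))"
proof -
  have [measurable]: "f \<in> borel_measurable borel" "g \<in> borel_measurable borel"
    using L2_measurable[OF f(1)] L2_measurable[OF g(1)] by auto
  have B: "B \<ge> 0" using gb[of 0] norm_ge_zero[of "g 0"] by linarith
  define s where "s n = 1 / real (Suc n)" for n
  have s: "s n > 0" for n by (simp add: s_def)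
  have slim: "s \<longlonglongrightarrow> 0"
    using LIMSEQ_inverse_real_of_nat by (simp add: inverse_eq_divide s_def[abs_def])
  let ?I = "\<lambda>n x. LINT z|lborel. cnj (g (x - s n *\<^sub>R z)) * complex_of_real (gaussian z)"
  have 1: "(\<lambda>n. LINT \<xi>|lborel. fourier_integral f \<xi> * cnj (fourier_integral g \<xi>)
      * complex_of_real (exp (- (norm (s n *\<^sub>R \<xi>))\<^sup>2 / 2)))
      \<longlonglongrightarrow> (LINT \<xi>|lborel. fourier_integral f \<xi> * cnj (fourier_integral g \<xi>))"
  proof (rule integral_dominated_convergence)
    show "integrable lborel (\<lambda>\<xi>. cmod (fourier_integral f \<xi> * cnj (fourier_integral g \<xi>)))"
      by (intro integrable_norm L2_mult_integrable L2_cnj fourier_integral_L2 f g)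
    show "AE \<xi> in lborel. (\<lambda>n. fourier_integral f \<xi> * cnj (fourier_integral g \<xi>)
        * complex_of_real (exp (- (norm (s n *\<^sub>R \<xi>))\<^sup>2 / 2)))
       \<longlonglongrightarrow> fourier_integral f \<xi> * cnj (fourier_integral g \<xi>)"
    proof (intro AE_I2)
      fix \<xi> :: 'a
      have "(\<lambda>n. fourier_integral f \<xi> * cnj (fourier_integral g \<xi>)
          * complex_of_real (exp (- (norm (s n *\<^sub>R \<xi>))\<^sup>2 / 2)))
       \<longlonglongrightarrow> fourier_integral f \<xi> * cnj (fourier_integral g \<xi>)
           * complex_of_real (exp (- (norm (0 *\<^sub>R \<xi>))\<^sup>2 / 2))"
        by (intro tendsto_intros slim) auto
      thus "(\<lambda>n. fourier_integral f \<xi> * cnj (fourier_integral g \<xi>)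
          * complex_of_real (exp (- (norm (s n *\<^sub>R \<xi>))\<^sup>2 / 2)))
       \<longlonglongrightarrow> fourier_integral f \<xi> * cnj (fourier_integral g \<xi>)" by simp
    qed
    show "AE \<xi> in lborel. norm (fourier_integral f \<xi> * cnj (fourier_integral g \<xi>)
        * complex_of_real (exp (- (norm (s n *\<^sub>R \<xi>))\<^sup>2 / 2)))
      \<le> cmod (fourier_integral f \<xi> * cnj (fourier_integral g \<xi>))" for n
      by (intro AE_I2) (auto simp: norm_mult intro!: mult_right_le_one_le)
  qed measurable
  have gau1: "integral\<^sup>L lborel (gaussian :: 'a \<Rightarrow> real) = 1"
    by (simp add: integral_eq_nn_integral nn_integral_gaussian)
  have gint: "integrable lborel (\<lambda>z::'a. B * gaussian z)"
    by (rule integrable_mult_right[OF integrable_gaussian])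
  have bnd: "cmod (cnj (g y) * complex_of_real (gaussian z)) \<le> B * gaussian z" for y z :: 'a
    using gb[of y] by (simp add: norm_mult mult_right_mono)
  have Ilim: "(\<lambda>n. ?I n x) \<longlonglongrightarrow> cnj (g x)" for x
  proof -
    have "(\<lambda>n. ?I n x) \<longlonglongrightarrow> (LINT z|lborel. cnj (g x) * complex_of_real (gaussian (z::'a)))"
    proof (rule integral_dominated_convergence)
      show "integrable lborel (\<lambda>z::'a. B * gaussian z)" by (rule gint)
      show "AE z in lborel. (\<lambda>n. cnj (g (x - s n *\<^sub>R z)) * complex_of_real (gaussian z))
          \<longlonglongrightarrow> cnj (g x) * complex_of_real (gaussian z)"
      proof (intro AE_I2 tendsto_intros)
        fix z
        have "isCont g x" using gc by (simp add: continuous_on_eq_continuous_at)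
        moreover have "(\<lambda>n. x - s n *\<^sub>R z) \<longlonglongrightarrow> x - 0 *\<^sub>R z" by (intro tendsto_intros slim)
        ultimately show "(\<lambda>n. g (x - s n *\<^sub>R z)) \<longlonglongrightarrow> g x"
          by (intro isCont_tendsto_compose[where g = g]) auto
      qed
      show "AE z in lborel. norm (cnj (g (x - s n *\<^sub>R z)) * complex_of_real (gaussian z))
          \<le> B * gaussian z" for n
        by (intro AE_I2 bnd)
    qed measurable
    thus ?thesis by (simp add: gau1)
  qed
  have Ib: "cmod (?I n x) \<le> B" for n x
  proof -
    have "cmod (?I n x) \<le> (LINT z|lborel. B * gaussian (z::'a))"
      by (rule Bochner_Integration.integral_norm_bound_integral[OF _ gint bnd])
         (rule Bochner_Integration.integrable_bound[OF gint], measurable, use bnd in \<open>auto intro!: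
             AE_I2 order_trans[OF bnd]\<close>)
    also have "\<dots> = B * enn2real (\<integral>\<^sup>+z. ennreal (gaussian (z::'a)) \<partial>lborel)"
      by (simp add: integral_eq_nn_integral)
    finally show ?thesis by (simp add: nn_integral_gaussian)
  qed
  have 2: "(\<lambda>n. LINT x|lborel. f x * ?I n x) \<longlonglongrightarrow> (LINT x|lborel. f x * cnj (g x))"
  proof (rule integral_dominated_convergence)
    show "integrable lborel (\<lambda>x. cmod (f x) * B)"
      by (intro integrable_mult_left integrable_norm f)
    show "AE x in lborel. (\<lambda>n. f x * ?I n x) \<longlonglongrightarrow> f x * cnj (g x)"
      by (intro AE_I2 tendsto_intros Ilim)
    show "AE x in lborel. norm (f x * ?I n x) \<le> cmod (f x) * B" for n
      by (intro AE_I2) (auto simp: norm_mult intro!: mult_left_mono Ib)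
  qed measurable
  have "(\<lambda>n. complex_of_real ((2 * pi) ^ DIM('a)) * (LINT x|lborel. f x * ?I n x)) \<longlonglongrightarrow>
      complex_of_real ((2 * pi) ^ DIM('a)) * (LINT x|lborel. f x * cnj (g x))"
    by (intro tendsto_intros 2)
  with 1 show ?thesis
    unfolding fourier_integral_regularized[OF f(2) g(2) s] by (rule LIMSEQ_unique)
qed

lemma L2_dense_sequence:
  fixes f :: "'a::euclidean_space \<Rightarrow> complex"
  assumes f: "f \<in> L2 lborel"
  obtains g where "\<And>k. g k \<in> L2 lborel" "\<And>k. integrable lborel (g k)" "\<And>k. continuous_on UNIV (g k)"
    "\<And>k. \<exists>B. \<forall>x. cmod (g k x) \<le> B" "L2_tendsto lborel g f"
proof -
  have "\<exists>g. g \<in> L2 lborel \<and> integrable lborel g \<and> continuous_on UNIV g \<and> (\<exists>B. \<forall>x. cmod (g x) \<le> B) \<and>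
    sqnorm lborel (\<lambda>x. g x - f x) < ennreal (1 / real (Suc k))" for k
    by (rule L2_dense_continuous[OF f, of "ennreal (1 / real (Suc k))"]) auto
  then obtain g where g: "\<And>k. g k \<in> L2 lborel \<and> integrable lborel (g k) \<and> continuous_on UNIV (g k)
      \<and> (\<exists>B. \<forall>x. cmod (g k x) \<le> B) \<and>
    sqnorm lborel (\<lambda>x. g k x - f x) < ennreal (1 / real (Suc k))"
    by metis
  have "(\<lambda>k. ennreal (1 / real (Suc k))) \<longlonglongrightarrow> ennreal 0"
    using LIMSEQ_inverse_real_of_nat by (intro tendsto_ennrealI) (simp add: inverse_eq_divide)
  hence lim0: "(\<lambda>k. ennreal (1 / real (Suc k))) \<longlonglongrightarrow> 0" by simp
  have "(\<lambda>k. sqnorm lborel (\<lambda>x. g k x - f x)) \<longlonglongrightarrow> 0"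
  proof (rule tendsto_sandwich[OF _ _ tendsto_const lim0])
    show "\<forall>\<^sub>F k in sequentially. sqnorm lborel (\<lambda>x. g k x - f x) \<le> ennreal (1 / real (Suc k))"
      by (intro always_eventually allI less_imp_le) (use g in blast)
  qed simp_all
  thus ?thesis using g by (intro that[of g]) (auto simp: L2_tendsto_def)
qed

lemma fourier_integral_L2_tendsto:
  fixes f :: "'a::euclidean_space \<Rightarrow> complex"
  assumes F: "\<And>n. F n \<in> L2 lborel" "\<And>n. integrable lborel (F n)"
      and f: "f \<in> L2 lborel" "integrable lborel f"
    and lim: "L2_tendsto lborel F f"
  shows "L2_tendsto lborel (\<lambda>n. fourier_integral (F n)) (fourier_integral f)"
proof -
  have "(\<lambda>n. ennreal ((2 * pi) ^ DIM('a)) * sqnorm lborel (\<lambda>x. F n x - f x))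
      \<longlonglongrightarrow> ennreal ((2 * pi) ^ DIM('a)) * 0"
    using lim unfolding L2_tendsto_def by (intro ennreal_tendsto_cmult) auto
  hence lim0: "(\<lambda>n. ennreal ((2 * pi) ^ DIM('a)) * sqnorm lborel (\<lambda>x. F n x - f x)) \<longlonglongrightarrow> 0"
    by simp
  have "sqnorm lborel (\<lambda>\<xi>. fourier_integral (F n) \<xi> - fourier_integral f \<xi>)
      \<le> ennreal ((2 * pi) ^ DIM('a)) * sqnorm lborel (\<lambda>x. F n x - f x)" for n
  proof -
    have "fourier_integral (\<lambda>x. F n x - f x) = (\<lambda>\<xi>.
        fourier_integral (F n) \<xi> - fourier_integral f \<xi>)"
      by (intro ext fourier_integral_diff F f)
    thus ?thesis
      using fourier_integral_sqnorm_le[OF _ L2_diff[OF F(1)[of n] f(1)]] F(2)[of n] f(2) by simp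
  qed
  thus ?thesis unfolding L2_tendsto_def
    by (intro tendsto_sandwich[OF _ _ tendsto_const lim0] always_eventually allI) simp_all
qed

lemma fourier_integral_Parseval:
  fixes f g :: "'a::euclidean_space \<Rightarrow> complex"
  assumes f: "f \<in> L2 lborel" "integrable lborel f" and g: "g \<in> L2 lborel" "integrable lborel g"
  shows "(LINT \<xi>|lborel. fourier_integral f \<xi> * cnj (fourier_integral g \<xi>))
      = complex_of_real ((2 * pi) ^ DIM('a)) * (LINT x|lborel. f x * cnj (g x))"
proof -
  obtain h where h: "\<And>k. h k \<in> L2 lborel" "\<And>k. integrable lborel (h k)" "\<And>k.
      continuous_on UNIV (h k)"
    "\<And>k. \<exists>B. \<forall>x. cmod (h k x) \<le> B" "L2_tendsto lborel h g"
    using L2_dense_sequence[OF g(1)] by metis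
  have 1: "(\<lambda>k. LINT \<xi>|lborel. fourier_integral f \<xi> * cnj (fourier_integral (h k) \<xi>))
      \<longlonglongrightarrow> (LINT \<xi>|lborel. fourier_integral f \<xi> * cnj (fourier_integral g \<xi>))"
    by (intro L2_tendsto_integral L2_tendsto_const L2_tendsto_cnj fourier_integral_L2_tendsto
        L2_cnj fourier_integral_L2 f g h)
  have 2: "(\<lambda>k. complex_of_real ((2 * pi) ^ DIM('a)) * (LINT x|lborel. f x * cnj (h k x)))
      \<longlonglongrightarrow> complex_of_real ((2 * pi) ^ DIM('a)) * (LINT x|lborel. f x * cnj (g x))"
    by (intro tendsto_mult tendsto_const L2_tendsto_integral L2_tendsto_const L2_tendsto_cnj
        L2_cnj f g h)
  have 3: "(LINT \<xi>|lborel. fourier_integral f \<xi> * cnj (fourier_integral (h k) \<xi>))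
      = complex_of_real ((2 * pi) ^ DIM('a)) * (LINT x|lborel. f x * cnj (h k x))" for k
  proof -
    obtain B where "\<And>x. cmod (h k x) \<le> B" using h(4) by blast
    thus ?thesis by (rule fourier_integral_Parseval_continuous[OF f h(1-3)])
  qed
  show ?thesis by (rule LIMSEQ_unique[OF 1[unfolded 3] 2])
qed

lemma fourier_integral_Plancherel:
  fixes f :: "'a::euclidean_space \<Rightarrow> complex"
  assumes f: "f \<in> L2 lborel" "integrable lborel f"
  shows "sqnorm lborel (fourier_integral f) = ennreal ((2 * pi) ^ DIM('a)) * sqnorm lborel f"
proof -
  have "complex_of_real (enn2real (sqnorm lborel (fourier_integral f)))
      = complex_of_real ((2 * pi) ^ DIM('a) * enn2real (sqnorm lborel f))"
    using fourier_integral_Parseval[OF f f] by (simp add: sqnorm_eq_inner[OF f(1)]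
        sqnorm_eq_inner[OF fourier_integral_L2[OF f]])
  hence "enn2real (sqnorm lborel (fourier_integral f))
      = (2 * pi) ^ DIM('a) * enn2real (sqnorm lborel f)"
    using of_real_eq_iff by blast
  thus ?thesis
    by (subst sqnorm_conv_enn2real[OF f(1)], subst sqnorm_conv_enn2real[OF fourier_integral_L2[OF
        f]])
       (simp add: ennreal_mult)
qed

section \<open>The Fourier transform on \<open>L\<^sup>2\<close>\<close>

lemma L2_tendsto_imp_Cauchy:
  assumes [measurable]: "\<And>n. F n \<in> borel_measurable M" "f \<in> borel_measurable M"
      and lim: "L2_tendsto M F f" and e: "e > 0"
  shows "\<exists>K. \<forall>m\<ge>K. \<forall>n\<ge>K. sqnorm M (\<lambda>x. F m x - F n x) < ennreal e"
proof -
  from order_tendstoD(2)[OF lim[unfolded L2_tendsto_def], of "ennreal (e/4)"] e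
  obtain K where K: "\<And>n. n \<ge> K \<Longrightarrow> sqnorm M (\<lambda>x. F n x - f x) < ennreal (e/4)"
    by (auto simp: eventually_sequentially)
  have "sqnorm M (\<lambda>x. F m x - F n x) < ennreal e" if "m \<ge> K" "n \<ge> K" for m n
  proof -
    have "sqnorm M (\<lambda>x. F m x - F n x) \<le> 2 * sqnorm M (\<lambda>x. F m x - f x)
        + 2 * sqnorm M (\<lambda>x. f x - F n x)"
      by (rule sqnorm_triangle3) auto
    also have "sqnorm M (\<lambda>x. f x - F n x) = sqnorm M (\<lambda>x. F n x - f x)"
        by (rule sqnorm_minus_commute)
    also have "2 * sqnorm M (\<lambda>x. F m x - f x) + 2 * sqnorm M (\<lambda>x. F n x - f x)
        < 2 * ennreal (e/4) + 2 * ennreal (e/4)"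
      using K that by (intro add_strict_mono ennreal_mult_strict_left_mono) auto
    also have "\<dots> = ennreal e"
      using e by (simp add: mult_2 flip: ennreal_plus)
    finally show ?thesis .
  qed
  thus ?thesis by blast
qed

lemma L2_tendsto_close:
  assumes [measurable]: "\<And>n. F n \<in> borel_measurable M" "\<And>n.
      G n \<in> borel_measurable M" "f \<in> borel_measurable M"
    and FG: "(\<lambda>n. sqnorm M (\<lambda>x. F n x - G n x)) \<longlonglongrightarrow> 0" and G: "L2_tendsto M G f"
  shows "L2_tendsto M F f"
proof -
  have "L2_tendsto M (\<lambda>n x. (F n x - G n x) + G n x) (\<lambda>x. 0 + f x)"
    using FG G by (intro L2_tendsto_add) (auto simp: L2_tendsto_def)
  thus ?thesis by simp
qed

lemma sqnorm_fourier_integral_diff: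
  fixes f :: "'a::euclidean_space \<Rightarrow> complex"
  assumes "f \<in> L2 lborel" "integrable lborel f" "g \<in> L2 lborel" "integrable lborel g"
  shows "sqnorm lborel (\<lambda>\<xi>. fourier_integral f \<xi> - fourier_integral g \<xi>)
      = ennreal ((2 * pi) ^ DIM('a)) * sqnorm lborel (\<lambda>x. f x - g x)"
proof -
  have "fourier_integral (\<lambda>x. f x - g x) = (\<lambda>\<xi>. fourier_integral f \<xi> - fourier_integral g \<xi>)"
    by (intro ext fourier_integral_diff assms)
  thus ?thesis
    using fourier_integral_Plancherel[OF L2_diff[OF assms(1,3)]
        Bochner_Integration.integrable_diff[OF assms(2,4)]] by simp
qed

lemma L2_cball_truncation:
  fixes f :: "'a::euclidean_space \<Rightarrow> complex"
  assumes f: "f \<in> L2 lborel"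
  shows "(\<lambda>x. indicator (cball 0 R) x * f x) \<in> L2 lborel" "integrable lborel (\<lambda>x.
      indicator (cball 0 R) x * f x)"
proof -
  show "(\<lambda>x. indicator (cball 0 R) x * f x) \<in> L2 lborel"
    by (rule L2_indicator_mult[OF f]) simp
  have "(indicator (cball 0 R) :: 'a \<Rightarrow> complex) \<in> L2 lborel"
    by (rule L2_cball_bounded(1)[where B = 1 and R = R])
       (auto simp: indicator_def intro!: borel_measurable_indicator)
  thus "integrable lborel (\<lambda>x. indicator (cball 0 R) x * f x)"
    by (rule L2_mult_integrable[OF _ f])
qed

lemma L2_tendsto_cball_truncation:
  fixes f :: "'a::euclidean_space \<Rightarrow> complex"
  assumes f: "f \<in> L2 lborel"
  shows "L2_tendsto lborel (\<lambda>n x. indicator (cball 0 (real n)) x * f x) f"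
  using eventually_norm_le by (intro L2_tendsto_truncation[OF f]) auto

lemma fourier_exists:
  fixes f :: "'a::euclidean_space \<Rightarrow> complex"
  assumes f: "f \<in> L2 lborel"
  shows "\<exists>g\<in>L2 lborel. L2_tendsto lborel (\<lambda>n. fourier_integral (\<lambda>x. indicator (cball 0 (real n)) x
      * f x)) g"
proof (rule L2_complete)
  define F where "F n x = indicator (cball 0 (real n)) x * f x" for n x
  have F: "F n \<in> L2 lborel" "integrable lborel (F n)" for n
    unfolding F_def[abs_def] by (rule L2_cball_truncation[OF f])+
  show "fourier_integral (\<lambda>x. indicator (cball 0 (real n)) x * f x) \<in> L2 lborel" for n
    using fourier_integral_L2[OF F[of n]] by (simp add: F_def[abs_def])
  fix e :: real assume e: "e > 0"
  have "\<exists>K. \<forall>m\<ge>K. \<forall>n\<ge>K. sqnorm lborel (\<lambda>x. F m x - F n x) < ennreal (e / (2 * pi) ^ DIM('a))"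
    using F f e L2_tendsto_cball_truncation[OF f]
    by (intro L2_tendsto_imp_Cauchy[where f = f] L2_measurable) (auto simp: F_def[abs_def])
  then obtain K where K: "\<And>m n. m \<ge> K \<Longrightarrow> n \<ge> K \<Longrightarrow> sqnorm lborel (\<lambda>x. F m x - F n x)
      < ennreal (e / (2 * pi) ^ DIM('a))"
    by blast
  have "sqnorm lborel (\<lambda>\<xi>. fourier_integral (F m) \<xi> - fourier_integral (F n) \<xi>)
      < ennreal e" if "m \<ge> K" "n \<ge> K" for m n
  proof -
    have "sqnorm lborel (\<lambda>\<xi>. fourier_integral (F m) \<xi> - fourier_integral (F n) \<xi>)
        < ennreal ((2 * pi) ^ DIM('a)) * ennreal (e / (2 * pi) ^ DIM('a))"
      unfolding sqnorm_fourier_integral_diff[OF F F]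
      by (intro ennreal_mult_strict_left_mono K that) (auto simp: ennreal_zero_less_mult_iff)
    also have "\<dots> = ennreal e" using e by (subst ennreal_mult[symmetric]) auto
    finally show ?thesis .
  qed
  thus "\<exists>K. \<forall>m\<ge>K. \<forall>n\<ge>K. sqnorm lborel (\<lambda>x. fourier_integral (\<lambda>x. indicator (cball 0 (real m)) x
      * f x) x - fourier_integral (\<lambda>x. indicator (cball 0 (real n)) x * f x) x) < ennreal e"
    unfolding F_def[abs_def] by blast
qed

lemma fourier_spec:
  fixes f :: "'a::euclidean_space \<Rightarrow> complex"
  assumes f: "f \<in> L2 lborel"
  shows "fourier f \<in> L2 lborel \<and> (\<exists>F. (\<forall>n. F n \<in> L2 lborel \<and> integrable lborel (F n)) \<and>
          L2_tendsto lborel F f \<and> L2_tendsto lborel (\<lambda>n. fourier_integral (F n)) (fourier f))"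
proof -
  obtain g where "g \<in> L2 lborel" "L2_tendsto lborel (\<lambda>n. fourier_integral (\<lambda>x.
      indicator (cball 0 (real n)) x * f x)) g"
    using fourier_exists[OF f] by blast
  hence "\<exists>g. g \<in> L2 lborel \<and> (\<exists>F. (\<forall>n. F n \<in> L2 lborel \<and> integrable lborel (F n)) \<and>
          L2_tendsto lborel F f \<and> L2_tendsto lborel (\<lambda>n. fourier_integral (F n)) g)"
    using L2_cball_truncation[OF f] L2_tendsto_cball_truncation[OF f]
    by (intro exI[of _ g] conjI exI[of _ "\<lambda>n x. indicator (cball 0 (real n)) x * f x"]) auto
  from someI_ex[OF this] show ?thesis unfolding fourier_def by simp
qed

lemma fourier_L2: "f \<in> L2 lborel \<Longrightarrow> fourier f \<in> L2 lborel"
  using fourier_spec by blast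

lemma fourier_approx:
  fixes f :: "'a::euclidean_space \<Rightarrow> complex"
  assumes f: "f \<in> L2 lborel"
  obtains F where "\<And>n. F n \<in> L2 lborel" "\<And>n. integrable lborel (F n)" "L2_tendsto lborel F f"
    "L2_tendsto lborel (\<lambda>n. fourier_integral (F n)) (fourier f)"
  using fourier_spec[OF f] by blast

lemma fourier_eqI:
  fixes f :: "'a::euclidean_space \<Rightarrow> complex"
  assumes f: "f \<in> L2 lborel" and g: "g \<in> L2 lborel"
    and F: "\<And>n. F n \<in> L2 lborel" "\<And>n. integrable lborel (F n)"
    and lF: "L2_tendsto lborel F f" and lg: "L2_tendsto lborel (\<lambda>n. fourier_integral (F n)) g"
  shows "AE \<xi> in lborel. fourier f \<xi> = g \<xi>"
proof -
  obtain G where G: "\<And>n. G n \<in> L2 lborel" "\<And>n. integrable lborel (G n)"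
      and lG: "L2_tendsto lborel G f"
    and lGf: "L2_tendsto lborel (\<lambda>n. fourier_integral (G n)) (fourier f)"
    by (rule fourier_approx[OF f]) blast
  note [measurable] = L2_measurable[OF f] L2_measurable[OF g] L2_measurable[OF F(1)]
      L2_measurable[OF G(1)]
     L2_measurable[OF fourier_L2[OF f]]
  have "L2_tendsto lborel (\<lambda>n x. F n x + - 1 * G n x) (\<lambda>x. f x + - 1 * f x)"
    by (intro L2_tendsto_add L2_tendsto_cmult lF lG) measurable
  hence "(\<lambda>n. ennreal ((2 * pi) ^ DIM('a)) * sqnorm lborel (\<lambda>x. F n x - G n x))
      \<longlonglongrightarrow> ennreal ((2 * pi) ^ DIM('a)) * 0"
    unfolding L2_tendsto_def by (intro ennreal_tendsto_cmult) auto
  hence "(\<lambda>n. sqnorm lborel (\<lambda>\<xi>. fourier_integral (F n) \<xi> - fourier_integral (G n) \<xi>)) \<longlonglongrightarrow> 0"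
    unfolding sqnorm_fourier_integral_diff[OF F G] by simp
  hence "L2_tendsto lborel (\<lambda>n. fourier_integral (F n)) (fourier f)"
    by (intro L2_tendsto_close[OF _ _ _ _ lGf]) auto
  from L2_tendsto_unique[OF _ _ _ this lg] show ?thesis by auto
qed

lemma fourier_eq_fourier_integral:
  fixes f :: "'a::euclidean_space \<Rightarrow> complex"
  assumes "f \<in> L2 lborel" "integrable lborel f"
  shows "AE \<xi> in lborel. fourier f \<xi> = fourier_integral f \<xi>"
  using assms by (intro fourier_eqI[where F = "\<lambda>n. f"] L2_tendsto_const fourier_integral_L2)

lemma L2_tendsto_cong_AE:
  assumes "AE x in M. f x = g x"
  shows "L2_tendsto M F f \<longleftrightarrow> L2_tendsto M F g"
proof -
  have "sqnorm M (\<lambda>x. F n x - f x) = sqnorm M (\<lambda>x. F n x - g x)" for n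
    using assms by (intro sqnorm_cong_AE) auto
  thus ?thesis by (simp add: L2_tendsto_def)
qed

lemma fourier_cong_AE: "AE x in lborel. f x = g x \<Longrightarrow> fourier f = fourier g"
  unfolding fourier_def by (simp add: L2_tendsto_cong_AE)

lemma fourier_add:
  fixes f :: "'a::euclidean_space \<Rightarrow> complex"
  assumes f: "f \<in> L2 lborel" and g: "g \<in> L2 lborel"
  shows "AE \<xi> in lborel. fourier (\<lambda>x. f x + g x) \<xi> = fourier f \<xi> + fourier g \<xi>"
proof -
  obtain F where F: "\<And>n. F n \<in> L2 lborel" "\<And>n. integrable lborel (F n)" "L2_tendsto lborel F f"
    "L2_tendsto lborel (\<lambda>n. fourier_integral (F n)) (fourier f)"
        by (rule fourier_approx[OF f]) blast
  obtain G where G: "\<And>n. G n \<in> L2 lborel" "\<And>n. integrable lborel (G n)" "L2_tendsto lborel G g"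
    "L2_tendsto lborel (\<lambda>n. fourier_integral (G n)) (fourier g)"
        by (rule fourier_approx[OF g]) blast
  note [measurable] = L2_measurable[OF f] L2_measurable[OF g] L2_measurable[OF F(1)]
      L2_measurable[OF G(1)]
     L2_measurable[OF fourier_L2[OF f]] L2_measurable[OF fourier_L2[OF g]]
  show ?thesis
  proof (rule fourier_eqI[where F = "\<lambda>n x. F n x + G n x"])
    have "fourier_integral (\<lambda>x. F n x + G n x) = (\<lambda>\<xi>. fourier_integral (F n) \<xi>
        + fourier_integral (G n) \<xi>)" for n
      by (intro ext fourier_integral_add F G)
    thus "L2_tendsto lborel (\<lambda>n. fourier_integral (\<lambda>x. F n x + G n x)) (\<lambda>\<xi>. fourier f \<xi>
        + fourier g \<xi>)"
      using L2_tendsto_add[OF _ _ _ _ F(4) G(4)] by simp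
    show "L2_tendsto lborel (\<lambda>n x. F n x + G n x) (\<lambda>x. f x + g x)"
      by (rule L2_tendsto_add[OF _ _ _ _ F(3) G(3)]) measurable
  qed (auto intro!: L2_add f g F G fourier_L2)
qed

lemma fourier_cmult:
  fixes f :: "'a::euclidean_space \<Rightarrow> complex"
  assumes f: "f \<in> L2 lborel"
  shows "AE \<xi> in lborel. fourier (\<lambda>x. c * f x) \<xi> = c * fourier f \<xi>"
proof -
  obtain F where F: "\<And>n. F n \<in> L2 lborel" "\<And>n. integrable lborel (F n)" "L2_tendsto lborel F f"
    "L2_tendsto lborel (\<lambda>n. fourier_integral (F n)) (fourier f)"
        by (rule fourier_approx[OF f]) blast
  note [measurable] = L2_measurable[OF f] L2_measurable[OF F(1)] L2_measurable[OF fourier_L2[OF f]]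
  show ?thesis
  proof (rule fourier_eqI[where F = "\<lambda>n x. c * F n x"])
    have "fourier_integral (\<lambda>x. c * F n x) = (\<lambda>\<xi>. c * fourier_integral (F n) \<xi>)" for n
      by (intro ext fourier_integral_cmult)
    thus "L2_tendsto lborel (\<lambda>n. fourier_integral (\<lambda>x. c * F n x)) (\<lambda>\<xi>. c * fourier f \<xi>)"
      using L2_tendsto_cmult[OF _ _ F(4)] by simp
    show "L2_tendsto lborel (\<lambda>n x. c * F n x) (\<lambda>x. c * f x)"
      by (rule L2_tendsto_cmult[OF _ _ F(3)]) measurable
  qed (auto intro!: L2_cmult f F fourier_L2)
qed

lemma fourier_diff:
  fixes f :: "'a::euclidean_space \<Rightarrow> complex"
  assumes f: "f \<in> L2 lborel" and g: "g \<in> L2 lborel"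
  shows "AE \<xi> in lborel. fourier (\<lambda>x. f x - g x) \<xi> = fourier f \<xi> - fourier g \<xi>"
  using fourier_add[OF f L2_cmult[OF g, of "-1"]] fourier_cmult[OF g, of "-1"]
  by eventually_elim simp

lemma fourier_Parseval:
  fixes f g :: "'a::euclidean_space \<Rightarrow> complex"
  assumes f: "f \<in> L2 lborel" and g: "g \<in> L2 lborel"
  shows "(LINT \<xi>|lborel. fourier f \<xi> * cnj (fourier g \<xi>))
      = complex_of_real ((2 * pi) ^ DIM('a)) * (LINT x|lborel. f x * cnj (g x))"
proof -
  obtain F where F: "\<And>n. F n \<in> L2 lborel" "\<And>n. integrable lborel (F n)" "L2_tendsto lborel F f"
    "L2_tendsto lborel (\<lambda>n. fourier_integral (F n)) (fourier f)"
        by (rule fourier_approx[OF f]) blast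
  obtain G where G: "\<And>n. G n \<in> L2 lborel" "\<And>n. integrable lborel (G n)" "L2_tendsto lborel G g"
    "L2_tendsto lborel (\<lambda>n. fourier_integral (G n)) (fourier g)"
        by (rule fourier_approx[OF g]) blast
  have 1: "(\<lambda>n. LINT \<xi>|lborel. fourier_integral (F n) \<xi> * cnj (fourier_integral (G n) \<xi>))
      \<longlonglongrightarrow> (LINT \<xi>|lborel. fourier f \<xi> * cnj (fourier g \<xi>))"
    by (intro L2_tendsto_integral L2_tendsto_cnj L2_cnj fourier_integral_L2 fourier_L2 f g F G)
  have 2: "(\<lambda>n. complex_of_real ((2 * pi) ^ DIM('a)) * (LINT x|lborel. F n x * cnj (G n x)))
      \<longlonglongrightarrow> complex_of_real ((2 * pi) ^ DIM('a)) * (LINT x|lborel. f x * cnj (g x))"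
    by (intro tendsto_mult tendsto_const L2_tendsto_integral L2_tendsto_cnj L2_cnj f g F G)
  show ?thesis
    by (rule LIMSEQ_unique[OF 1[unfolded fourier_integral_Parseval[OF F(1,2) G(1,2)]] 2])
qed

lemma Plancherel:
  fixes f :: "'a::euclidean_space \<Rightarrow> complex"
  assumes f: "f \<in> L2 lborel"
  shows "sqnorm lborel (fourier f) = ennreal ((2 * pi) ^ DIM('a)) * sqnorm lborel f"
proof -
  have "complex_of_real (enn2real (sqnorm lborel (fourier f)))
      = complex_of_real ((2 * pi) ^ DIM('a) * enn2real (sqnorm lborel f))"
    using fourier_Parseval[OF f f] by (simp add: sqnorm_eq_inner[OF f] sqnorm_eq_inner[OF
        fourier_L2[OF f]])
  hence "enn2real (sqnorm lborel (fourier f)) = (2 * pi) ^ DIM('a) * enn2real (sqnorm lborel f)"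
    using of_real_eq_iff by blast
  thus ?thesis
    by (subst sqnorm_conv_enn2real[OF f], subst sqnorm_conv_enn2real[OF fourier_L2[OF f]])
       (simp add: ennreal_mult)
qed

lemma sqnorm_fourier_diff:
  fixes f :: "'a::euclidean_space \<Rightarrow> complex"
  assumes f: "f \<in> L2 lborel" and g: "g \<in> L2 lborel"
  shows "sqnorm lborel (\<lambda>\<xi>. fourier f \<xi> - fourier g \<xi>)
      = ennreal ((2 * pi) ^ DIM('a)) * sqnorm lborel (\<lambda>x. f x - g x)"
  using sqnorm_cong_AE[OF fourier_diff[OF f g]] Plancherel[OF L2_diff[OF f g]] by simp

lemma fourier_tendsto:
  fixes f :: "'a::euclidean_space \<Rightarrow> complex"
  assumes "\<And>n. F n \<in> L2 lborel" "f \<in> L2 lborel" "L2_tendsto lborel F f"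
  shows "L2_tendsto lborel (\<lambda>n. fourier (F n)) (fourier f)"
  using ennreal_tendsto_cmult[OF _ assms(3)[unfolded L2_tendsto_def], of "ennreal ((2
      * pi) ^ DIM('a))"]
  by (simp add: L2_tendsto_def sqnorm_fourier_diff[OF assms(1,2)])

lemma fourier_inj:
  fixes f :: "'a::euclidean_space \<Rightarrow> complex"
  assumes f: "f \<in> L2 lborel" and g: "g \<in> L2 lborel" and eq: "AE \<xi> in lborel. fourier f \<xi>
      = fourier g \<xi>"
  shows "AE x in lborel. f x = g x"
proof -
  note [measurable] = L2_measurable[OF f] L2_measurable[OF g] 
  have "sqnorm lborel (\<lambda>\<xi>. fourier f \<xi> - fourier g \<xi>) = sqnorm lborel (\<lambda>\<xi>::'a. 0)"
    using eq by (intro sqnorm_cong_AE) auto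
  hence "ennreal ((2 * pi) ^ DIM('a)) * sqnorm lborel (\<lambda>x. f x - g x) = 0"
    by (simp add: sqnorm_fourier_diff[OF f g])
  moreover have "ennreal ((2 * pi) ^ DIM('a)) \<noteq> 0"
    by (simp add: ennreal_eq_0_iff not_le)
  ultimately have "sqnorm lborel (\<lambda>x. f x - g x) = 0" using mult_eq_0_iff by blast
  thus ?thesis by (subst (asm) sqnorm_0_iff) auto
qed

lemma fourier_mult_formula:
  fixes f h :: "'a::euclidean_space \<Rightarrow> complex"
  assumes f: "f \<in> L2 lborel" and h: "h \<in> L2 lborel"
  shows "(LINT \<xi>|lborel. fourier f \<xi> * h \<xi>) = (LINT x|lborel. f x * fourier h x)"
proof -
  obtain F where F: "\<And>n. F n \<in> L2 lborel" "\<And>n. integrable lborel (F n)" "L2_tendsto lborel F f"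
    "L2_tendsto lborel (\<lambda>n. fourier_integral (F n)) (fourier f)"
        by (rule fourier_approx[OF f]) blast
  obtain H where H: "\<And>n. H n \<in> L2 lborel" "\<And>n. integrable lborel (H n)" "L2_tendsto lborel H h"
    "L2_tendsto lborel (\<lambda>n. fourier_integral (H n)) (fourier h)"
        by (rule fourier_approx[OF h]) blast
  have 1: "(\<lambda>n. LINT \<xi>|lborel. fourier_integral (F n) \<xi> * H n \<xi>)
      \<longlonglongrightarrow> (LINT \<xi>|lborel. fourier f \<xi> * h \<xi>)"
    by (intro L2_tendsto_integral fourier_integral_L2 fourier_L2 f h F H)
  have 2: "(\<lambda>n. LINT x|lborel. F n x * fourier_integral (H n) x)
      \<longlonglongrightarrow> (LINT x|lborel. f x * fourier h x)"
    by (intro L2_tendsto_integral fourier_integral_L2 fourier_L2 f h F H)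
  show ?thesis
    by (rule LIMSEQ_unique[OF 1[unfolded fourier_integral_mult_formula[OF F(2) H(2)]] 2])
qed

text \<open>
  The inverse transform is \<open>k \<mapsto> (2\<pi>)\<^sup>-\<^sup>d cnj (F (cnj k))\<close>; that it is a right inverse follows by
  testing against an \<open>L\<^sup>2\<close> function with the multiplication formula and Parseval's identity.
\<close>

lemma fourier_inversion:
  fixes k :: "'a::euclidean_space \<Rightarrow> complex"
  assumes k: "k \<in> L2 lborel"
  shows "AE \<xi> in lborel. fourier (\<lambda>x. cnj (fourier (\<lambda>y. cnj (k y)) x)) \<xi>
      = complex_of_real ((2 * pi) ^ DIM('a)) * k \<xi>"
proof -
  define g where "g = (\<lambda>y. cnj (k y))"
  have g: "g \<in> L2 lborel" unfolding g_def by (rule L2_cnj[OF k])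
  define h where "h = (\<lambda>x. cnj (fourier g x))"
  have h: "h \<in> L2 lborel" unfolding h_def by (intro L2_cnj fourier_L2 g)
  define d where "d \<xi> = fourier h \<xi> - complex_of_real ((2 * pi) ^ DIM('a)) * k \<xi>" for \<xi>
  have d: "d \<in> L2 lborel" unfolding d_def by (intro L2_diff L2_cmult fourier_L2 h k)
  have int: "integrable lborel (\<lambda>x. cnj (d x) * fourier h x)"
     "integrable lborel (\<lambda>x. complex_of_real ((2 * pi) ^ DIM('a)) * (cnj (d x) * k x))"
    by (intro L2_mult_integrable integrable_mult_right L2_cnj fourier_L2 d h k)+
  have "(LINT x|lborel. d x * cnj (d x)) = (LINT x|lborel. cnj (d x)
      * fourier h x - complex_of_real ((2 * pi) ^ DIM('a)) * (cnj (d x) * k x))"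
    by (intro Bochner_Integration.integral_cong refl) (simp add: d_def algebra_simps)
  also have "\<dots> = (LINT x|lborel. cnj (d x) * fourier h x) - (LINT x|lborel. complex_of_real ((2
      * pi) ^ DIM('a)) * (cnj (d x) * k x))"
    by (rule Bochner_Integration.integral_diff[OF int])
  also have "(LINT x|lborel. cnj (d x) * fourier h x)
      = (LINT x|lborel. fourier (\<lambda>y. cnj (d y)) x * cnj (fourier g x))"
    unfolding fourier_mult_formula[OF L2_cnj[OF d] h, symmetric] by (simp add: h_def)
  also have "\<dots> = complex_of_real ((2 * pi) ^ DIM('a)) * (LINT x|lborel. cnj (d x) * cnj (g x))"
    by (rule fourier_Parseval[OF L2_cnj[OF d] g])
  also have "\<dots> = (LINT x|lborel. complex_of_real ((2 * pi) ^ DIM('a)) * (cnj (d x) * k x))"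
    by (subst integral_mult_right_zero) (simp add: g_def)
  finally have "(LINT x|lborel. d x * cnj (d x)) = 0" by simp
  hence "complex_of_real (enn2real (sqnorm lborel d)) = 0" by (simp add: sqnorm_eq_inner[OF d])
  hence "enn2real (sqnorm lborel d) = 0" by simp
  hence "sqnorm lborel d = 0" by (subst sqnorm_conv_enn2real[OF d]) simp
  hence "AE x in lborel. d x = 0" using sqnorm_0_iff[OF L2_measurable[OF d]] by simp
  thus ?thesis by eventually_elim (simp add: d_def h_def g_def)
qed

lemma fourier_surj:
  fixes k :: "'a::euclidean_space \<Rightarrow> complex"
  assumes k: "k \<in> L2 lborel"
  shows "\<exists>f\<in>L2 lborel. AE \<xi> in lborel. fourier f \<xi> = k \<xi>"
proof -
  let ?f = "\<lambda>x. cnj (fourier (\<lambda>y. cnj (k y)) x)"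
  let ?c = "complex_of_real ((2 * pi) ^ DIM('a))"
  have f: "?f \<in> L2 lborel" by (intro L2_cnj fourier_L2 k)
  have "AE \<xi> in lborel. fourier (\<lambda>x. inverse ?c * ?f x) \<xi> = k \<xi>"
    using fourier_inversion[OF k] fourier_cmult[OF f, of "inverse ?c"]
    by eventually_elim (simp add: field_simps)
  thus ?thesis using L2_cmult[OF f, of "inverse ?c"] by blast
qed

lemma fourier_inv_spec:
  fixes k :: "'a::euclidean_space \<Rightarrow> complex"
  assumes k: "k \<in> L2 lborel" and eq: "AE \<xi> in lborel. k' \<xi> = k \<xi>"
  shows "fourier_inv k' \<in> L2 lborel \<and> (AE \<xi> in lborel. fourier (fourier_inv k') \<xi> = k' \<xi>)"
proof -
  obtain f where "f \<in> L2 lborel" "AE \<xi> in lborel. fourier f \<xi>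
      = k \<xi>" using fourier_surj[OF k] by blast
  moreover from this(2) eq have "AE \<xi> in lborel. fourier f \<xi> = k' \<xi>" by eventually_elim simp
  ultimately have "\<exists>f. f \<in> L2 lborel \<and> (AE \<xi> in lborel. fourier f \<xi> = k' \<xi>)" by blast
  from someI_ex[OF this] show ?thesis unfolding fourier_inv_def by simp
qed

section \<open>Translation, dilation, involution and convolution\<close>

lemma L2_tendsto_affine:
  fixes t :: "'a::euclidean_space"
  assumes [measurable]: "\<And>n. F n \<in> borel_measurable borel" "f \<in> borel_measurable borel"
    and c: "c \<noteq> 0" and lim: "L2_tendsto lborel F f"
  shows "L2_tendsto lborel (\<lambda>n x. F n (t + c *\<^sub>R x)) (\<lambda>x. f (t + c *\<^sub>R x))"
proof -
  have "sqnorm lborel (\<lambda>x. F n (t + c *\<^sub>R x) - f (t + c *\<^sub>R x))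
      = ennreal (1 / \<bar>c\<bar> ^ DIM('a)) * sqnorm lborel (\<lambda>x. F n x - f x)" for n
  proof -
    have "ennreal (1 / \<bar>c\<bar> ^ DIM('a)) * sqnorm lborel (\<lambda>x. F n x - f x) =
       (ennreal (1 / \<bar>c\<bar> ^ DIM('a)) * ennreal (\<bar>c\<bar> ^ DIM('a))) * sqnorm lborel (\<lambda>x. F n (t
           + c *\<^sub>R x) - f (t + c *\<^sub>R x))"
      by (subst sqnorm_lborel_affine[OF _ c, of _ t]) (auto simp: mult.assoc)
    also have "ennreal (1 / \<bar>c\<bar> ^ DIM('a)) * ennreal (\<bar>c\<bar> ^ DIM('a)) = 1"
      using c by (simp flip: ennreal_mult)
    finally show ?thesis by simp
  qed
  thus ?thesis
    using ennreal_tendsto_cmult[OF _ lim[unfolded L2_tendsto_def], of "ennreal (1 / \<bar>c\<bar> ^ DIM('a))"]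
    by (simp add: L2_tendsto_def)
qed

lemma L2_tendsto_unimodular:
  assumes "\<And>x. cmod (e x) = 1" "L2_tendsto M F f"
  shows "L2_tendsto M (\<lambda>n x. e x * F n x) (\<lambda>x. e x * f x)"
proof -
  have "sqnorm M (\<lambda>x. e x * F n x - e x * f x) = sqnorm M (\<lambda>x. F n x - f x)" for n
    unfolding sqnorm_def using assms(1) by (simp add: norm_mult flip: right_diff_distrib)
  thus ?thesis using assms(2) by (simp add: L2_tendsto_def)
qed

lemma fourier_integral_affine:
  fixes f :: "'a::euclidean_space \<Rightarrow> complex"
  assumes [measurable]: "f \<in> borel_measurable borel" and c: "c \<noteq> 0"
  shows "fourier_integral (\<lambda>x. f (t + c *\<^sub>R x)) \<xi> = complex_of_real (1 / \<bar>c\<bar> ^ DIM('a))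
      * (fexp (- \<xi> /\<^sub>R c) t * fourier_integral f (\<xi> /\<^sub>R c))"
proof -
  have "fexp (- \<xi> /\<^sub>R c) t * fourier_integral f (\<xi> /\<^sub>R c)
      = (LINT x|lborel. f x * fexp (\<xi> /\<^sub>R c) (x - t))"
    unfolding fourier_integral_def
    by (subst integral_mult_right_zero[symmetric], intro Bochner_Integration.integral_cong)
       (auto simp: inner_diff_right exp_add[symmetric] algebra_simps)
  also have "\<dots> = \<bar>c\<bar> ^ DIM('a) *\<^sub>R (LINT x|lborel. f (t + c *\<^sub>R x) * fexp (\<xi> /\<^sub>R c) (t
      + c *\<^sub>R x - t))"
    by (rule integral_lborel_affine[OF _ c]) simp
  also have "\<dots> = \<bar>c\<bar> ^ DIM('a) *\<^sub>R fourier_integral (\<lambda>x. f (t + c *\<^sub>R x)) \<xi>"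
  proof -
    have "(\<xi> /\<^sub>R c) \<bullet> (t + c *\<^sub>R x - t) = \<xi> \<bullet> x" for x using c by (simp add: field_simps)
    thus ?thesis unfolding fourier_integral_def by (simp only:)
  qed
  finally show ?thesis using c by (simp add: scaleR_conv_of_real)
qed

lemma fourier_affine:
  fixes f :: "'a::euclidean_space \<Rightarrow> complex"
  assumes f: "f \<in> L2 lborel" and c: "c \<noteq> 0"
  shows "AE \<xi> in lborel. fourier (\<lambda>x. f (t + c *\<^sub>R x)) \<xi>
      = complex_of_real (1 / \<bar>c\<bar> ^ DIM('a)) * (fexp (- \<xi> /\<^sub>R c) t * fourier f (\<xi> /\<^sub>R c))"
proof -
  obtain F where F: "\<And>n. F n \<in> L2 lborel" "\<And>n. integrable lborel (F n)" "L2_tendsto lborel F f"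
    "L2_tendsto lborel (\<lambda>n. fourier_integral (F n)) (fourier f)"
        by (rule fourier_approx[OF f]) blast
  have [measurable]: "f \<in> borel_measurable borel" "\<And>n.
      F n \<in> borel_measurable borel" "fourier f \<in> borel_measurable borel"
    using L2_measurable[OF f] L2_measurable[OF F(1)] L2_measurable[OF fourier_L2[OF f]] by auto
  have ic: "inverse c \<noteq> 0" using c by simp
  have gL2: "(\<lambda>\<xi>. fourier f (\<xi> /\<^sub>R c)) \<in> L2 lborel"
    using L2_lborel_affine[OF fourier_L2[OF f] ic, of 0] by simp
  show ?thesis
  proof (rule fourier_eqI[where F = "\<lambda>n x. F n (t + c *\<^sub>R x)"])
    have lim: "L2_tendsto lborel (\<lambda>n \<xi>. fourier_integral (F n) (\<xi> /\<^sub>R c)) (\<lambda>\<xi>. fourier f (\<xi> /\<^sub>R c))"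
      using L2_tendsto_affine[OF _ _ ic F(4), of 0] by simp
    have "L2_tendsto lborel (\<lambda>n \<xi>. complex_of_real (1 / \<bar>c\<bar> ^ DIM('a)) * (fexp (- \<xi> /\<^sub>R c) t
        * fourier_integral (F n) (\<xi> /\<^sub>R c)))
       (\<lambda>\<xi>. complex_of_real (1 / \<bar>c\<bar> ^ DIM('a)) * (fexp (- \<xi> /\<^sub>R c) t * fourier f (\<xi> /\<^sub>R c)))"
      by (intro L2_tendsto_cmult L2_tendsto_unimodular lim) (simp_all only: cmod_fexp, measurable)
    moreover have "fourier_integral (\<lambda>x. F n (t + c *\<^sub>R x))
        = (\<lambda>\<xi>. complex_of_real (1 / \<bar>c\<bar> ^ DIM('a)) * (fexp (- \<xi> /\<^sub>R c) t
        * fourier_integral (F n) (\<xi> /\<^sub>R c)))" for n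
      by (intro ext fourier_integral_affine c) simp
    ultimately show "L2_tendsto lborel (\<lambda>n. fourier_integral (\<lambda>x. F n (t
        + c *\<^sub>R x))) (\<lambda>\<xi>. complex_of_real (1 / \<bar>c\<bar> ^ DIM('a)) * (fexp (- \<xi> /\<^sub>R c) t
        * fourier f (\<xi> /\<^sub>R c)))"
      by simp
    show "(\<lambda>\<xi>. complex_of_real (1 / \<bar>c\<bar> ^ DIM('a)) * (fexp (- \<xi> /\<^sub>R c) t
        * fourier f (\<xi> /\<^sub>R c))) \<in> L2 lborel"
    proof (intro L2_cmult L2_dominated[OF gL2])
      show "AE \<xi> in lborel. cmod (fexp (- \<xi> /\<^sub>R c) t * fourier f (\<xi> /\<^sub>R c))
          \<le> cmod (fourier f (\<xi> /\<^sub>R c))"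
        unfolding norm_mult cmod_fexp by simp
    qed measurable
    show "L2_tendsto lborel (\<lambda>n x. F n (t + c *\<^sub>R x)) (\<lambda>x. f (t + c *\<^sub>R x))"
      by (intro L2_tendsto_affine F c) auto
  qed (auto intro!: L2_lborel_affine integrable_lborel_affine f F c)
qed

lemma invol_L2: "u \<in> L2 lborel \<Longrightarrow> invol u \<in> L2 lborel"
  unfolding invol_def[abs_def] using L2_cnj[OF L2_lborel_affine[of u "-1" 0]] by simp

lemma fourier_invol:
  fixes u :: "'a::euclidean_space \<Rightarrow> complex"
  assumes u: "u \<in> L2 lborel"
  shows "AE \<xi> in lborel. fourier (invol u) \<xi> = cnj (fourier u \<xi>)"
proof -
  obtain F where F: "\<And>n. F n \<in> L2 lborel" "\<And>n. integrable lborel (F n)" "L2_tendsto lborel F u"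
    "L2_tendsto lborel (\<lambda>n. fourier_integral (F n)) (fourier u)"
        by (rule fourier_approx[OF u]) blast
  have [measurable]: "u \<in> borel_measurable borel" "\<And>n. F n \<in> borel_measurable borel"
    using L2_measurable[OF u] L2_measurable[OF F(1)] by auto
  show ?thesis
  proof (rule fourier_eqI[where F = "\<lambda>n. invol (F n)"])
    have "fourier_integral (invol (F n)) = (\<lambda>\<xi>. cnj (fourier_integral (F n) \<xi>))" for n
      by (intro ext cnj_fourier_integral) simp
    thus "L2_tendsto lborel (\<lambda>n. fourier_integral (invol (F n))) (\<lambda>\<xi>. cnj (fourier u \<xi>))"
      using L2_tendsto_cnj[OF F(4)] by simp
    show "L2_tendsto lborel (\<lambda>n. invol (F n)) (invol u)"
      unfolding invol_def[abs_def] using L2_tendsto_cnj[OF L2_tendsto_affine[OF _ _ _ F(3), of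
          "-1" 0]] by simp
    show "integrable lborel (invol (F n))" for n
      unfolding invol_def[abs_def] using integrable_lborel_affine[OF F(2)[of n], of "-1" 0] by simp
  qed (auto intro!: invol_L2 L2_cnj fourier_L2 u F)
qed

lemma conv_eq_fourier_integral:
  fixes u f :: "'a::euclidean_space \<Rightarrow> complex"
  assumes u: "u \<in> L2 lborel" and f: "f \<in> L2 lborel"
  shows "conv u f x = complex_of_real (1 / (2 * pi) ^ DIM('a))
      * cnj (fourier_integral (\<lambda>\<xi>. cnj (fourier u \<xi> * fourier f \<xi>)) x)"
proof -
  define w where "w y = invol u (- x + 1 *\<^sub>R y)" for y
  have w: "w \<in> L2 lborel" unfolding w_def[abs_def] by (intro L2_lborel_affine invol_L2 u) simp
  have hw: "AE \<xi> in lborel. fourier w \<xi> = fexp \<xi> x * cnj (fourier u \<xi>)"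
    using fourier_affine[OF invol_L2[OF u] one_neq_zero, of "-x"] fourier_invol[OF u]
    unfolding w_def[abs_def] by eventually_elim simp
  note [measurable] = L2_measurable[OF fourier_L2[OF u]] L2_measurable[OF fourier_L2[OF f]]
      L2_measurable[OF fourier_L2[OF w]]
  have "conv u f x = (LINT y|lborel. f y * cnj (w y))"
    unfolding conv_def by (intro Bochner_Integration.integral_cong) (auto simp: w_def invol_def)
  also have "\<dots> = complex_of_real (1 / (2 * pi) ^ DIM('a)) * (LINT \<xi>|lborel. fourier f \<xi>
      * cnj (fourier w \<xi>))"
    by (subst fourier_Parseval[OF f w]) simp
  also have "(LINT \<xi>|lborel. fourier f \<xi> * cnj (fourier w \<xi>))
      = (LINT \<xi>|lborel. cnj (cnj (fourier u \<xi> * fourier f \<xi>) * fexp x \<xi>))"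
    using hw by (intro integral_cong_AE) (auto elim!: eventually_mono simp: inner_commute)
  also have "\<dots> = cnj (fourier_integral (\<lambda>\<xi>. cnj (fourier u \<xi> * fourier f \<xi>)) x)"
    unfolding fourier_integral_def by (rule Bochner_Integration.integral_cnj)
  finally show ?thesis .
qed

lemma fourier_conv:
  fixes u f :: "'a::euclidean_space \<Rightarrow> complex"
  assumes u: "u \<in> L2 lborel" and ub: "fourier u \<in> Linfty lborel" and f: "f \<in> L2 lborel"
  shows "conv u f \<in> L2 lborel" "AE \<xi> in lborel. fourier (conv u f) \<xi> = fourier u \<xi> * fourier f \<xi>"
proof -
  define k where "k \<xi> = fourier u \<xi> * fourier f \<xi>" for \<xi>
  define C where "C = complex_of_real ((2 * pi) ^ DIM('a))"
  have C: "C \<noteq> 0" by (simp add: C_def)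
  note [measurable] = L2_measurable[OF fourier_L2[OF u]] L2_measurable[OF fourier_L2[OF f]]
  obtain B where "AE \<xi> in lborel. cmod (fourier u \<xi>) \<le> B" using ub by (auto simp: Linfty_def)
  hence k2: "k \<in> L2 lborel" unfolding k_def[abs_def]
      by (intro L2_bounded_mult[OF fourier_L2[OF f]]) auto
  have k1: "integrable lborel k" unfolding k_def[abs_def]
      by (intro L2_mult_integrable fourier_L2 u f)
  have ck: "(\<lambda>\<xi>. cnj (k \<xi>)) \<in> L2 lborel" "integrable lborel (\<lambda>\<xi>. cnj (k \<xi>))"
    using L2_cnj[OF k2] k1 by auto
  define g where "g x = cnj (fourier (\<lambda>\<xi>. cnj (k \<xi>)) x)" for x
  have g: "g \<in> L2 lborel" unfolding g_def[abs_def] by (intro L2_cnj fourier_L2 ck)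
  note [measurable] = L2_measurable[OF ck(1)] L2_measurable[OF k2]
  have eq: "conv u f = (\<lambda>x. inverse C * cnj (fourier_integral (\<lambda>\<xi>. cnj (k \<xi>)) x))"
    by (rule ext) (simp add: conv_eq_fourier_integral[OF u f] k_def C_def field_simps)
  have eqg: "AE x in lborel. conv u f x = inverse C * g x"
    using fourier_eq_fourier_integral[OF ck] by eventually_elim (simp add: eq g_def)
  have [measurable]: "conv u f \<in> borel_measurable borel" unfolding eq by measurable
  show "conv u f \<in> L2 lborel" by (rule L2_cong_AE[OF L2_cmult[OF g] _ eqg]) simp
  have "AE \<xi> in lborel. fourier (\<lambda>x. inverse C * g x) \<xi> = k \<xi>"
    using fourier_cmult[OF g, of "inverse C"] fourier_inversion[OF k2, folded g_def[abs_def] C_def]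
    by eventually_elim (use C in simp)
  thus "AE \<xi> in lborel. fourier (conv u f) \<xi> = fourier u \<xi> * fourier f \<xi>"
    unfolding fourier_cong_AE[OF eqg] k_def .
qed

section \<open>The Fourier transform on the cylinder\<close>

lemma vector_2_eq: "(vector [a, b] :: real^2) = a *\<^sub>R axis 1 1 + b *\<^sub>R axis 2 1"
  by (simp add: vec_eq_iff forall_2 axis_def)

lemma space_circle [simp]: "space circle = sphere 0 1"
  by (simp add: circle_def space_restrict_space)

lemma sets_circle [measurable_cong]: "sets circle = sets (restrict_space borel (sphere 0 1))"
  by (simp add: circle_def)

lemma unit_vector_norm: "norm (vector [cos t, sin t] :: real^2) = 1"
  by (simp add: norm_vec_def L2_set_def sum_2)

lemma unit_vector_borel [measurable]: "(\<lambda>t. vector [cos t, sin t] :: real^2) \<in> borel_measurable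
    borel"
  unfolding vector_2_eq by measurable

lemma unit_vector_measurable:
  "(\<lambda>t. vector [cos t, sin t] :: real^2) \<in> measurable (restrict_space lborel {0..<2
      * pi}) (restrict_space borel (sphere 0 1))"
proof (rule measurable_restrict_space2)
  show "(\<lambda>t. vector [cos t, sin t] :: real^2) \<in> restrict_space lborel {0..<2 * pi} \<rightarrow>\<^sub>M borel"
    by (rule measurable_restrict_space1) simp
qed (simp add: unit_vector_norm)

lemma nn_integral_circle:
  assumes f: "f \<in> borel_measurable (restrict_space borel (sphere 0 1))"
  shows "(\<integral>\<^sup>+\<theta>. f \<theta> \<partial>circle) = (\<integral>\<^sup>+t. f (vector [cos t, sin t]) * indicator {0..<2 * pi} t \<partial>lborel)"
  unfolding circle_def using f
  by (subst nn_integral_distr[OF unit_vector_measurable]) (simp_all add: nn_integral_restrict_space)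

lemma finite_measure_circle: "finite_measure circle"
proof
  have "emeasure circle (space circle) = (\<integral>\<^sup>+\<theta>. 1 \<partial>circle)" by simp
  also have "\<dots> = (\<integral>\<^sup>+t. indicator {0..<2 * pi} t \<partial>lborel)"
    by (subst nn_integral_circle) auto
  also have "\<dots> = ennreal (2 * pi)" by simp
  finally show "emeasure circle (space circle) \<noteq> \<infinity>" by simp
qed

interpretation circle: finite_measure circle by (rule finite_measure_circle)
interpretation circle_lborel: pair_sigma_finite circle "lborel :: real measure" ..

lemma sets_cyl [measurable_cong]: "sets cyl = sets (circle \<Otimes>\<^sub>M (borel :: real measure))"
  unfolding cyl_def by (intro sets_pair_measure_cong) auto

lemma space_cyl: "space cyl = sphere 0 1 \<times> UNIV"
  by (simp add: cyl_def space_pair_measure)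

lemma measurable_cyl_section:
  assumes [measurable]: "f \<in> borel_measurable cyl" and \<theta>: "\<theta> \<in> space circle"
  shows "(\<lambda>s. f (\<theta>, s)) \<in> borel_measurable borel"
proof -
  have "f \<in> borel_measurable (circle \<Otimes>\<^sub>M (borel :: real measure))"
    using assms(1) by (simp add: measurable_cong_sets[OF sets_cyl refl])
  from measurable_compose[OF measurable_Pair1'[OF \<theta>] this] show ?thesis .
qed

lemma nn_integral_cyl:
  assumes "f \<in> borel_measurable cyl"
  shows "(\<integral>\<^sup>+p. f p \<partial>cyl) = (\<integral>\<^sup>+\<theta>. (\<integral>\<^sup>+s. f (\<theta>, s) \<partial>lborel) \<partial>circle)"
  using lborel.nn_integral_fst[of f circle] assms by (simp add: cyl_def)

lemma sqnorm_cyl: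
  assumes [measurable]: "f \<in> borel_measurable cyl"
  shows "sqnorm cyl f = (\<integral>\<^sup>+\<theta>. sqnorm lborel (\<lambda>s. f (\<theta>, s)) \<partial>circle)"
  unfolding sqnorm_def by (rule nn_integral_cyl) measurable

lemma sqnorm_section_measurable:
  assumes f: "f \<in> borel_measurable cyl"
  shows "(\<lambda>\<theta>. sqnorm lborel (\<lambda>s. f (\<theta>, s))) \<in> borel_measurable circle"
proof -
  have [measurable]: "f \<in> borel_measurable (circle \<Otimes>\<^sub>M (lborel :: real measure))"
    using f by (simp add: cyl_def)
  show ?thesis unfolding sqnorm_def by measurable
qed

lemma L2_cyl_section:
  assumes f: "f \<in> L2 cyl"
  shows "AE \<theta> in circle. (\<lambda>s. f (\<theta>, s)) \<in> L2 lborel"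
proof -
  have m: "f \<in> borel_measurable cyl" by (rule L2_measurable[OF f])
  have "(\<integral>\<^sup>+\<theta>. sqnorm lborel (\<lambda>s. f (\<theta>, s)) \<partial>circle) \<noteq> \<infinity>"
    using L2_finite[OF f] sqnorm_cyl[OF m] by simp
  hence "AE \<theta> in circle. sqnorm lborel (\<lambda>s. f (\<theta>, s)) \<noteq> \<infinity>"
    by (intro nn_integral_PInf_AE sqnorm_section_measurable m)
  thus ?thesis using AE_space
    by eventually_elim (auto simp: L2_def less_top intro: measurable_cyl_section[OF m])
qed

lemma AE_cyl_iff:
  assumes f: "f \<in> borel_measurable cyl" and g: "(g :: _ \<Rightarrow> complex) \<in> borel_measurable cyl"
  shows "(AE p in cyl. f p = g p) \<longleftrightarrow> (AE \<theta> in circle. AE s in lborel. f (\<theta>, s) = g (\<theta>, s))"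
proof -
  have [measurable]: "f \<in> borel_measurable (circle \<Otimes>\<^sub>M (lborel :: real measure))" "g \<in>
      borel_measurable (circle \<Otimes>\<^sub>M (lborel :: real measure))"
    using f g by (simp_all add: cyl_def)
  have "{p \<in> space (circle \<Otimes>\<^sub>M (lborel :: real measure)). f p = g p} \<in> sets (circle \<Otimes>\<^sub>M lborel)"
    by measurable
  from circle_lborel.AE_pair_measure[OF this] circle_lborel.AE_pair[of "\<lambda>p. f p = g p"]
  show ?thesis unfolding cyl_def by blast
qed

lemma AE_cyl_sections: "AE p in cyl. P p \<Longrightarrow> AE \<theta> in circle. AE s in lborel. P (\<theta>, s)"
  unfolding cyl_def by (rule circle_lborel.AE_pair)

lemma fourier_integral_section_measurable:
  assumes g: "g \<in> borel_measurable cyl"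
  shows "(\<lambda>(\<theta>, \<sigma>). fourier_integral (\<lambda>s. g (\<theta>, s)) \<sigma>) \<in> borel_measurable cyl"
proof -
  have [measurable]: "g \<in> borel_measurable (circle \<Otimes>\<^sub>M (borel :: real measure))"
    using g by (simp add: measurable_cong_sets[OF sets_cyl refl])
  have "(\<lambda>p. LINT s|lborel. g (fst p, s) * exp (- (\<i>
      * complex_of_real (snd p \<bullet> s)))) \<in> borel_measurable cyl"
    by (rule lborel.borel_measurable_lebesgue_integral) measurable
  thus ?thesis by (simp add: fourier_integral_def case_prod_unfold)
qed

text \<open>
  Nothing makes the sectionwise \<open>fourier\<close> jointly measurable, since its representatives are chosen
  section by section. The transforms of the truncations are integrals and thus jointly measurable;
  along a subsequence of them almost every section converges.
\<close>

lemma fourier2_exists: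
  assumes g: "g \<in> L2 cyl"
  shows "\<exists>h\<in>L2 cyl. AE \<theta> in circle. AE \<sigma> in lborel. h (\<theta>, \<sigma>) = fourier (\<lambda>s. g (\<theta>, s)) \<sigma>"
proof -
  define A where "A n = space circle \<times> cball (0::real) (real n)" for n :: nat
  have Am: "A n \<in> sets cyl" for n unfolding A_def cyl_def by (rule pair_measureI[OF sets.top]) simp
  define G where "G n p = indicator (A n) p * g p" for n p
  define H where "H n = (\<lambda>(\<theta>, \<sigma>). fourier_integral (\<lambda>s. G n (\<theta>, s)) \<sigma>)" for n
  have gm: "g \<in> borel_measurable cyl" by (rule L2_measurable[OF g])
  have G: "G n \<in> L2 cyl" for n unfolding G_def[abs_def] by (rule L2_indicator_mult[OF g Am])
  have Gm: "G n \<in> borel_measurable cyl" for n by (rule L2_measurable[OF G])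
  have lG: "L2_tendsto cyl G g"
    unfolding G_def[abs_def]
  proof (rule L2_tendsto_truncation[OF g Am])
    fix p assume "p \<in> space cyl"
    thus "\<forall>\<^sub>F n in sequentially. p \<in> A n"
      using eventually_norm_le[of "snd p"] by (cases p)
          (auto simp: A_def space_cyl elim!: eventually_mono)
  qed
  have Hm: "H n \<in> borel_measurable cyl" for n
    unfolding H_def by (rule fourier_integral_section_measurable[OF Gm])
  have sect: "AE \<theta> in circle. \<theta> \<in> space circle \<and> (\<lambda>s. g (\<theta>, s)) \<in> L2 lborel"
    using L2_cyl_section[OF g] AE_space by eventually_elim simp
  have Gs: "(\<lambda>s. G n (\<theta>, s)) = (\<lambda>s. indicator (cball 0 (real n)) s
      * g (\<theta>, s))" if "\<theta> \<in> space circle" for n \<theta>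
    using that by (auto simp: G_def A_def indicator_def fun_eq_iff)
  have Gs2: "(\<lambda>s. G n (\<theta>, s)) \<in> L2 lborel" "integrable lborel (\<lambda>s. G n (\<theta>, s))"
    if "\<theta> \<in> space circle" "(\<lambda>s. g (\<theta>, s)) \<in> L2 lborel" for n \<theta>
    unfolding Gs[OF that(1)] by (rule L2_cball_truncation[OF that(2)])+
  have mult: "(\<integral>\<^sup>+\<theta>. ennreal (2 * pi) * f \<theta> \<partial>circle)
      = ennreal (2 * pi) * (\<integral>\<^sup>+\<theta>. f \<theta> \<partial>circle)" if "f \<in> borel_measurable circle" for f
    using that by (rule nn_integral_cmult)
  have Hdiff: "sqnorm cyl (\<lambda>p. H m p - H n p) = ennreal (2 * pi)
      * sqnorm cyl (\<lambda>p. G m p - G n p)" for m n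
  proof -
    have Gmm: "(\<lambda>p. G m p - G n p) \<in> borel_measurable cyl" by (intro borel_measurable_diff Gm)
    have "sqnorm cyl (\<lambda>p. H m p - H n p) = (\<integral>\<^sup>+\<theta>. sqnorm lborel (\<lambda>s.
        H m (\<theta>, s) - H n (\<theta>, s)) \<partial>circle)"
      by (intro sqnorm_cyl borel_measurable_diff Hm)
    also have "\<dots> = (\<integral>\<^sup>+\<theta>. ennreal (2 * pi) * sqnorm lborel (\<lambda>s. G m (\<theta>, s) - G n (\<theta>, s)) \<partial>circle)"
      using sect
      by (intro nn_integral_cong_AE, eventually_elim)
         (simp add: H_def sqnorm_fourier_integral_diff Gs2)
    also have "\<dots> = ennreal (2 * pi) * (\<integral>\<^sup>+\<theta>. sqnorm lborel (\<lambda>s. G m (\<theta>, s) - G n (\<theta>, s)) \<partial>circle)"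
      by (rule mult[OF sqnorm_section_measurable[OF Gmm]])
    also have "\<dots> = ennreal (2 * pi) * sqnorm cyl (\<lambda>p. G m p - G n p)"
      by (simp add: sqnorm_cyl[OF Gmm])
    finally show ?thesis .
  qed
  have H2: "H n \<in> L2 cyl" for n
  proof -
    have "sqnorm cyl (H n) = (\<integral>\<^sup>+\<theta>. sqnorm lborel (\<lambda>s. H n (\<theta>, s)) \<partial>circle)"
      by (rule sqnorm_cyl[OF Hm])
    also have "\<dots> = (\<integral>\<^sup>+\<theta>. ennreal (2 * pi) * sqnorm lborel (\<lambda>s. G n (\<theta>, s)) \<partial>circle)"
      using sect
      by (intro nn_integral_cong_AE, eventually_elim)
         (simp add: H_def fourier_integral_Plancherel Gs2)
    also have "\<dots> = ennreal (2 * pi) * sqnorm cyl (G n)"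
      by (simp add: mult[OF sqnorm_section_measurable[OF Gm]] sqnorm_cyl[OF Gm])
    also have "\<dots> < \<infinity>" using L2_finite[OF G[of n]] by (simp add: ennreal_mult_less_top)
    finally show ?thesis using Hm[of n] by (simp add: L2_def)
  qed
  have "\<exists>h\<in>L2 cyl. L2_tendsto cyl H h"
  proof (rule L2_complete[OF H2])
    fix e :: real assume e: "e > 0"
    then obtain K where K: "\<And>m n. m \<ge> K \<Longrightarrow> n \<ge> K \<Longrightarrow> sqnorm cyl (\<lambda>p. G m p - G n p)
        < ennreal (e / (2 * pi))"
      using L2_tendsto_imp_Cauchy[OF Gm gm lG, of "e / (2 * pi)"] by auto
    have "sqnorm cyl (\<lambda>p. H m p - H n p) < ennreal e" if "m \<ge> K" "n \<ge> K" for m n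
    proof -
      have "sqnorm cyl (\<lambda>p. H m p - H n p) < ennreal (2 * pi) * ennreal (e / (2 * pi))"
        unfolding Hdiff by (intro ennreal_mult_strict_left_mono K that)
            (auto simp: ennreal_zero_less_mult_iff)
      also have "\<dots> = ennreal e" using e by (subst ennreal_mult[symmetric]) auto
      finally show ?thesis .
    qed
    thus "\<exists>K. \<forall>m\<ge>K. \<forall>n\<ge>K. sqnorm cyl (\<lambda>p. H m p - H n p) < ennreal e" by blast
  qed
  then obtain h where h: "h \<in> L2 cyl" and lH: "L2_tendsto cyl H h" by blast
  have hm: "h \<in> borel_measurable cyl" by (rule L2_measurable[OF h])
  have dm: "(\<lambda>p. H n p - h p) \<in> borel_measurable cyl" for n by (intro borel_measurable_diff Hm hm)
  have "(\<lambda>n. \<integral>\<^sup>+\<theta>. sqnorm lborel (\<lambda>s. H n (\<theta>, s) - h (\<theta>, s)) \<partial>circle) \<longlonglongrightarrow> 0"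
    using lH unfolding L2_tendsto_def sqnorm_cyl[OF dm] .
  from nn_integral_subseq_AE[OF sqnorm_section_measurable[OF dm] this]
  obtain r where r: "strict_mono r" and lr: "AE \<theta> in circle. (\<lambda>n. sqnorm lborel (\<lambda>s.
      H (r n) (\<theta>, s) - h (\<theta>, s))) \<longlonglongrightarrow> 0"
    by auto
  have "AE \<theta> in circle. AE \<sigma> in lborel. h (\<theta>, \<sigma>) = fourier (\<lambda>s. g (\<theta>, s)) \<sigma>"
    using sect lr L2_cyl_section[OF h]
  proof eventually_elim
    case (elim \<theta>)
    have "AE \<sigma> in lborel. fourier (\<lambda>s. g (\<theta>, s)) \<sigma> = (\<lambda>\<sigma>. h (\<theta>, \<sigma>)) \<sigma>"
    proof (rule fourier_eqI[where F = "\<lambda>n s. G (r n) (\<theta>, s)"])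
      show "L2_tendsto lborel (\<lambda>n. fourier_integral (\<lambda>s. G (r n) (\<theta>, s))) (\<lambda>\<sigma>. h (\<theta>, \<sigma>))"
        using elim by (simp add: L2_tendsto_def H_def)
      have "L2_tendsto lborel (\<lambda>n s. indicator (cball 0 (real n)) s * g (\<theta>, s)) (\<lambda>s. g (\<theta>, s))"
        using elim by (intro L2_tendsto_cball_truncation) auto
      from LIMSEQ_subseq_LIMSEQ[OF this[unfolded L2_tendsto_def] r]
      show "L2_tendsto lborel (\<lambda>n s. G (r n) (\<theta>, s)) (\<lambda>s. g (\<theta>, s))"
        using Gs[of \<theta>] elim by (simp add: L2_tendsto_def o_def fun_eq_iff)
    qed (use elim Gs2 in auto)
    thus ?case by eventually_elim simp
  qed
  thus ?thesis using h by blast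
qed

lemma fourier2_spec:
  assumes g: "g \<in> L2 cyl"
  shows "fourier2 g \<in> L2 cyl \<and> (AE \<theta> in circle. AE \<sigma> in lborel. fourier2 g (\<theta>, \<sigma>)
      = fourier (\<lambda>s. g (\<theta>, s)) \<sigma>)"
proof -
  have "\<exists>h. h \<in> L2 cyl \<and> (AE \<theta> in circle. AE \<sigma> in lborel. h (\<theta>, \<sigma>) = fourier (\<lambda>s. g (\<theta>, s)) \<sigma>)"
    using fourier2_exists[OF g] by blast
  from someI_ex[OF this] show ?thesis unfolding fourier2_def by simp
qed

lemma fourier2_L2: "g \<in> L2 cyl \<Longrightarrow> fourier2 g \<in> L2 cyl"
  using fourier2_spec by blast

lemma fourier2_section: "g \<in> L2 cyl \<Longrightarrow> AE \<theta> in circle. AE \<sigma> in lborel. fourier2 g (\<theta>, \<sigma>)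
    = fourier (\<lambda>s. g (\<theta>, s)) \<sigma>"
  using fourier2_spec by blast

lemma fourier2_eqI:
  assumes g: "g \<in> L2 cyl" and h: "h \<in> borel_measurable cyl"
    and "AE \<theta> in circle. AE \<sigma> in lborel. fourier (\<lambda>s. g (\<theta>, s)) \<sigma> = h (\<theta>, \<sigma>)"
  shows "AE p in cyl. fourier2 g p = h p"
  unfolding AE_cyl_iff[OF L2_measurable[OF fourier2_L2[OF g]] h]
  using fourier2_section[OF g] assms(3)
proof eventually_elim
  case (elim \<theta>) thus ?case by eventually_elim simp
qed

lemma fourier2_cong_AE:
  assumes "AE p in cyl. f p = g p"
  shows "fourier2 f = fourier2 g"
proof -
  have eq: "AE \<theta> in circle. fourier (\<lambda>s. f (\<theta>, s)) = fourier (\<lambda>s. g (\<theta>, s))"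
    using AE_cyl_sections[OF assms] by eventually_elim (rule fourier_cong_AE)
  have "(AE \<theta> in circle. AE \<sigma> in lborel. h (\<theta>, \<sigma>) = fourier (\<lambda>s. f (\<theta>, s)) \<sigma>) \<longleftrightarrow>
    (AE \<theta> in circle. AE \<sigma> in lborel. h (\<theta>, \<sigma>) = fourier (\<lambda>s. g (\<theta>, s)) \<sigma>)"
    (is "?P \<longleftrightarrow> ?Q") for h
  proof
    assume ?P from this eq show ?Q by eventually_elim simp
  next
    assume ?Q from this eq show ?P by eventually_elim simp
  qed
  thus ?thesis unfolding fourier2_def by simp
qed

lemma fourier2_add:
  assumes f: "f \<in> L2 cyl" and g: "g \<in> L2 cyl"
  shows "AE p in cyl. fourier2 (\<lambda>p. f p + g p) p = fourier2 f p + fourier2 g p"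
proof (rule fourier2_eqI[OF L2_add[OF f g]])
  show "(\<lambda>p. fourier2 f p + fourier2 g p) \<in> borel_measurable cyl"
    by (intro L2_measurable L2_add fourier2_L2 f g)
  show "AE \<theta> in circle. AE \<sigma> in lborel. fourier (\<lambda>s. f (\<theta>, s) + g (\<theta>, s)) \<sigma>
      = fourier2 f (\<theta>, \<sigma>) + fourier2 g (\<theta>, \<sigma>)"
    using fourier2_section[OF f] fourier2_section[OF g] L2_cyl_section[OF f] L2_cyl_section[OF g]
  proof eventually_elim
    case (elim \<theta>)
    from elim(1,2) fourier_add[OF elim(3,4)] show ?case by eventually_elim simp
  qed
qed

lemma fourier2_cmult:
  assumes f: "f \<in> L2 cyl"
  shows "AE p in cyl. fourier2 (\<lambda>p. c * f p) p = c * fourier2 f p"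
proof (rule fourier2_eqI[OF L2_cmult[OF f]])
  show "(\<lambda>p. c * fourier2 f p) \<in> borel_measurable cyl"
    by (intro L2_measurable L2_cmult fourier2_L2 f)
  show "AE \<theta> in circle. AE \<sigma> in lborel. fourier (\<lambda>s. c * f (\<theta>, s)) \<sigma> = c * fourier2 f (\<theta>, \<sigma>)"
    using fourier2_section[OF f] L2_cyl_section[OF f]
  proof eventually_elim
    case (elim \<theta>)
    from elim(1) fourier_cmult[OF elim(2), of c] show ?case by eventually_elim simp
  qed
qed

lemma fourier2_diff:
  assumes f: "f \<in> L2 cyl" and g: "g \<in> L2 cyl"
  shows "AE p in cyl. fourier2 (\<lambda>p. f p - g p) p = fourier2 f p - fourier2 g p"
  using fourier2_add[OF f L2_cmult[OF g, of "-1"]] fourier2_cmult[OF g, of "-1"]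
  by eventually_elim simp

lemma Plancherel2:
  assumes g: "g \<in> L2 cyl"
  shows "sqnorm cyl (fourier2 g) = ennreal (2 * pi) * sqnorm cyl g"
proof -
  have gm: "g \<in> borel_measurable cyl" by (rule L2_measurable[OF g])
  have "sqnorm cyl (fourier2 g) = (\<integral>\<^sup>+\<theta>. sqnorm lborel (\<lambda>s. fourier2 g (\<theta>, s)) \<partial>circle)"
    by (rule sqnorm_cyl[OF L2_measurable[OF fourier2_L2[OF g]]])
  also have "\<dots> = (\<integral>\<^sup>+\<theta>. ennreal (2 * pi) * sqnorm lborel (\<lambda>s. g (\<theta>, s)) \<partial>circle)"
  proof (rule nn_integral_cong_AE)
    show "AE \<theta> in circle. sqnorm lborel (\<lambda>s. fourier2 g (\<theta>, s))
        = ennreal (2 * pi) * sqnorm lborel (\<lambda>s. g (\<theta>, s))"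
      using fourier2_section[OF g] L2_cyl_section[OF g]
    proof eventually_elim
      case (elim \<theta>)
      show ?case using sqnorm_cong_AE[OF elim(1)] Plancherel[OF elim(2)] by simp
    qed
  qed
  also have "\<dots> = ennreal (2 * pi) * (\<integral>\<^sup>+\<theta>. sqnorm lborel (\<lambda>s. g (\<theta>, s)) \<partial>circle)"
    by (rule nn_integral_cmult[OF sqnorm_section_measurable[OF gm]])
  finally show ?thesis by (simp add: sqnorm_cyl[OF gm])
qed

lemma sqnorm_fourier2_diff:
  assumes f: "f \<in> L2 cyl" and g: "g \<in> L2 cyl"
  shows "sqnorm cyl (\<lambda>p. fourier2 f p - fourier2 g p)
      = ennreal (2 * pi) * sqnorm cyl (\<lambda>p. f p - g p)"
  using sqnorm_cong_AE[OF fourier2_diff[OF f g]] Plancherel2[OF L2_diff[OF f g]] by simp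

lemma fourier2_tendsto:
  assumes "\<And>n. F n \<in> L2 cyl" "f \<in> L2 cyl" "L2_tendsto cyl F f"
  shows "L2_tendsto cyl (\<lambda>n. fourier2 (F n)) (fourier2 f)"
  using ennreal_tendsto_cmult[OF _ assms(3)[unfolded L2_tendsto_def], of "ennreal (2 * pi)"]
  by (simp add: L2_tendsto_def sqnorm_fourier2_diff[OF assms(1,2)])

lemma fourier2_inj:
  assumes f: "f \<in> L2 cyl" and g: "g \<in> L2 cyl" and eq: "AE p in cyl. fourier2 f p = fourier2 g p"
  shows "AE p in cyl. f p = g p"
proof -
  note [measurable] = L2_measurable[OF f] L2_measurable[OF g]
  have "sqnorm cyl (\<lambda>p. fourier2 f p - fourier2 g p) = sqnorm cyl (\<lambda>p. 0)"
    using eq by (intro sqnorm_cong_AE) auto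
  hence "ennreal (2 * pi) * sqnorm cyl (\<lambda>p. f p - g p) = 0"
    by (simp add: sqnorm_fourier2_diff[OF f g])
  moreover have "ennreal (2 * pi) \<noteq> 0" by (simp add: ennreal_eq_0_iff not_le)
  ultimately have "sqnorm cyl (\<lambda>p. f p - g p) = 0" using mult_eq_0_iff by blast
  thus ?thesis by (subst (asm) sqnorm_0_iff) auto
qed

lemma fourier2_surj:
  assumes k: "k \<in> L2 cyl"
  shows "\<exists>g\<in>L2 cyl. AE p in cyl. fourier2 g p = k p"
proof -
  define c where "c = complex_of_real (2 * pi)"
  have c: "c \<noteq> 0" by (simp add: c_def)
  define g where "g p = inverse c * cnj (fourier2 (\<lambda>q. cnj (k q)) p)" for p
  have ck: "(\<lambda>q. cnj (k q)) \<in> L2 cyl" by (rule L2_cnj[OF k])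
  have g: "g \<in> L2 cyl" unfolding g_def[abs_def] by (intro L2_cmult L2_cnj fourier2_L2 k)
  have "AE p in cyl. fourier2 g p = k p"
  proof (rule fourier2_eqI[OF g L2_measurable[OF k]])
    show "AE \<theta> in circle. AE \<sigma> in lborel. fourier (\<lambda>s. g (\<theta>, s)) \<sigma> = k (\<theta>, \<sigma>)"
      using fourier2_section[OF ck] L2_cyl_section[OF k]
    proof eventually_elim
      case (elim \<theta>)
      let ?f = "\<lambda>x. cnj (fourier (\<lambda>y. cnj (k (\<theta>, y))) x)"
      have f: "?f \<in> L2 lborel" by (intro L2_cnj fourier_L2 elim)
      have "AE s in lborel. g (\<theta>, s) = inverse c * ?f s"
        using elim(1) by eventually_elim (simp add: g_def)
      hence "fourier (\<lambda>s. g (\<theta>, s)) = fourier (\<lambda>s. inverse c * ?f s)" by (rule fourier_cong_AE)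
      with fourier_cmult[OF f, of "inverse c"] fourier_inversion[OF elim(2)] c
      show ?case by (auto simp: c_def field_simps elim!: eventually_elim2)
    qed
  qed
  thus ?thesis using g by blast
qed

lemma fourier2_inv_spec:
  assumes k: "k \<in> L2 cyl"
  shows "fourier2_inv k \<in> L2 cyl \<and> (AE p in cyl. fourier2 (fourier2_inv k) p = k p)"
proof -
  have "\<exists>g. g \<in> L2 cyl \<and> (AE p in cyl. fourier2 g p = k p)" using fourier2_surj[OF k] by blast
  from someI_ex[OF this] show ?thesis unfolding fourier2_inv_def by simp
qed

lemma invol2_measurable:
  assumes "v \<in> borel_measurable cyl"
  shows "invol2 v \<in> borel_measurable cyl"
proof -
  have [measurable]: "v \<in> borel_measurable (circle \<Otimes>\<^sub>M (borel :: real measure))"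
    using assms by (simp add: measurable_cong_sets[OF sets_cyl refl])
  show ?thesis unfolding invol2_def by measurable
qed

lemma invol2_section: "(\<lambda>s. invol2 v (\<theta>, s)) = invol (\<lambda>s. v (\<theta>, s))"
  by (simp add: invol2_def invol_def fun_eq_iff)

lemma sqnorm_invol: 
  assumes "u \<in> borel_measurable borel"
  shows "sqnorm lborel (invol u) = sqnorm lborel u"
  using sqnorm_lborel_affine[OF assms, of "-1" 0] by (simp add: invol_def[abs_def])

lemma invol2_L2:
  assumes v: "v \<in> L2 cyl"
  shows "invol2 v \<in> L2 cyl"
proof -
  have m: "v \<in> borel_measurable cyl" by (rule L2_measurable[OF v])
  have "sqnorm cyl (invol2 v) = (\<integral>\<^sup>+\<theta>. sqnorm lborel (\<lambda>s. invol2 v (\<theta>, s)) \<partial>circle)"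
    by (rule sqnorm_cyl[OF invol2_measurable[OF m]])
  also have "\<dots> = (\<integral>\<^sup>+\<theta>. sqnorm lborel (\<lambda>s. v (\<theta>, s)) \<partial>circle)"
    unfolding invol2_section
    by (intro nn_integral_cong sqnorm_invol measurable_cyl_section[OF m])
  also have "\<dots> = sqnorm cyl v" by (rule sqnorm_cyl[OF m, symmetric])
  finally show ?thesis using v invol2_measurable[OF m] by (simp add: L2_def)
qed

lemma fourier2_invol2:
  assumes v: "v \<in> L2 cyl"
  shows "AE p in cyl. fourier2 (invol2 v) p = cnj (fourier2 v p)"
proof (rule fourier2_eqI[OF invol2_L2[OF v]])
  show "(\<lambda>p. cnj (fourier2 v p)) \<in> borel_measurable cyl"
    by (intro L2_measurable L2_cnj fourier2_L2 v)
  show "AE \<theta> in circle. AE \<sigma> in lborel. fourier (\<lambda>s. invol2 v (\<theta>, s)) \<sigma> = cnj (fourier2 v (\<theta>, \<sigma>))"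
    using fourier2_section[OF v] L2_cyl_section[OF v]
  proof eventually_elim
    case (elim \<theta>)
    from elim(1) fourier_invol[OF elim(2)] show ?case
      unfolding invol2_section by eventually_elim simp
  qed
qed

lemma fourier2_conv2:
  assumes v: "v \<in> L2 cyl" and vb: "AE p in cyl. cmod (fourier2 v p) \<le> C" and g: "g \<in> L2 cyl"
  shows "conv2 v g \<in> L2 cyl" "AE p in cyl. fourier2 (conv2 v g) p = fourier2 v p * fourier2 g p"
proof -
  have [measurable]: "v \<in> borel_measurable (circle \<Otimes>\<^sub>M (borel :: real measure))" "g \<in>
      borel_measurable (circle \<Otimes>\<^sub>M (borel :: real measure))"
    using L2_measurable[OF v] L2_measurable[OF g] by
        (simp_all add: measurable_cong_sets[OF sets_cyl refl])
  have sec: "(\<lambda>s. conv2 v g (\<theta>, s)) = conv (\<lambda>s. v (\<theta>, s)) (\<lambda>s. g (\<theta>, s))" for \<theta>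
    by (simp add: conv2_def conv_def fun_eq_iff)
  have "(\<lambda>p. LINT t|lborel. v (fst p, snd p - t) * g (fst p, t)) \<in> borel_measurable cyl"
    by (rule lborel.borel_measurable_lebesgue_integral) measurable
  hence m: "conv2 v g \<in> borel_measurable cyl" by (simp add: conv2_def case_prod_unfold)
  have k2: "(\<lambda>p. fourier2 v p * fourier2 g p) \<in> L2 cyl"
    by (rule L2_bounded_mult[OF fourier2_L2[OF g] L2_measurable[OF fourier2_L2[OF v]] vb])
  have fib: "AE \<theta> in circle. (\<lambda>s. conv2 v g (\<theta>, s)) \<in> L2 lborel
      \<and> (AE \<sigma> in lborel. fourier (\<lambda>s. conv2 v g (\<theta>, s)) \<sigma> = fourier2 v (\<theta>, \<sigma>) * fourier2 g (\<theta>, \<sigma>))"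
    using fourier2_section[OF v] fourier2_section[OF g] L2_cyl_section[OF v] L2_cyl_section[OF g]
        AE_cyl_sections[OF vb]
  proof eventually_elim
    case (elim \<theta>)
    have "AE \<sigma> in lborel. cmod (fourier (\<lambda>s. v (\<theta>, s)) \<sigma>) \<le> C"
      using elim(1,5) by eventually_elim simp
    hence "fourier (\<lambda>s. v (\<theta>, s)) \<in> Linfty lborel"
      using L2_measurable[OF fourier_L2[OF elim(3)]] by (auto simp: Linfty_def)
    note c = fourier_conv[OF elim(3) this elim(4)]
    from elim(1,2) c(2) have "AE \<sigma> in lborel. fourier (\<lambda>s. conv2 v g (\<theta>, s)) \<sigma>
        = fourier2 v (\<theta>, \<sigma>) * fourier2 g (\<theta>, \<sigma>)"
      unfolding sec by eventually_elim simp
    thus ?case using c(1) by (simp add: sec)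
  qed
  have "sqnorm cyl (\<lambda>p. fourier2 v p * fourier2 g p)
      = (\<integral>\<^sup>+\<theta>. sqnorm lborel (\<lambda>s. fourier2 v (\<theta>, s) * fourier2 g (\<theta>, s)) \<partial>circle)"
    by (rule sqnorm_cyl[OF L2_measurable[OF k2]])
  also have "\<dots> = (\<integral>\<^sup>+\<theta>. ennreal (2 * pi) * sqnorm lborel (\<lambda>s. conv2 v g (\<theta>, s)) \<partial>circle)"
  proof (rule nn_integral_cong_AE)
    show "AE \<theta> in circle. sqnorm lborel (\<lambda>s. fourier2 v (\<theta>, s) * fourier2 g (\<theta>, s))
        = ennreal (2 * pi) * sqnorm lborel (\<lambda>s. conv2 v g (\<theta>, s))"
      using fib
    proof eventually_elim
      case (elim \<theta>)
      hence "sqnorm lborel (fourier (\<lambda>s. conv2 v g (\<theta>, s)))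
          = sqnorm lborel (\<lambda>s. fourier2 v (\<theta>, s) * fourier2 g (\<theta>, s))"
        by (intro sqnorm_cong_AE) blast
      thus ?case using Plancherel[of "\<lambda>s. conv2 v g (\<theta>, s)"] elim by simp
    qed
  qed
  also have "\<dots> = ennreal (2 * pi) * sqnorm cyl (conv2 v g)"
    by (simp add: nn_integral_cmult[OF sqnorm_section_measurable[OF m]] sqnorm_cyl[OF m])
  finally have "ennreal (2 * pi) * sqnorm cyl (conv2 v g) < \<infinity>"
    using L2_finite[OF k2] by simp
  hence "sqnorm cyl (conv2 v g) < \<infinity>"
    by (auto simp: ennreal_mult_less_top)
  thus c2: "conv2 v g \<in> L2 cyl" using m by (simp add: L2_def)
  show "AE p in cyl. fourier2 (conv2 v g) p = fourier2 v p * fourier2 g p"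
    using fib by (intro fourier2_eqI[OF c2 L2_measurable[OF k2]]) (auto elim: eventually_mono)
qed

section \<open>Polar coordinates\<close>

lemma nn_integral_inverse_cos_square:
  assumes "l \<le> u"
  shows "(\<integral>\<^sup>+t. ennreal (1 / (cos t)\<^sup>2) * indicator {arctan l..arctan u} t \<partial>lborel)
      = ennreal (u - l)"
proof -
  have c: "cos t \<noteq> 0" if "arctan l \<le> t" "t \<le> arctan u" for t
  proof -
    have "- (pi/2) < t" "t < pi/2" using that arctan_lbound[of l] arctan_ubound[of u] by auto
    thus ?thesis using cos_gt_zero_pi[of t] by auto
  qed
  have "(\<integral>\<^sup>+t. ennreal (1 / (cos t)\<^sup>2) * indicator {arctan l..arctan u} t \<partial>lborel)
      = ennreal (tan (arctan u) - tan (arctan l))"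
  proof (rule nn_integral_FTC_Icc)
    show "arctan l \<le> arctan u" using assms by (simp add: arctan_le_iff)
    fix t assume t: "t \<in> {arctan l..arctan u}"
    from DERIV_tan[OF c, of t] t show "(tan has_real_derivative 1 / (cos t)\<^sup>2) (at t)"
      by (simp add: inverse_eq_divide)
  qed auto
  thus ?thesis by (simp add: tan_arctan)
qed

lemma nn_integral_tan:
  fixes f :: "real \<Rightarrow> ennreal"
  assumes [measurable]: "f \<in> borel_measurable borel"
  shows "(\<integral>\<^sup>+y. f y \<partial>lborel) = (\<integral>\<^sup>+t. f (tan t) * ennreal (1 / (cos t)\<^sup>2)
      * indicator {-(pi/2)<..<pi/2} t \<partial>lborel)"
proof -
  have tanm [measurable]: "(tan :: real \<Rightarrow> real) \<in> borel_measurable borel"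
    unfolding tan_def[abs_def] by measurable
  define D where "D = density lborel (\<lambda>t. ennreal (1 / (cos t)\<^sup>2) * indicator {-(pi/2)<..<pi/2} t)"
  have "lborel = distr D borel tan"
  proof (rule lborel_eqI)
    fix l u :: real assume "\<And>b. b \<in> Basis \<Longrightarrow> l \<bullet> b \<le> u \<bullet> b"
    hence lu: "l \<le> u" by simp
    have "emeasure (distr D borel tan) (box l u) = emeasure D (tan -` {l<..<u})"
      by (subst emeasure_distr) (auto simp: D_def box_real)
    also have "\<dots> = (\<integral>\<^sup>+t. ennreal (1 / (cos t)\<^sup>2) * indicator {-(pi/2)<..<pi/2} t
        * indicator (tan -` {l<..<u}) t \<partial>lborel)"
    proof -
      have "tan -` {l<..<u} \<in> sets borel"
        using measurable_sets[OF tanm, of "{l<..<u}"] by simp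
      thus ?thesis unfolding D_def by (subst emeasure_density) auto
    qed
    also have "\<dots> = (\<integral>\<^sup>+t. ennreal (1 / (cos t)\<^sup>2) * indicator {arctan l..arctan u} t \<partial>lborel)"
    proof (intro nn_integral_cong_AE)
      have "AE t in lborel. t \<noteq> arctan l" "AE t in lborel. t \<noteq> arctan u"
        by (rule AE_lborel_singleton)+
      thus "AE t in lborel. ennreal (1 / (cos t)\<^sup>2) * indicator {-(pi/2)<..<pi/2} t
          * indicator (tan -` {l<..<u}) t = ennreal (1 / (cos t)\<^sup>2)
          * indicator {arctan l..arctan u} t"
      proof eventually_elim
        case (elim t)
        have "(t \<in> {-(pi/2)<..<pi/2} \<and> t \<in> tan -` {l<..<u}) \<longleftrightarrow> t \<in> {arctan l..arctan u}"
        proof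
          assume a: "t \<in> {-(pi/2)<..<pi/2} \<and> t \<in> tan -` {l<..<u}"
          hence "arctan (tan t) = t" by (intro arctan_tan) auto
          moreover have "arctan l \<le> arctan (tan t)" "arctan (tan t) \<le> arctan u"
            using a by (auto simp: arctan_le_iff)
          ultimately show "t \<in> {arctan l..arctan u}" by auto
        next
          assume a: "t \<in> {arctan l..arctan u}"
          hence b: "-(pi/2) < t" "t < pi/2" using arctan_lbound[of l] arctan_ubound[of u] by auto
          have "tan (arctan l) < tan t" "tan t < tan (arctan u)"
            using a b elim arctan_lbound[of l] arctan_ubound[of u] by (auto intro!: tan_monotone)
          thus "t \<in> {-(pi/2)<..<pi/2} \<and> t \<in> tan -` {l<..<u}"
            using b by (simp add: tan_arctan)
        qed
        thus ?case by (auto simp: indicator_def)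
      qed
    qed
    also have "\<dots> = ennreal (u - l)" by (rule nn_integral_inverse_cos_square[OF lu])
    finally show "emeasure (distr D borel tan) (box l u) = (\<Prod>b\<in>Basis. (u - l) \<bullet> b)" by simp
  qed simp
  hence "(\<integral>\<^sup>+y. f y \<partial>lborel) = (\<integral>\<^sup>+y. f y \<partial>distr D borel tan)" by simp
  also have "\<dots> = (\<integral>\<^sup>+t. f (tan t) \<partial>D)"
    by (rule nn_integral_distr) (simp_all add: D_def)
  also have "\<dots> = (\<integral>\<^sup>+t. ennreal (1 / (cos t)\<^sup>2) * indicator {-(pi/2)<..<pi/2} t
      * f (tan t) \<partial>lborel)"
    unfolding D_def by (subst nn_integral_density) auto
  finally show ?thesis by (simp add: mult_ac)
qed

lemma vector_2_borel [measurable]: "(\<lambda>p. vector [fst p, snd p] :: real^2) \<in> borel_measurable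
    (borel \<Otimes>\<^sub>M borel)"
  unfolding vector_2_eq by measurable

lemma Basis_vec_2: "(Basis :: (real^2) set) = {axis 1 1, axis 2 1}"
  by (auto simp: Basis_vec_def UNIV_2)

lemma nn_integral_lborel_vec2:
  fixes w :: "real^2 \<Rightarrow> ennreal"
  assumes [measurable]: "w \<in> borel_measurable borel"
  shows "(\<integral>\<^sup>+\<xi>. w \<xi> \<partial>lborel) = (\<integral>\<^sup>+x. (\<integral>\<^sup>+y. w (vector [x, y]) \<partial>lborel) \<partial>lborel)"
proof -
  let ?v = "\<lambda>p. vector [fst p, snd p] :: real^2"
  have m: "?v \<in> lborel \<Otimes>\<^sub>M lborel \<rightarrow>\<^sub>M borel" by measurable
  have "lborel = distr (lborel \<Otimes>\<^sub>M lborel) borel ?v"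
  proof (rule lborel_eqI)
    fix l u :: "real^2" assume le: "\<And>b. b \<in> Basis \<Longrightarrow> l \<bullet> b \<le> u \<bullet> b"
    have "emeasure (distr (lborel \<Otimes>\<^sub>M lborel) borel ?v) (box l u)
        = emeasure (lborel \<Otimes>\<^sub>M lborel) ({l$1<..<u$1} \<times> {l$2<..<u$2})"
      by (subst emeasure_distr[OF m]) (auto simp: box_def Basis_vec_2 inner_axis
          space_pair_measure intro!: arg_cong2[where f = emeasure])
    also have "\<dots> = emeasure lborel {l$1<..<u$1} * emeasure lborel {l$2<..<u$2}"
      by (intro lborel.emeasure_pair_measure_Times) auto
    also have "\<dots> = ennreal ((u$1 - l$1) * (u$2 - l$2))"
    proof -
      have "l$1 \<le> u$1" "l$2 \<le> u$2" using le[of "axis 1 1"] le[of "axis 2 1"]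
          by (auto simp: Basis_vec_2 inner_axis)
      thus ?thesis by (simp add: ennreal_mult)
    qed
    also have "(u$1 - l$1) * (u$2 - l$2) = (\<Prod>b\<in>Basis. (u - l) \<bullet> b)"
      by (simp add: Basis_vec_2 inner_axis axis_eq_axis)
    finally show "emeasure (distr (lborel \<Otimes>\<^sub>M lborel) borel ?v) (box l u)
        = (\<Prod>b\<in>Basis. (u - l) \<bullet> b)" .
  qed simp
  hence "(\<integral>\<^sup>+\<xi>. w \<xi> \<partial>lborel) = (\<integral>\<^sup>+\<xi>. w \<xi> \<partial>distr (lborel \<Otimes>\<^sub>M lborel) borel ?v)" by simp
  also have "\<dots> = (\<integral>\<^sup>+p. w (?v p) \<partial>(lborel \<Otimes>\<^sub>M lborel))"
    by (rule nn_integral_distr[OF m]) simp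
  also have "\<dots> = (\<integral>\<^sup>+x. (\<integral>\<^sup>+y. w (?v (x, y)) \<partial>lborel) \<partial>lborel)"
    by (rule lborel.nn_integral_fst[symmetric]) measurable
  finally show ?thesis by simp
qed

text \<open>Substitute \<open>y = x tan t\<close> and then \<open>x = r cos t\<close>, which leaves the Jacobian \<open>r\<close>.\<close>

lemma nn_integral_half_plane:
  fixes w :: "real^2 \<Rightarrow> ennreal"
  assumes [measurable]: "w \<in> borel_measurable borel"
  shows "(\<integral>\<^sup>+x. (\<integral>\<^sup>+y. w (vector [x, y]) \<partial>lborel) * indicator {0<..} x \<partial>lborel)
    = (\<integral>\<^sup>+t. (\<integral>\<^sup>+r. w (r *\<^sub>R vector [cos t, sin t]) * ennreal r * indicator {0<..} r \<partial>lborel)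
        * indicator {-(pi/2)<..<pi/2} t \<partial>lborel)"
proof -
  let ?I = "\<lambda>t::real. indicator {-(pi/2)<..<pi/2} t :: ennreal"
  have [measurable]: "(tan :: real \<Rightarrow> real) \<in> borel_measurable borel"
    unfolding tan_def[abs_def] by measurable
  have [measurable]: "(\<lambda>(x, t). w (vector [x, x * tan t])) \<in> borel_measurable (lborel \<Otimes>\<^sub>M lborel)"
    unfolding vector_2_eq by measurable
  have [measurable]: "(\<lambda>y. w (vector [x, y])) \<in> borel_measurable borel" for x
    unfolding vector_2_eq by measurable
  have "(\<integral>\<^sup>+x. (\<integral>\<^sup>+y. w (vector [x, y]) \<partial>lborel) * indicator {0<..} x \<partial>lborel) =
     (\<integral>\<^sup>+x. (\<integral>\<^sup>+t. w (vector [x, x * tan t]) * ennreal (x / (cos t)\<^sup>2) * ?I t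
         * indicator {0<..} x \<partial>lborel) \<partial>lborel)"
  proof (intro nn_integral_cong)
    fix x :: real
    show "(\<integral>\<^sup>+y. w (vector [x, y]) \<partial>lborel) * indicator {0<..} x
        = (\<integral>\<^sup>+t. w (vector [x, x * tan t]) * ennreal (x / (cos t)\<^sup>2) * ?I t
        * indicator {0<..} x \<partial>lborel)"
    proof (cases "x > 0")
      case True
      have "(\<integral>\<^sup>+y. w (vector [x, y]) \<partial>lborel) = ennreal x * (\<integral>\<^sup>+y. w (vector [x, x * y]) \<partial>lborel)"
        using True by (subst nn_integral_real_affine[of _ x 0]) auto
      also have "(\<integral>\<^sup>+y. w (vector [x, x * y]) \<partial>lborel)
          = (\<integral>\<^sup>+t. w (vector [x, x * tan t]) * ennreal (1 / (cos t)\<^sup>2) * ?I t \<partial>lborel)"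
        by (rule nn_integral_tan) (simp add: vector_2_eq)
      also have "ennreal x * \<dots> = (\<integral>\<^sup>+t. ennreal x * (w (vector [x, x * tan t])
          * ennreal (1 / (cos t)\<^sup>2) * ?I t) \<partial>lborel)"
        by (rule nn_integral_cmult[symmetric]) (simp add: vector_2_eq)
      also have "\<dots> = (\<integral>\<^sup>+t. w (vector [x, x * tan t]) * ennreal (x / (cos t)\<^sup>2) * ?I t \<partial>lborel)"
      proof (intro nn_integral_cong)
        fix t
        have "ennreal (x / (cos t)\<^sup>2) = ennreal x * ennreal (1 / (cos t)\<^sup>2)"
          using True by (subst ennreal_mult[symmetric]) auto
        thus "ennreal x * (w (vector [x, x * tan t]) * ennreal (1 / (cos t)\<^sup>2) * ?I t)
            = w (vector [x, x * tan t]) * ennreal (x / (cos t)\<^sup>2) * ?I t"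
          by (simp add: mult_ac)
      qed
      finally show ?thesis using True by simp
    qed simp
  qed
  also have "\<dots> = (\<integral>\<^sup>+t. (\<integral>\<^sup>+x. w (vector [x, x * tan t]) * ennreal (x / (cos t)\<^sup>2) * ?I t
      * indicator {0<..} x \<partial>lborel) \<partial>lborel)"
    by (rule lborel_pair.Fubini') measurable
  also have "\<dots> = (\<integral>\<^sup>+t. (\<integral>\<^sup>+r. w (r *\<^sub>R vector [cos t, sin t]) * ennreal r
      * indicator {0<..} r \<partial>lborel) * ?I t \<partial>lborel)"
  proof (intro nn_integral_cong)
    fix t :: real
    show "(\<integral>\<^sup>+x. w (vector [x, x * tan t]) * ennreal (x / (cos t)\<^sup>2) * ?I t
        * indicator {0<..} x \<partial>lborel) = (\<integral>\<^sup>+r. w (r *\<^sub>R vector [cos t, sin t]) * ennreal r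
        * indicator {0<..} r \<partial>lborel) * ?I t"
    proof (cases "t \<in> {-(pi/2)<..<pi/2}")
      case True
      hence c: "cos t > 0" by (intro cos_gt_zero_pi) auto
      have "(\<integral>\<^sup>+x. w (vector [x, x * tan t]) * ennreal (x / (cos t)\<^sup>2) * indicator {0<..} x \<partial>lborel)
         = ennreal (cos t) * (\<integral>\<^sup>+r. w (vector [cos t * r, cos t * r * tan t]) * ennreal (cos t
             * r / (cos t)\<^sup>2) * indicator {0<..} (cos t * r) \<partial>lborel)"
        using c by (subst nn_integral_real_affine[of _ "cos t" 0]) (auto simp: vector_2_eq)
      also have "\<dots> = (\<integral>\<^sup>+r. ennreal (cos t) * (w (vector [cos t * r, cos t * r * tan t])
          * ennreal (cos t * r / (cos t)\<^sup>2) * indicator {0<..} (cos t * r)) \<partial>lborel)"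
        by (rule nn_integral_cmult[symmetric]) (simp add: vector_2_eq)
      also have "\<dots> = (\<integral>\<^sup>+r. w (r *\<^sub>R vector [cos t, sin t]) * ennreal r
          * indicator {0<..} r \<partial>lborel)"
      proof (intro nn_integral_cong)
        fix r :: real
        show "ennreal (cos t) * (w (vector [cos t * r, cos t * r * tan t]) * ennreal (cos t
            * r / (cos t)\<^sup>2) * indicator {0<..} (cos t * r))
            = w (r *\<^sub>R vector [cos t, sin t]) * ennreal r * indicator {0<..} r"
        proof (cases "r > 0")
          case True
          have 1: "vector [cos t * r, cos t * r * tan t] = r *\<^sub>R (vector [cos t, sin t] :: real^2)"
            using c by (simp add: vector_2_eq tan_def scaleR_add_right mult_ac)
          have 2: "ennreal (cos t) * ennreal (cos t * r / (cos t)\<^sup>2) = ennreal r"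
            using c True by (subst ennreal_mult[symmetric]) (auto simp: power2_eq_square)
          show ?thesis unfolding 1 using True c 2
            by (simp add: mult.left_commute[of "ennreal (cos t)"] zero_less_mult_iff)
        next
          case False thus ?thesis using c by (simp add: zero_less_mult_iff)
        qed
      qed
      finally show ?thesis using True by simp
    qed simp
  qed
  finally show ?thesis .
qed

lemma nn_integral_periodic_shift:
  fixes F :: "real \<Rightarrow> ennreal"
  assumes [measurable]: "F \<in> borel_measurable borel" and per: "\<And>t. F (t + 2 * pi)
      = F t" and a: "-(2 * pi) \<le> a" "a \<le> 0"
  shows "(\<integral>\<^sup>+t. F t * indicator {a..<a + 2 * pi} t \<partial>lborel)
      = (\<integral>\<^sup>+t. F t * indicator {0..<2 * pi} t \<partial>lborel)"
proof -
  have "(\<integral>\<^sup>+t. F t * indicator {a..<a + 2 * pi} t \<partial>lborel)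
      = (\<integral>\<^sup>+t. F t * indicator {a..<0} t + F t * indicator {0..<a + 2 * pi} t \<partial>lborel)"
    using a by (intro nn_integral_cong) (auto simp: indicator_def)
  also have "\<dots> = (\<integral>\<^sup>+t. F t * indicator {a..<0} t \<partial>lborel) + (\<integral>\<^sup>+t. F t * indicator {0..<a
      + 2 * pi} t \<partial>lborel)"
    by (rule nn_integral_add) measurable
  also have "(\<integral>\<^sup>+t. F t * indicator {a..<0} t \<partial>lborel)
      = (\<integral>\<^sup>+t. F (t - 2 * pi) * indicator {a..<0} (t - 2 * pi) \<partial>lborel)"
    by (subst nn_integral_real_affine[of _ 1 "-(2 * pi)"]) auto
  also have "\<dots> = (\<integral>\<^sup>+t. F t * indicator {a + 2 * pi..<2 * pi} t \<partial>lborel)"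
    using per[of "_ - 2 * pi"] by (intro nn_integral_cong) (auto simp: indicator_def)
  also have "\<dots> + (\<integral>\<^sup>+t. F t * indicator {0..<a + 2 * pi} t \<partial>lborel)
      = (\<integral>\<^sup>+t. F t * indicator {a + 2 * pi..<2 * pi} t + F t * indicator {0..<a
      + 2 * pi} t \<partial>lborel)"
    by (rule nn_integral_add[symmetric]) measurable
  also have "\<dots> = (\<integral>\<^sup>+t. F t * indicator {0..<2 * pi} t \<partial>lborel)"
    using a by (intro nn_integral_cong) (auto simp: indicator_def)
  finally show ?thesis .
qed

lemma nn_integral_circle_uminus:
  assumes f: "f \<in> borel_measurable circle"
  shows "(\<integral>\<^sup>+\<theta>. f (- \<theta>) \<partial>circle) = (\<integral>\<^sup>+\<theta>. f \<theta> \<partial>circle)"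
proof -
  define F where "F t = f (vector [cos t, sin t])" for t :: real
  have f': "f \<in> borel_measurable (restrict_space borel (sphere 0 1))"
    using f by (simp add: measurable_cong_sets[OF sets_circle refl])
  have "uminus \<in> restrict_space borel (sphere 0 1) \<rightarrow>\<^sub>M restrict_space borel (sphere (0::real^2) 1)"
    by (intro measurable_restrict_space2 measurable_restrict_space1)
        (auto simp: space_restrict_space)
  from measurable_compose[OF this f'] have f'': "(\<lambda>\<theta>.
      f (- \<theta>)) \<in> borel_measurable (restrict_space borel (sphere 0 1))" .
  have "(\<lambda>t. vector [cos t, sin t] :: real^2) \<in> borel \<rightarrow>\<^sub>M restrict_space borel (sphere 0 1)"
    by (intro measurable_restrict_space2) (auto simp: unit_vector_norm)
  from measurable_compose[OF this f'] have [measurable]: "F \<in> borel_measurable borel"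
      by (simp add: F_def[abs_def])
  have per: "F (t + 2 * pi) = F t" for t by (simp add: F_def)
  have neg: "f (- vector [cos t, sin t]) = F (t + pi)" for t
    by (simp add: F_def vector_2_eq)
  have "(\<integral>\<^sup>+\<theta>. f (- \<theta>) \<partial>circle) = (\<integral>\<^sup>+t. F (t + pi) * indicator {0..<2 * pi} t \<partial>lborel)"
    by (subst nn_integral_circle[OF f'']) (simp add: neg)
  also have "\<dots> = (\<integral>\<^sup>+t. F (- pi + t + pi) * indicator {0..<2 * pi} (- pi + t + 2 * pi) \<partial>lborel)"
  proof -
    have "(\<integral>\<^sup>+t. F (t + pi) * indicator {0..<2 * pi} t \<partial>lborel)
        = (\<integral>\<^sup>+t. F ((pi + 1 * t) + pi) * indicator {0..<2 * pi} (pi + 1 * t) \<partial>lborel)"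
      by (subst nn_integral_real_affine[of _ 1 pi]) auto
    also have "\<dots> = (\<integral>\<^sup>+t. F (- pi + t + pi) * indicator {0..<2 * pi} (- pi + t + 2 * pi) \<partial>lborel)"
      using per by (intro nn_integral_cong) (simp add: algebra_simps)
    finally show ?thesis .
  qed
  also have "\<dots> = (\<integral>\<^sup>+t. F t * indicator {- pi..<- pi + 2 * pi} t \<partial>lborel)"
    by (intro nn_integral_cong) (auto simp: indicator_def)
  also have "\<dots> = (\<integral>\<^sup>+t. F t * indicator {0..<2 * pi} t \<partial>lborel)"
    by (rule nn_integral_periodic_shift[where F = F, OF _ per]) auto
  also have "\<dots> = (\<integral>\<^sup>+\<theta>. f \<theta> \<partial>circle)"
    by (subst nn_integral_circle[OF f']) (simp add: F_def)
  finally show ?thesis .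
qed

theorem nn_integral_polar:
  fixes w :: "real^2 \<Rightarrow> ennreal"
  assumes [measurable]: "w \<in> borel_measurable borel"
  shows "(\<integral>\<^sup>+\<xi>. w \<xi> \<partial>lborel) = (\<integral>\<^sup>+\<theta>. (\<integral>\<^sup>+r. w (r *\<^sub>R \<theta>) * ennreal r
      * indicator {0<..} r \<partial>lborel) \<partial>circle)"
proof -
  define F where "F t = (\<integral>\<^sup>+r. w (r *\<^sub>R vector [cos t, sin t]) * ennreal r
      * indicator {0<..} r \<partial>lborel)" for t :: real
  have [measurable]: "F \<in> borel_measurable borel"
  proof -
    have "F \<in> borel_measurable lborel" unfolding F_def[abs_def] vector_2_eq by measurable
    thus ?thesis by simp
  qed
  have "(\<lambda>\<theta>. \<integral>\<^sup>+r. w (r *\<^sub>R \<theta>) * ennreal r * indicator {0<..} r \<partial>lborel) \<in> borel_measurable (borel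
      :: (real^2) measure)"
    by measurable
  hence pm: "(\<lambda>\<theta>. \<integral>\<^sup>+r. w (r *\<^sub>R \<theta>) * ennreal r * indicator {0<..} r \<partial>lborel) \<in> borel_measurable
      (restrict_space borel (sphere (0::real^2) 1))"
    by (rule measurable_restrict_space1)
  have vm [measurable]: "(\<lambda>y. w (vector [x, y])) \<in> borel_measurable borel" "(\<lambda>y.
      w (- vector [x, y])) \<in> borel_measurable borel" for x
    unfolding vector_2_eq by measurable
  have vm2 [measurable]: "(\<lambda>x. \<integral>\<^sup>+y. w (vector [x, y]) \<partial>lborel) \<in> borel_measurable borel"
  proof -
    have "(\<lambda>x. \<integral>\<^sup>+y. w (vector [x, y]) \<partial>lborel) \<in> borel_measurable lborel" unfolding vector_2_eq
        by measurable
    thus ?thesis by simp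
  qed
  have neg: "(\<integral>\<^sup>+x. (\<integral>\<^sup>+y. w (vector [x, y]) \<partial>lborel) * indicator {..<0} x \<partial>lborel) =
     (\<integral>\<^sup>+x. (\<integral>\<^sup>+y. w (- vector [x, y]) \<partial>lborel) * indicator {0<..} x \<partial>lborel)"
  proof -
    have "(\<integral>\<^sup>+x. (\<integral>\<^sup>+y. w (vector [x, y]) \<partial>lborel) * indicator {..<0} x \<partial>lborel) =
        (\<integral>\<^sup>+x. (\<integral>\<^sup>+y. w (vector [- x, y]) \<partial>lborel) * indicator {..<0} (- x) \<partial>lborel)"
      by (subst nn_integral_real_affine[of _ "-1" 0]) auto
    also have "\<dots> = (\<integral>\<^sup>+x. (\<integral>\<^sup>+y. w (vector [- x, - y]) \<partial>lborel) * indicator {..<0} (- x) \<partial>lborel)"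
    proof (intro nn_integral_cong)
      fix x :: real
      show "(\<integral>\<^sup>+y. w (vector [- x, y]) \<partial>lborel) * indicator {..<0} (- x)
          = (\<integral>\<^sup>+y. w (vector [- x, - y]) \<partial>lborel) * indicator {..<0} (- x)"
        by (subst nn_integral_real_affine[of _ "-1" 0]) auto
    qed
    also have "\<dots> = (\<integral>\<^sup>+x. (\<integral>\<^sup>+y. w (- vector [x, y]) \<partial>lborel) * indicator {0<..} x \<partial>lborel)"
      by (intro nn_integral_cong) (simp add: vector_2_eq indicator_def)
    finally show ?thesis .
  qed
  have per: "F (t + 2 * pi) = F t" for t by (simp add: F_def)
  have Fpi: "F (t + pi) = (\<integral>\<^sup>+r. w (- (r *\<^sub>R vector [cos t, sin t])) * ennreal r
      * indicator {0<..} r \<partial>lborel)" for t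
    by (simp add: F_def vector_2_eq scaleR_add_right scaleR_diff_right)
  have "(\<integral>\<^sup>+\<xi>. w \<xi> \<partial>lborel) = (\<integral>\<^sup>+x. (\<integral>\<^sup>+y. w (vector [x, y]) \<partial>lborel) * indicator {0<..} x
      + (\<integral>\<^sup>+y. w (vector [x, y]) \<partial>lborel) * indicator {..<0} x \<partial>lborel)"
    unfolding nn_integral_lborel_vec2[OF assms]
  proof (intro nn_integral_cong_AE)
    have "AE x in lborel. x \<noteq> (0::real)" by (rule AE_lborel_singleton)
    thus "AE x in lborel. (\<integral>\<^sup>+y. w (vector [x, y]) \<partial>lborel)
        = (\<integral>\<^sup>+y. w (vector [x, y]) \<partial>lborel) * indicator {0<..} x
        + (\<integral>\<^sup>+y. w (vector [x, y]) \<partial>lborel) * indicator {..<0} x"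
      by eventually_elim (auto simp: indicator_def)
  qed
  also have "\<dots> = (\<integral>\<^sup>+x. (\<integral>\<^sup>+y. w (vector [x, y]) \<partial>lborel) * indicator {0<..} x \<partial>lborel)
      + (\<integral>\<^sup>+x. (\<integral>\<^sup>+y. w (vector [x, y]) \<partial>lborel) * indicator {..<0} x \<partial>lborel)"
    by (rule nn_integral_add) measurable
  also have "\<dots> = (\<integral>\<^sup>+t. F t * indicator {-(pi/2)<..<pi/2} t \<partial>lborel) + (\<integral>\<^sup>+t. F (t
      + pi) * indicator {-(pi/2)<..<pi/2} t \<partial>lborel)"
    unfolding neg Fpi using nn_integral_half_plane[OF assms] nn_integral_half_plane[of "\<lambda>\<xi>.
        w (- \<xi>)"]
    by (simp add: F_def)
  also have "(\<integral>\<^sup>+t. F (t + pi) * indicator {-(pi/2)<..<pi/2} t \<partial>lborel)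
      = (\<integral>\<^sup>+t. F t * indicator {-(pi/2)<..<pi/2} (t - pi) \<partial>lborel)"
    by (subst nn_integral_real_affine[of _ 1 "-pi"]) auto
  also have "(\<integral>\<^sup>+t. F t * indicator {-(pi/2)<..<pi/2} t \<partial>lborel) + \<dots>
      = (\<integral>\<^sup>+t. F t * indicator {-(pi/2)<..<pi/2} t
      + F t * indicator {-(pi/2)<..<pi/2} (t - pi) \<partial>lborel)"
    by (rule nn_integral_add[symmetric]) measurable
  also have "\<dots> = (\<integral>\<^sup>+t. F t * indicator {-(pi/2)..<-(pi/2) + 2 * pi} t \<partial>lborel)"
  proof (intro nn_integral_cong_AE)
    have "AE t in lborel. t \<noteq> -(pi/2)" "AE t in lborel. t \<noteq> pi/2" "AE t in lborel. t \<noteq> 3*pi/2"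
      by (rule AE_lborel_singleton)+
    thus "AE t in lborel. F t * indicator {-(pi/2)<..<pi/2} t
        + F t * indicator {-(pi/2)<..<pi/2} (t - pi)
        = F t * indicator {-(pi/2)..<-(pi/2) + 2 * pi} t"
      by eventually_elim (auto simp: indicator_def)
  qed
  also have "\<dots> = (\<integral>\<^sup>+t. F t * indicator {0..<2 * pi} t \<partial>lborel)"
    by (rule nn_integral_periodic_shift[where F = F, OF _ per]) auto
  also have "\<dots> = (\<integral>\<^sup>+\<theta>. (\<integral>\<^sup>+r. w (r *\<^sub>R \<theta>) * ennreal r * indicator {0<..} r \<partial>lborel) \<partial>circle)"
    by (subst nn_integral_circle[OF pm]) (simp add: F_def)
  finally show ?thesis .
qed

section \<open>The Radon transform\<close>

lemma measurable_cyl_iff_borel: "f \<in> borel_measurable cyl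
    \<longleftrightarrow> f \<in> borel_measurable (circle \<Otimes>\<^sub>M (borel :: real measure))"
  by (simp add: measurable_cong_sets[OF sets_cyl refl])

lemma fst_cyl_measurable: "fst \<in> cyl \<rightarrow>\<^sub>M circle"
  unfolding cyl_def by measurable

lemma snd_cyl_borel [measurable]: "snd \<in> borel_measurable cyl"
  unfolding measurable_cyl_iff_borel by measurable

lemma circle_to_borel: "(\<lambda>\<theta>. \<theta>) \<in> circle \<rightarrow>\<^sub>M borel"
  unfolding measurable_cong_sets[OF sets_circle refl] by (rule measurable_restrict_space1) simp

lemma fst_cyl_borel [measurable]: "fst \<in> borel_measurable cyl"
  using measurable_compose[OF fst_cyl_measurable circle_to_borel] by simp

abbreviation cart :: "(real^2) \<times> real \<Rightarrow> real^2" where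
  "cart p \<equiv> snd p *\<^sub>R fst p"

definition polar :: "real^2 \<Rightarrow> (real^2) \<times> real" where
  "polar \<xi> = (if \<xi> = 0 then (axis 1 1, 0) else (\<xi> /\<^sub>R norm \<xi>, norm \<xi>))"

lemma polar_measurable [measurable]: "polar \<in> borel \<rightarrow>\<^sub>M cyl"
proof -
  have "(\<lambda>\<xi>::real^2. fst (polar \<xi>)) \<in> borel \<rightarrow>\<^sub>M restrict_space borel (sphere 0 1)"
    by (rule measurable_restrict_space2) (auto simp: polar_def if_distrib[of fst] norm_axis_1)
  hence "(\<lambda>\<xi>. fst (polar \<xi>)) \<in> borel \<rightarrow>\<^sub>M circle"
    by (simp add: measurable_cong_sets[OF refl sets_circle])
  moreover have "(\<lambda>\<xi>. snd (polar \<xi>)) \<in> borel \<rightarrow>\<^sub>M lborel"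
    by (simp add: polar_def if_distrib[of snd])
  ultimately show ?thesis unfolding cyl_def by (simp add: measurable_pair_iff o_def)
qed

lemma polar_cart: "norm \<theta> = 1 \<Longrightarrow> r > 0 \<Longrightarrow> polar (r *\<^sub>R \<theta>) = (\<theta>, r)"
  by (auto simp: polar_def)

lemma cart_polar: "cart (polar \<xi>) = \<xi>"
  by (simp add: polar_def)

lemma nn_integral_cart:
  fixes w :: "real^2 \<Rightarrow> ennreal"
  assumes [measurable]: "w \<in> borel_measurable borel"
  shows "(\<integral>\<^sup>+\<xi>. w \<xi> \<partial>lborel) = (\<integral>\<^sup>+p. w (cart p) * ennreal (snd p) * indicator {0<..} (snd p) \<partial>cyl)"
  by (subst nn_integral_polar, simp, subst nn_integral_cyl) (auto intro!: nn_integral_cong)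

lemma uminus_cyl: "uminus \<in> cyl \<rightarrow>\<^sub>M cyl"
proof -
  have "(\<lambda>p. - fst p) \<in> cyl \<rightarrow>\<^sub>M restrict_space borel (sphere (0::real^2) 1)"
    by (intro measurable_restrict_space2) (auto simp: space_cyl)
  hence "(\<lambda>p. - fst p) \<in> cyl \<rightarrow>\<^sub>M circle" by (simp add: measurable_cong_sets[OF refl sets_circle])
  moreover have "(\<lambda>p. - snd p) \<in> cyl \<rightarrow>\<^sub>M lborel" by simp
  ultimately show ?thesis unfolding cyl_def by (simp add: measurable_pair_iff o_def)
qed

lemma nn_integral_cyl_uminus:
  fixes k :: "(real^2) \<times> real \<Rightarrow> ennreal"
  assumes k: "k \<in> borel_measurable cyl"
  shows "(\<integral>\<^sup>+p. k (- p) \<partial>cyl) = (\<integral>\<^sup>+p. k p \<partial>cyl)"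
proof -
  have k': "k \<in> borel_measurable (circle \<Otimes>\<^sub>M (lborel :: real measure))" using k
      by (simp add: cyl_def)
  have "(\<integral>\<^sup>+p. k (- p) \<partial>cyl) = (\<integral>\<^sup>+\<theta>. (\<integral>\<^sup>+s. k (- \<theta>, - s) \<partial>lborel) \<partial>circle)"
    using nn_integral_cyl[OF measurable_compose[OF uminus_cyl k]] by simp
  also have "\<dots> = (\<integral>\<^sup>+\<theta>. (\<integral>\<^sup>+s. k (- \<theta>, s) \<partial>lborel) \<partial>circle)"
  proof (rule nn_integral_cong)
    fix \<theta> assume "\<theta> \<in> space circle"
    hence "- \<theta> \<in> space circle" by simp
    from measurable_compose[OF measurable_Pair1'[OF this] k'] have "(\<lambda>s.
        k (- \<theta>, s)) \<in> borel_measurable borel" by simp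
    from nn_integral_real_affine[OF this, of "-1" 0]
    show "(\<integral>\<^sup>+s. k (- \<theta>, - s) \<partial>lborel) = (\<integral>\<^sup>+s. k (- \<theta>, s) \<partial>lborel)" by simp
  qed
  also have "\<dots> = (\<integral>\<^sup>+\<theta>. (\<integral>\<^sup>+s. k (\<theta>, s) \<partial>lborel) \<partial>circle)"
    by (rule nn_integral_circle_uminus) (use k' in measurable)
  also have "\<dots> = (\<integral>\<^sup>+p. k p \<partial>cyl)" by (rule nn_integral_cyl[OF k, symmetric])
  finally show ?thesis .
qed

lemma AE_cyl_snd_nonzero: "AE p in cyl. snd p \<noteq> 0"
proof -
  have "{p \<in> space cyl. snd p \<noteq> 0} \<in> sets cyl" by measurable
  moreover have "AE \<theta> in circle. AE s in lborel. snd (\<theta>, s) \<noteq> (0::real)"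
    using AE_lborel_singleton[of "0::real"] by simp
  ultimately show ?thesis unfolding cyl_def by (intro circle_lborel.AE_pair_measure) auto
qed

lemma nn_integral_half_cyl:
  fixes k :: "(real^2) \<times> real \<Rightarrow> ennreal"
  assumes k [measurable]: "k \<in> borel_measurable cyl" and even: "AE p in cyl. k (- p) = k p"
  shows "(\<integral>\<^sup>+p. k p \<partial>cyl) = 2 * (\<integral>\<^sup>+p. k p * indicator {0<..} (snd p) \<partial>cyl)"
proof -
  have "(\<integral>\<^sup>+p. k p \<partial>cyl) = (\<integral>\<^sup>+p. k p * indicator {0<..} (snd p)
      + k p * indicator {..<0} (snd p) \<partial>cyl)"
    using AE_cyl_snd_nonzero by (intro nn_integral_cong_AE, eventually_elim)
        (auto simp: indicator_def)
  also have "\<dots> = (\<integral>\<^sup>+p. k p * indicator {0<..} (snd p) \<partial>cyl)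
      + (\<integral>\<^sup>+p. k p * indicator {..<0} (snd p) \<partial>cyl)"
    by (rule nn_integral_add) measurable
  also have "(\<integral>\<^sup>+p. k p * indicator {..<0} (snd p) \<partial>cyl)
      = (\<integral>\<^sup>+p. k (- p) * indicator {..<0} (snd (- p)) \<partial>cyl)"
    by (subst nn_integral_cyl_uminus[symmetric]) auto
  also have "\<dots> = (\<integral>\<^sup>+p. k p * indicator {0<..} (snd p) \<partial>cyl)"
    using even by (intro nn_integral_cong_AE, eventually_elim) (auto simp: indicator_def)
  finally show ?thesis by (simp add: mult_2)
qed

lemma nn_integral_cart_abs:
  fixes w :: "real^2 \<Rightarrow> ennreal"
  assumes [measurable]: "w \<in> borel_measurable borel"
  shows "(\<integral>\<^sup>+p. w (cart p) * ennreal \<bar>snd p\<bar> \<partial>cyl) = 2 * (\<integral>\<^sup>+\<xi>. w \<xi> \<partial>lborel)"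
proof -
  have "(\<integral>\<^sup>+p. w (cart p) * ennreal \<bar>snd p\<bar> \<partial>cyl) = 2 * (\<integral>\<^sup>+p. w (cart p) * ennreal \<bar>snd p\<bar>
      * indicator {0<..} (snd p) \<partial>cyl)"
    by (rule nn_integral_half_cyl) auto
  also have "(\<integral>\<^sup>+p. w (cart p) * ennreal \<bar>snd p\<bar> * indicator {0<..} (snd p) \<partial>cyl)
      = (\<integral>\<^sup>+\<xi>. w \<xi> \<partial>lborel)"
    unfolding nn_integral_cart[OF assms] by (rule nn_integral_cong) (simp add: indicator_def)
  finally show ?thesis .
qed

lemma AE_cart:
  assumes "AE \<xi> in lborel. Q \<xi>"
  shows "AE p in cyl. Q (cart p)"
proof -
  obtain N where N: "N \<in> null_sets lborel" "{\<xi>. \<not> Q \<xi>} \<subseteq> N"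
    using assms by (auto simp: eventually_ae_filter)
  have [measurable]: "N \<in> sets borel" using N(1) by auto
  have "(\<integral>\<^sup>+p. indicator N (cart p) * ennreal \<bar>snd p\<bar> \<partial>cyl) = 0"
    using N(1) by (subst nn_integral_cart_abs) auto
  hence "AE p in cyl. indicator N (cart p) * ennreal \<bar>snd p\<bar> = 0"
    by (subst (asm) nn_integral_0_iff_AE) auto
  with AE_cyl_snd_nonzero show ?thesis
    by eventually_elim (use N in \<open>auto simp: indicator_def ennreal_eq_0_iff split: if_splits\<close>)
qed

lemma nn_integral_polar_map:
  assumes k [measurable]: "k \<in> borel_measurable cyl"
  shows "(\<integral>\<^sup>+\<xi>. k (polar \<xi>) \<partial>lborel) = (\<integral>\<^sup>+p. k p * ennreal (snd p)
      * indicator {0<..} (snd p) \<partial>cyl)"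
  by (subst nn_integral_cart, simp, intro nn_integral_cong)
     (auto simp: indicator_def space_cyl polar_cart)

lemma AE_polar:
  assumes "AE p in cyl. Q p"
  shows "AE \<xi> in lborel. Q (polar \<xi>)"
proof -
  obtain N where N: "N \<in> null_sets cyl" "{p \<in> space cyl. \<not> Q p} \<subseteq> N"
    using assms by (auto simp: eventually_ae_filter)
  have [measurable]: "N \<in> sets cyl" using N(1) by auto
  have "AE p in cyl. p \<notin> N" by (rule AE_not_in[OF N(1)])
  hence "(\<integral>\<^sup>+p. indicator N p * ennreal (snd p) * indicator {0<..} (snd p) \<partial>cyl) = 0"
    by (subst nn_integral_0_iff_AE) (auto elim!: eventually_mono)
  hence "(\<integral>\<^sup>+\<xi>. indicator N (polar \<xi>) \<partial>lborel) = (0::ennreal)"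
    by (subst nn_integral_polar_map) auto
  hence "AE \<xi> in lborel. indicator N (polar \<xi>) = (0::ennreal)"
    by (subst (asm) nn_integral_0_iff_AE) auto
  thus ?thesis
  proof eventually_elim
    case (elim \<xi>)
    have "polar \<xi> \<in> space cyl" using measurable_space[OF polar_measurable, of \<xi>] by simp
    thus ?case using elim N(2) by (auto simp: indicator_def split: if_splits)
  qed
qed

lemma sqnorm_cart:
  assumes [measurable]: "f \<in> borel_measurable borel"
  shows "sqnorm cyl (\<lambda>p. f (cart p)) = 2 * sqnorm lborel (\<lambda>\<xi>. complex_of_real (norm \<xi> powr (-1/2))
      * f \<xi>)"
proof -
  have "sqnorm cyl (\<lambda>p. f (cart p)) = (\<integral>\<^sup>+p. ennreal ((cmod (complex_of_real (norm (cart p) powr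
      (-1/2)) * f (cart p)))\<^sup>2) * ennreal \<bar>snd p\<bar> \<partial>cyl)"
    unfolding sqnorm_def
  proof (rule nn_integral_cong_AE)
    show "AE p in cyl. ennreal ((cmod (f (cart p)))\<^sup>2)
        = ennreal ((cmod (complex_of_real (norm (cart p) powr (-1/2)) * f (cart p)))\<^sup>2)
        * ennreal \<bar>snd p\<bar>"
      using AE_cyl_snd_nonzero AE_space
    proof eventually_elim
      case (elim p)
      have n: "norm (cart p) = \<bar>snd p\<bar>" using elim by (auto simp: space_cyl)
      have "(\<bar>snd p\<bar> powr (-1/2))\<^sup>2 = \<bar>snd p\<bar> powr (-1)"
        by (simp add: power2_eq_square powr_add[symmetric])
      hence "(\<bar>snd p\<bar> powr (-1/2))\<^sup>2 * \<bar>snd p\<bar> = 1"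
        using elim by (simp add: powr_neg_one)
      hence "(cmod (complex_of_real (norm (cart p) powr (-1/2)) * f (cart p)))\<^sup>2 * \<bar>snd p\<bar>
          = (cmod (f (cart p)))\<^sup>2"
        unfolding n norm_mult power_mult_distrib by
            (simp add: mult.assoc mult.commute mult.left_commute)
      thus ?case by (simp flip: ennreal_mult)
    qed
  qed
  also have "\<dots> = 2 * sqnorm lborel (\<lambda>\<xi>. complex_of_real (norm \<xi> powr (-1/2)) * f \<xi>)"
    unfolding sqnorm_def by (rule nn_integral_cart_abs) measurable
  finally show ?thesis .
qed

lemma L2_cart_iff:
  assumes [measurable]: "f \<in> borel_measurable borel"
  shows "(\<lambda>p. f (cart p)) \<in> L2 cyl \<longleftrightarrow> (\<lambda>\<xi>. complex_of_real (norm \<xi> powr (-1/2)) * f \<xi>) \<in> L2 lborel"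
  using sqnorm_cart[OF assms] by (auto simp: L2_def ennreal_mult_less_top)

lemma radon_dom_iff: "f \<in> radon_dom \<longleftrightarrow> f \<in> L2 lborel \<and> (\<lambda>p. fourier f (cart p)) \<in> L2 cyl"
  using L2_cart_iff[of "fourier f"] L2_measurable[OF fourier_L2[of f]] by (auto simp: radon_dom_def)

lemma radon_spec:
  assumes f: "f \<in> radon_dom"
  shows "radon f \<in> L2 cyl" "AE p in cyl. fourier2 (radon f) p = fourier f (cart p)"
proof -
  have "radon f = fourier2_inv (\<lambda>p. fourier f (cart p))"
    using f by (simp add: radon_def case_prod_unfold)
  thus "radon f \<in> L2 cyl" "AE p in cyl. fourier2 (radon f) p = fourier f (cart p)"
    using fourier2_inv_spec[of "\<lambda>p. fourier f (cart p)"] f by (auto simp: radon_dom_iff)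
qed

lemma radon_linear: "L2_linear_op lborel cyl radon_dom radon"
  unfolding L2_linear_op_def
proof (intro conjI ballI impI allI)
  fix f g :: "real^2 \<Rightarrow> complex" assume f: "f \<in> radon_dom" and g: "g \<in> L2 lborel"
      and "AE x in lborel. f x = g x"
  hence eq: "fourier f = fourier g" by (intro fourier_cong_AE)
  show "g \<in> radon_dom" using f g by (simp add: radon_dom_iff eq)
  thus "AE p in cyl. radon f p = radon g p" using f by (simp add: radon_def eq)
next
  show "radon_dom \<subseteq> L2 lborel" by (auto simp: radon_dom_def)
next
  fix f assume "f \<in> radon_dom" thus "radon f \<in> L2 cyl" by (rule radon_spec)
next
  have z: "AE \<xi> in lborel. fourier (\<lambda>x::real^2. 0) \<xi> = 0"
    using fourier_cmult[OF L2_zero, of 0] by simp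
  have "(\<lambda>p. fourier (\<lambda>x::real^2. 0) (cart p)) \<in> L2 cyl"
  proof (rule L2_cong_AE[OF L2_zero _ AE_cart[OF z]])
    have [measurable]: "fourier (\<lambda>x::real^2. 0) \<in> borel_measurable borel"
      using L2_measurable[OF fourier_L2[OF L2_zero]] by simp
    show "(\<lambda>p. fourier (\<lambda>x::real^2. 0) (cart p)) \<in> borel_measurable cyl" by measurable
  qed
  thus "(\<lambda>_. 0) \<in> radon_dom" by (simp add: radon_dom_iff)
next
  fix f g assume f: "f \<in> radon_dom" and g: "g \<in> radon_dom"
  have L: "f \<in> L2 lborel" "g \<in> L2 lborel" "(\<lambda>p. fourier f (cart p)) \<in> L2 cyl" "(\<lambda>p.
      fourier g (cart p)) \<in> L2 cyl"
    using f g by (auto simp: radon_dom_iff)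
  note [measurable] = L2_measurable[OF fourier_L2[OF L2_add[OF L(1,2)]]]
  note a = AE_cart[OF fourier_add[OF L(1,2)]]
  show d: "(\<lambda>x. f x + g x) \<in> radon_dom"
    unfolding radon_dom_iff by (intro conjI L2_add L L2_cong_AE[OF L2_add[OF L(3,4)] _ a])
        measurable
  have "AE p in cyl. fourier2 (radon (\<lambda>x. f x + g x)) p = fourier2 (\<lambda>p. radon f p + radon g p) p"
    using a radon_spec(2)[OF d] radon_spec(2)[OF f] radon_spec(2)[OF g] fourier2_add[OF
        radon_spec(1)[OF f] radon_spec(1)[OF g]]
    by eventually_elim simp
  thus "AE p in cyl. radon (\<lambda>x. f x + g x) p = radon f p + radon g p"
    by (rule fourier2_inj[OF radon_spec(1)[OF d] L2_add[OF radon_spec(1)[OF f] radon_spec(1)[OF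
        g]]])
next
  fix c f assume f: "f \<in> radon_dom"
  have L: "f \<in> L2 lborel" "(\<lambda>p. fourier f (cart p)) \<in> L2 cyl"
    using f by (auto simp: radon_dom_iff)
  note [measurable] = L2_measurable[OF fourier_L2[OF L2_cmult[OF L(1), of c]]]
  note a = AE_cart[OF fourier_cmult[OF L(1), of c]]
  show d: "(\<lambda>x. c * f x) \<in> radon_dom"
    unfolding radon_dom_iff by (intro conjI L2_cmult L L2_cong_AE[OF L2_cmult[OF L(2), of c] _ a])
        measurable
  have "AE p in cyl. fourier2 (radon (\<lambda>x. c * f x)) p = fourier2 (\<lambda>p. c * radon f p) p"
    using a radon_spec(2)[OF d] radon_spec(2)[OF f] fourier2_cmult[OF radon_spec(1)[OF f], of c]
    by eventually_elim simp
  thus "AE p in cyl. radon (\<lambda>x. c * f x) p = c * radon f p"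
    by (rule fourier2_inj[OF radon_spec(1)[OF d] L2_cmult[OF radon_spec(1)[OF f]]])
qed

lemma radon_closed: "L2_closed_op lborel cyl radon_dom radon"
  unfolding L2_closed_op_def
proof (intro conjI radon_linear allI ballI impI)
  fix F f g assume f: "f \<in> L2 lborel" and g: "g \<in> L2 cyl"
    and a: "(\<forall>n. F n \<in> radon_dom) \<and> L2_tendsto lborel F f \<and> L2_tendsto cyl (\<lambda>n. radon (F n)) g"
  have F: "F n \<in> radon_dom" "F n \<in> L2 lborel" for n using a by (auto simp: radon_dom_def)
  have l1: "L2_tendsto lborel (\<lambda>n. fourier (F n)) (fourier f)"
    using a by (intro fourier_tendsto F f) auto
  have l2: "L2_tendsto cyl (\<lambda>n. fourier2 (radon (F n))) (fourier2 g)"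
    using a by (intro fourier2_tendsto radon_spec(1) F g) auto
  have [measurable]: "fourier f \<in> borel_measurable borel" "\<And>n.
      fourier (F n) \<in> borel_measurable borel"
    using L2_measurable[OF fourier_L2[OF f]] L2_measurable[OF fourier_L2[OF F(2)]] by auto
  have [measurable]: "fourier2 g \<in> borel_measurable cyl"
    by (rule L2_measurable[OF fourier2_L2[OF g]])
  define w where "w p = complex_of_real (sqrt (min 1 \<bar>snd p\<bar>))" for p :: "(real^2) \<times> real"
  have w: "(cmod (w p))\<^sup>2 = min 1 \<bar>snd p\<bar>" for p by (simp add: w_def)
  have [measurable]: "w \<in> borel_measurable cyl" unfolding w_def[abs_def] by measurable
  have 1: "sqnorm cyl (\<lambda>p. w p * fourier (F n) (cart p) - w p * fourier f (cart p))
      \<le> 2 * sqnorm lborel (\<lambda>\<xi>. fourier (F n) \<xi> - fourier f \<xi>)" for n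
  proof -
    have "sqnorm cyl (\<lambda>p. w p * fourier (F n) (cart p) - w p * fourier f (cart p)) \<le>
      (\<integral>\<^sup>+p. ennreal ((cmod (fourier (F n) (cart p) - fourier f (cart p)))\<^sup>2)
          * ennreal \<bar>snd p\<bar> \<partial>cyl)"
      unfolding sqnorm_def right_diff_distrib[symmetric] norm_mult power_mult_distrib w
    proof (rule nn_integral_mono)
      fix p
      let ?x = "(cmod (fourier (F n) (cart p) - fourier f (cart p)))\<^sup>2"
      have "min 1 \<bar>snd p\<bar> * ?x \<le> \<bar>snd p\<bar> * ?x" by (rule mult_right_mono) auto
      thus "ennreal (min 1 \<bar>snd p\<bar> * ?x) \<le> ennreal ?x * ennreal \<bar>snd p\<bar>"
        by (simp add: mult.commute flip: ennreal_mult)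
    qed
    also have "\<dots> = 2 * sqnorm lborel (\<lambda>\<xi>. fourier (F n) \<xi> - fourier f \<xi>)"
      unfolding sqnorm_def by (rule nn_integral_cart_abs) measurable
    finally show ?thesis .
  qed
  have t1: "L2_tendsto cyl (\<lambda>n p. w p * fourier (F n) (cart p)) (\<lambda>p. w p * fourier f (cart p))"
    unfolding L2_tendsto_def
  proof (rule tendsto_sandwich[OF _ _ tendsto_const])
    show "(\<lambda>n. 2 * sqnorm lborel (\<lambda>\<xi>. fourier (F n) \<xi> - fourier f \<xi>)) \<longlonglongrightarrow> 0"
      using ennreal_tendsto_cmult[OF _ l1[unfolded L2_tendsto_def], of 2] by simp
  qed (use 1 in \<open>auto intro!: always_eventually\<close>)
  have 2: "sqnorm cyl (\<lambda>p. w p * fourier (F n) (cart p) - w p * fourier2 g p)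
      \<le> sqnorm cyl (\<lambda>p. fourier2 (radon (F n)) p - fourier2 g p)" for n
  proof (rule sqnorm_mono_AE)
    show "AE p in cyl. cmod (w p * fourier (F n) (cart p) - w p * fourier2 g p)
        \<le> cmod (fourier2 (radon (F n)) p - fourier2 g p)"
      using radon_spec(2)[OF F(1)[of n]]
      by eventually_elim (auto simp: w_def norm_mult simp flip: right_diff_distrib intro!:
          mult_left_le_one_le)
  qed
  have t2: "L2_tendsto cyl (\<lambda>n p. w p * fourier (F n) (cart p)) (\<lambda>p. w p * fourier2 g p)"
    unfolding L2_tendsto_def
    by (rule tendsto_sandwich[OF _ _ tendsto_const l2[unfolded L2_tendsto_def]]) (use 2 in \<open>auto
        intro!: always_eventually\<close>)
  have "AE p in cyl. w p * fourier f (cart p) = w p * fourier2 g p"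
    by (rule L2_tendsto_unique[OF _ _ _ t1 t2]) measurable
  with AE_cyl_snd_nonzero have eq: "AE p in cyl. fourier f (cart p) = fourier2 g p"
    by eventually_elim (auto simp: w_def)
  show d: "f \<in> radon_dom"
    unfolding radon_dom_iff by (intro conjI f L2_cong_AE[OF fourier2_L2[OF g] _ eq]) measurable
  have "AE p in cyl. fourier2 (radon f) p = fourier2 g p"
    using radon_spec(2)[OF d] eq by eventually_elim simp
  thus "AE p in cyl. radon f p = g p"
    by (rule fourier2_inj[OF radon_spec(1)[OF d] g])
qed

section \<open>Frames and filters with annular support\<close>

lemma ess_support_null:
  fixes f :: "'a::euclidean_space \<Rightarrow> complex"
  shows "AE x in lborel. x \<notin> ess_support f \<longrightarrow> f x = 0"
proof -
  define \<U> where "\<U> = {U. open U \<and> (AE y in lborel. y \<in> U \<longrightarrow> f y = 0)}"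
  obtain \<V> where \<V>: "\<V> \<subseteq> \<U>" "countable \<V>" "\<Union>\<V> = \<Union>\<U>"
    using Lindelof[of \<U>] by (auto simp: \<U>_def)
  have "AE y in lborel. \<forall>U\<in>\<V>. y \<in> U \<longrightarrow> f y = 0"
    using \<V> by (subst AE_ball_countable) (auto simp: \<U>_def)
  moreover have "x \<in> \<Union>\<V>" if "x \<notin> ess_support f" for x
    unfolding \<V>(3) using that by (auto simp: ess_support_def \<U>_def)
  ultimately show ?thesis by (auto elim!: eventually_mono)
qed

lemma infsum_ennreal_bij:
  fixes f :: "'i \<Rightarrow> ennreal"
  assumes h: "bij (h :: nat \<Rightarrow> 'i)"
  shows "(\<Sum>\<^sub>\<infinity>i. f i) = (\<Sum>n. f (h n))"
proof -
  have "(\<Sum>\<^sub>\<infinity>i. f i) = (SUP F\<in>{F. finite F \<and> F \<subseteq> UNIV}. sum f F)"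
    by (rule nonneg_infsum_complete) simp
  also have "\<dots> = (SUP n. \<Sum>k<n. f (h k))"
  proof (rule antisym)
    show "(SUP F\<in>{F. finite F \<and> F \<subseteq> UNIV}. sum f F) \<le> (SUP n. \<Sum>k<n. f (h k))"
    proof (rule SUP_least)
      fix F :: "'i set" assume "F \<in> {F. finite F \<and> F \<subseteq> UNIV}"
      hence "finite (h -` F)" using h by (intro finite_vimageI) (auto dest: bij_is_inj)
      then obtain n where n: "h -` F \<subseteq> {..<n}" using finite_nat_iff_bounded by blast
      have "sum f F = sum f (h ` (h -` F))" using h by (simp add: bij_is_surj surj_image_vimage_eq)
      also have "\<dots> = (\<Sum>k\<in>h -` F. f (h k))"
        using h by (subst sum.reindex) (auto intro: inj_on_subset dest: bij_is_inj)
      also have "\<dots> \<le> (\<Sum>k<n. f (h k))" using n by (intro sum_mono2) auto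
      also have "\<dots> \<le> (SUP n. \<Sum>k<n. f (h k))" by (rule SUP_upper) simp
      finally show "sum f F \<le> (SUP n. \<Sum>k<n. f (h k))" .
    qed
    show "(SUP n. \<Sum>k<n. f (h k)) \<le> (SUP F\<in>{F. finite F \<and> F \<subseteq> UNIV}. sum f F)"
    proof (rule SUP_least)
      fix n
      have "(\<Sum>k<n. f (h k)) = sum f (h ` {..<n})"
        using h by (subst sum.reindex) (auto intro: inj_on_subset dest: bij_is_inj)
      also have "\<dots> \<le> (SUP F\<in>{F. finite F \<and> F \<subseteq> UNIV}. sum f F)" by (rule SUP_upper) simp
      finally show "(\<Sum>k<n. f (h k)) \<le> (SUP F\<in>{F. finite F \<and> F \<subseteq> UNIV}. sum f F)" .
    qed
  qed
  also have "\<dots> = (\<Sum>n. f (h n))" by (rule suminf_eq_SUP[symmetric])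
  finally show ?thesis .
qed

lemma AE_le_of_nn_integral_le:
  fixes S T :: "'a::euclidean_space \<Rightarrow> ennreal"
  assumes [measurable]: "S \<in> borel_measurable borel" "T \<in> borel_measurable borel"
    and le: "\<And>E. E \<in> sets borel \<Longrightarrow> bounded E \<Longrightarrow> (\<integral>\<^sup>+x. S x * indicator E x \<partial>lborel)
        \<le> (\<integral>\<^sup>+x. T x * indicator E x \<partial>lborel)"
    and fin: "\<And>E. E \<in> sets borel \<Longrightarrow> bounded E \<Longrightarrow> (\<integral>\<^sup>+x. T x * indicator E x \<partial>lborel) \<noteq> \<infinity>"
  shows "AE x in lborel. S x \<le> T x"
proof -
  have "AE x in lborel. x \<in> cball 0 (real n) \<longrightarrow> S x \<le> T x" for n
  proof -
    define E where "E = {x. T x < S x} \<inter> cball 0 (real n)"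
    have Em [measurable]: "E \<in> sets borel"
    proof -
      have "{x \<in> space borel. T x < S x} \<in> sets borel" by measurable
      thus ?thesis by (simp add: E_def)
    qed
    have Eb: "bounded E" by (auto simp: E_def)
    have "AE x in lborel. S x * indicator E x \<le> T x * indicator E x"
    proof (rule ccontr)
      assume c: "\<not> (AE x in lborel. S x * indicator E x \<le> T x * indicator E x)"
      have "(\<integral>\<^sup>+x. T x * indicator E x \<partial>lborel) < (\<integral>\<^sup>+x. S x * indicator E x \<partial>lborel)"
        by (rule nn_integral_less[OF _ _ fin[OF Em Eb] _ c]) (auto simp: E_def indicator_def)
      with le[OF Em Eb] show False by simp
    qed
    thus ?thesis
    proof eventually_elim
      case (elim x)
      show ?case
      proof (rule impI, rule ccontr)
        assume "x \<in> cball 0 (real n)" "\<not> S x \<le> T x"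
        hence "x \<in> E" by (auto simp: E_def)
        with elim \<open>\<not> S x \<le> T x\<close> show False by simp
      qed
    qed
  qed
  hence "AE x in lborel. \<forall>n. x \<in> cball 0 (real n) \<longrightarrow> S x \<le> T x" unfolding AE_all_countable by blast
  thus ?thesis
  proof eventually_elim
    case (elim x)
    obtain n where "norm x \<le> real n" using real_arch_simple by blast
    thus ?case using elim by auto
  qed
qed

lemma Linfty_invol:
  assumes u: "u \<in> L2 lborel" and "fourier u \<in> Linfty lborel"
  shows "fourier (invol u) \<in> Linfty lborel"
proof -
  obtain C where "AE \<xi> in lborel. cmod (fourier u \<xi>) \<le> C" using assms by (auto simp: Linfty_def)
  with fourier_invol[OF u] have "AE \<xi> in lborel. cmod (fourier (invol u) \<xi>) \<le> C"
    by eventually_elim simp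
  thus ?thesis using L2_measurable[OF fourier_L2[OF invol_L2[OF u]]] by (auto simp: Linfty_def)
qed

lemma fourier_conv_invol:
  fixes u :: "'a::euclidean_space \<Rightarrow> complex"
  assumes u: "u \<in> L2 lborel" "fourier u \<in> Linfty lborel" and f: "f \<in> L2 lborel"
  shows "conv (invol u) f \<in> L2 lborel" "AE \<xi> in lborel. fourier (conv (invol u) f) \<xi>
      = cnj (fourier u \<xi>) * fourier f \<xi>"
proof -
  note c = fourier_conv[OF invol_L2[OF u(1)] Linfty_invol[OF u] f]
  show "conv (invol u) f \<in> L2 lborel" by (rule c)
  show "AE \<xi> in lborel. fourier (conv (invol u) f) \<xi> = cnj (fourier u \<xi>) * fourier f \<xi>"
    using c(2) fourier_invol[OF u(1)] by eventually_elim simp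
qed

lemma frame_symbol_bounds:
  fixes u :: "'i \<Rightarrow> 'a::euclidean_space \<Rightarrow> complex" and h :: "nat \<Rightarrow> 'i"
  assumes h: "bij h" and u: "\<And>i. u i \<in> L2 lborel" "\<And>i. fourier (u i) \<in> Linfty lborel"
    and A: "\<And>f. f \<in> L2 lborel \<Longrightarrow> ennreal A * sqnorm lborel f
        \<le> (\<Sum>\<^sub>\<infinity>i. sqnorm lborel (conv (invol (u i)) f))"
    and B: "\<And>f. f \<in> L2 lborel \<Longrightarrow> (\<Sum>\<^sub>\<infinity>i. sqnorm lborel (conv (invol (u i)) f))
        \<le> ennreal B * sqnorm lborel f"
  shows "AE \<xi> in lborel. ennreal A \<le> (\<Sum>n. ennreal ((cmod (fourier (u (h n)) \<xi>))\<^sup>2))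
      \<and> (\<Sum>n. ennreal ((cmod (fourier (u (h n)) \<xi>))\<^sup>2)) \<le> ennreal B"
proof -
  let ?C = "ennreal ((2 * pi) ^ DIM('a))"
  have [measurable]: "fourier (u i) \<in> borel_measurable borel" for i
    using L2_measurable[OF fourier_L2[OF u(1)[of i]]] by simp
  define S where "S \<xi> = (\<Sum>n. ennreal ((cmod (fourier (u (h n)) \<xi>))\<^sup>2))" for \<xi>
  have [measurable]: "S \<in> borel_measurable borel" unfolding S_def[abs_def] by measurable
  have main: "ennreal A * (\<integral>\<^sup>+\<xi>. indicator E \<xi> \<partial>lborel) \<le> (\<integral>\<^sup>+\<xi>. S \<xi> * indicator E \<xi> \<partial>lborel) \<and>
     (\<integral>\<^sup>+\<xi>. S \<xi> * indicator E \<xi> \<partial>lborel) \<le> ennreal B * (\<integral>\<^sup>+\<xi>. indicator E \<xi> \<partial>lborel)"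
    if [measurable]: "E \<in> sets borel" and Eb: "bounded E" for E
  proof -
    obtain r where r: "\<And>x. x \<in> E \<Longrightarrow> norm x \<le> r" using Eb by (auto simp: bounded_iff)
    have E2: "(indicator E :: 'a \<Rightarrow> complex) \<in> L2 lborel"
      by (rule L2_cball_bounded(1)[where B = 1 and R
          = r]) (auto simp: indicator_def dest: r intro!: borel_measurable_indicator)
    obtain f where f: "f \<in> L2 lborel" "AE \<xi> in lborel. fourier f \<xi> = indicator E \<xi>"
      using fourier_surj[OF E2] by blast
    have n: "?C * sqnorm lborel f = (\<integral>\<^sup>+\<xi>. indicator E \<xi> \<partial>lborel)"
    proof -
      have "?C * sqnorm lborel f = sqnorm lborel (indicator E :: 'a \<Rightarrow> complex)"
        using Plancherel[OF f(1)] sqnorm_cong_AE[OF f(2)] by simp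
      also have "\<dots> = (\<integral>\<^sup>+\<xi>. indicator E \<xi> \<partial>lborel)"
        unfolding sqnorm_def by (intro nn_integral_cong) (auto simp: indicator_def)
      finally show ?thesis .
    qed
    have c: "?C * sqnorm lborel (conv (invol (u i)) f)
        = (\<integral>\<^sup>+\<xi>. ennreal ((cmod (fourier (u i) \<xi>))\<^sup>2) * indicator E \<xi> \<partial>lborel)" for i
    proof -
      note cv = fourier_conv_invol[OF u(1)[of i] u(2)[of i] f(1)]
      have "?C * sqnorm lborel (conv (invol (u i)) f)
          = sqnorm lborel (fourier (conv (invol (u i)) f))"
        by (rule Plancherel[OF cv(1), symmetric])
      also have "\<dots> = (\<integral>\<^sup>+\<xi>. ennreal ((cmod (fourier (u i) \<xi>))\<^sup>2) * indicator E \<xi> \<partial>lborel)"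
        unfolding sqnorm_def
      proof (rule nn_integral_cong_AE)
        show "AE \<xi> in lborel. ennreal ((cmod (fourier (conv (invol (u i)) f) \<xi>))\<^sup>2)
            = ennreal ((cmod (fourier (u i) \<xi>))\<^sup>2) * indicator E \<xi>"
          using cv(2) f(2) by eventually_elim (auto simp: indicator_def)
      qed
      finally show ?thesis .
    qed
    have s: "?C * (\<Sum>\<^sub>\<infinity>i. sqnorm lborel (conv (invol (u i)) f))
        = (\<integral>\<^sup>+\<xi>. S \<xi> * indicator E \<xi> \<partial>lborel)"
    proof -
      have "?C * (\<Sum>\<^sub>\<infinity>i. sqnorm lborel (conv (invol (u i)) f))
          = (\<Sum>n. ?C * sqnorm lborel (conv (invol (u (h n))) f))"
        unfolding infsum_ennreal_bij[OF h] by (rule ennreal_suminf_cmult[symmetric])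
      also have "\<dots> = (\<integral>\<^sup>+\<xi>. (\<Sum>n. ennreal ((cmod (fourier (u (h n)) \<xi>))\<^sup>2) * indicator E \<xi>) \<partial>lborel)"
        unfolding c by (rule nn_integral_suminf[symmetric]) measurable
      also have "\<dots> = (\<integral>\<^sup>+\<xi>. S \<xi> * indicator E \<xi> \<partial>lborel)"
        unfolding S_def by (simp add: ennreal_suminf_multc)
      finally show ?thesis .
    qed
    from mult_left_mono[OF A[OF f(1)], of ?C] mult_left_mono[OF B[OF f(1)], of ?C]
    show ?thesis unfolding s n[symmetric] by (simp add: mult.left_commute)
  qed
  have fin: "ennreal c * (\<integral>\<^sup>+\<xi>. indicator E \<xi> \<partial>lborel) \<noteq> \<infinity>" if "E \<in> sets borel" "bounded E" for E
      :: "'a set" and c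
    using that emeasure_bounded_finite[OF that(2)] by (simp add: ennreal_mult_eq_top_iff)
  have "AE \<xi> in lborel. ennreal A \<le> S \<xi>"
  proof (rule AE_le_of_nn_integral_le)
    fix E :: "'a set" assume E: "E \<in> sets borel" "bounded E"
    show "(\<integral>\<^sup>+\<xi>. ennreal A * indicator E \<xi> \<partial>lborel) \<le> (\<integral>\<^sup>+\<xi>. S \<xi> * indicator E \<xi> \<partial>lborel)"
      using main[OF E] E by (simp add: nn_integral_cmult)
    have "(\<integral>\<^sup>+\<xi>. S \<xi> * indicator E \<xi> \<partial>lborel) \<le> ennreal B * (\<integral>\<^sup>+\<xi>. indicator E \<xi> \<partial>lborel)"
      using main[OF E] by simp
    thus "(\<integral>\<^sup>+\<xi>. S \<xi> * indicator E \<xi> \<partial>lborel) \<noteq> \<infinity>"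
      using fin[OF E, of B] by (auto simp: top_unique)
  qed simp_all
  moreover have "AE \<xi> in lborel. S \<xi> \<le> ennreal B"
  proof (rule AE_le_of_nn_integral_le)
    fix E :: "'a set" assume E: "E \<in> sets borel" "bounded E"
    show "(\<integral>\<^sup>+\<xi>. S \<xi> * indicator E \<xi> \<partial>lborel) \<le> (\<integral>\<^sup>+\<xi>. ennreal B * indicator E \<xi> \<partial>lborel)"
      using main[OF E] E by (simp add: nn_integral_cmult)
    show "(\<integral>\<^sup>+\<xi>. ennreal B * indicator E \<xi> \<partial>lborel) \<noteq> \<infinity>"
      using fin[OF E, of B] E by (simp add: nn_integral_cmult)
  qed simp_all
  ultimately show ?thesis unfolding S_def by eventually_elim simp
qed

lemma fourier_dilation:
  fixes u w :: "real^2 \<Rightarrow> complex"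
  assumes u: "u \<in> L2 lborel" and R: "R > 0" and w: "AE x in lborel. w x
      = complex_of_real (R\<^sup>2) * u (R *\<^sub>R x)"
  shows "AE \<xi> in lborel. fourier w \<xi> = fourier u (\<xi> /\<^sub>R R)"
proof -
  have R0: "R \<noteq> 0" using R by simp
  have u': "(\<lambda>x. u (0 + R *\<^sub>R x)) \<in> L2 lborel" by (rule L2_lborel_affine[OF u R0])
  have "fourier w = fourier (\<lambda>x. complex_of_real (R\<^sup>2) * u (0 + R *\<^sub>R x))"
    using w by (intro fourier_cong_AE) simp
  with fourier_cmult[OF u', of "complex_of_real (R\<^sup>2)"] fourier_affine[OF u R0, of 0]
  show ?thesis by (auto elim!: eventually_elim2 simp: R0)
qed

locale radial_filter =
  fixes u :: "real^2 \<Rightarrow> complex" and C r R :: real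
  assumes u: "u \<in> L2 lborel"
    and bound: "AE \<xi> in lborel. cmod (fourier u \<xi>) \<le> C"
    and supp: "AE \<xi> in lborel. fourier u \<xi> \<noteq> 0 \<longrightarrow> r \<le> norm \<xi> \<and> norm \<xi> \<le> R"
    and r: "r > 0"
begin

lemma fourier_u_measurable [measurable]: "fourier u \<in> borel_measurable borel"
  using L2_measurable[OF fourier_L2[OF u]] by simp

lemma supp_cart: "AE p in cyl. fourier u (cart p) \<noteq> 0 \<longrightarrow> r \<le> \<bar>snd p\<bar> \<and> \<bar>snd p\<bar> \<le> R"
  using AE_cart[OF supp] AE_space by eventually_elim (auto simp: space_cyl)

lemma in_radon_dom: "u \<in> radon_dom"
proof -
  have "(\<lambda>\<xi>. complex_of_real (norm \<xi> powr (-1/2)) * fourier u \<xi>) \<in> L2 lborel"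
  proof (rule L2_dominated)
    show "(\<lambda>\<xi>. complex_of_real (r powr (-1/2)) * fourier u \<xi>) \<in> L2 lborel"
      by (rule L2_cmult[OF fourier_L2[OF u]])
    show "AE \<xi> in lborel. cmod (complex_of_real (norm \<xi> powr (-1/2)) * fourier u \<xi>)
        \<le> cmod (complex_of_real (r powr (-1/2)) * fourier u \<xi>)"
      using supp
    proof eventually_elim
      case (elim \<xi>)
      show ?case
      proof (cases "fourier u \<xi> = 0")
        case False
        have "norm \<xi> powr (-1/2) \<le> r powr (-1/2)" using elim False r by (intro powr_mono2') auto
        thus ?thesis by (simp add: norm_mult mult_right_mono)
      qed simp
    qed
  qed measurable
  thus ?thesis using u by (simp add: radon_dom_def)
qed

lemma riesz_radon:
  "riesz (radon u) \<in> L2 cyl" "AE p in cyl. fourier2 (riesz (radon u)) p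
      = complex_of_real \<bar>snd p\<bar> * fourier u (cart p)"
proof -
  note s = radon_spec[OF in_radon_dom]
  have [measurable]: "fourier2 (radon u) \<in> borel_measurable cyl"
      by (rule L2_measurable[OF fourier2_L2[OF s(1)]])
  have L: "(\<lambda>p. complex_of_real \<bar>snd p\<bar> * fourier2 (radon u) p) \<in> L2 cyl"
  proof (rule L2_dominated)
    show "(\<lambda>p. complex_of_real R * fourier2 (radon u) p) \<in> L2 cyl"
      by (rule L2_cmult[OF fourier2_L2[OF s(1)]])
    show "AE p in cyl. cmod (complex_of_real \<bar>snd p\<bar> * fourier2 (radon u) p)
        \<le> cmod (complex_of_real R * fourier2 (radon u) p)"
      using s(2) supp_cart
    proof eventually_elim
      case (elim p)
      show ?case
      proof (cases "fourier u (cart p) = 0")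
        case False
        hence "\<bar>snd p\<bar> \<le> \<bar>R\<bar>" using elim by linarith
        thus ?thesis by (simp add: norm_mult mult_right_mono)
      qed (simp add: elim)
    qed
  qed measurable
  have "riesz (radon u) = fourier2_inv (\<lambda>p. complex_of_real \<bar>snd p\<bar> * fourier2 (radon u) p)"
    using L s(1) by (simp add: riesz_def riesz_dom_def case_prod_unfold)
  with fourier2_inv_spec[OF L] s(2)
  show "riesz (radon u) \<in> L2 cyl" "AE p in cyl. fourier2 (riesz (radon u)) p
      = complex_of_real \<bar>snd p\<bar> * fourier u (cart p)"
    by (auto elim!: eventually_elim2)
qed

definition symbol :: "real \<Rightarrow> ((real^2) \<times> real \<Rightarrow> complex) \<Rightarrow> real^2 \<Rightarrow> complex" where
  "symbol \<kappa> g \<xi> = complex_of_real \<kappa> * cnj (fourier u \<xi>) * fourier2 g (polar \<xi>)"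

lemma sqnorm_symbol:
  assumes g: "g \<in> L2 cyl"
  shows "sqnorm lborel (symbol \<kappa> g) = (\<integral>\<^sup>+p. ennreal (\<kappa>\<^sup>2 * snd p * (cmod (fourier u (cart p)))\<^sup>2)
      * (ennreal ((cmod (fourier2 g p))\<^sup>2) * indicator {0<..} (snd p)) \<partial>cyl)"
proof -
  have [measurable]: "fourier2 g \<in> borel_measurable cyl"
      by (rule L2_measurable[OF fourier2_L2[OF g]])
  have "sqnorm lborel (symbol \<kappa> g) = (\<integral>\<^sup>+\<xi>. (\<lambda>p. ennreal ((cmod (complex_of_real \<kappa>
      * cnj (fourier u (cart p)) * fourier2 g p))\<^sup>2)) (polar \<xi>) \<partial>lborel)"
    unfolding sqnorm_def symbol_def by (simp only: cart_polar)
  also have "\<dots> = (\<integral>\<^sup>+p. ennreal ((cmod (complex_of_real \<kappa> * cnj (fourier u (cart p))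
      * fourier2 g p))\<^sup>2) * ennreal (snd p) * indicator {0<..} (snd p) \<partial>cyl)"
    by (rule nn_integral_polar_map) measurable
  also have "\<dots> = (\<integral>\<^sup>+p. ennreal (\<kappa>\<^sup>2 * snd p * (cmod (fourier u (cart p)))\<^sup>2)
      * (ennreal ((cmod (fourier2 g p))\<^sup>2) * indicator {0<..} (snd p)) \<partial>cyl)"
    by (rule nn_integral_cong)
       (auto simp: indicator_def norm_mult power_mult_distrib mult_ac simp flip: ennreal_mult)
  finally show ?thesis .
qed

lemma symbol_measurable:
  assumes g: "g \<in> L2 cyl"
  shows "symbol \<kappa> g \<in> borel_measurable borel"
proof -
  have [measurable]: "fourier2 g \<in> borel_measurable cyl"
      by (rule L2_measurable[OF fourier2_L2[OF g]])
  show ?thesis unfolding symbol_def[abs_def] by measurable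
qed

lemma sqnorm_symbol_le:
  assumes g: "g \<in> L2 cyl"
  shows "sqnorm lborel (symbol \<kappa> g) \<le> ennreal (\<kappa>\<^sup>2 * \<bar>R\<bar> * C\<^sup>2 * (2 * pi)) * sqnorm cyl g"
proof -
  have [measurable]: "fourier2 g \<in> borel_measurable cyl"
      by (rule L2_measurable[OF fourier2_L2[OF g]])
  have "sqnorm lborel (symbol \<kappa> g) \<le> (\<integral>\<^sup>+p. ennreal (\<kappa>\<^sup>2 * \<bar>R\<bar> * C\<^sup>2)
      * ennreal ((cmod (fourier2 g p))\<^sup>2) \<partial>cyl)"
    unfolding sqnorm_symbol[OF g]
  proof (rule nn_integral_mono_AE)
    show "AE p in cyl. ennreal (\<kappa>\<^sup>2 * snd p * (cmod (fourier u (cart p)))\<^sup>2)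
        * (ennreal ((cmod (fourier2 g p))\<^sup>2) * indicator {0<..} (snd p))
        \<le> ennreal (\<kappa>\<^sup>2 * \<bar>R\<bar> * C\<^sup>2) * ennreal ((cmod (fourier2 g p))\<^sup>2)"
      using supp_cart AE_cart[OF bound]
    proof eventually_elim
      case (elim p)
      show ?case
      proof (cases "snd p > 0")
        case True
        have "snd p * (cmod (fourier u (cart p)))\<^sup>2 \<le> \<bar>R\<bar> * C\<^sup>2"
        proof (cases "fourier u (cart p) = 0")
          case False
          thus ?thesis using elim True by (intro mult_mono power_mono) auto
        qed simp
        hence "\<kappa>\<^sup>2 * (snd p * (cmod (fourier u (cart p)))\<^sup>2) \<le> \<kappa>\<^sup>2 * (\<bar>R\<bar> * C\<^sup>2)"
          by (rule mult_left_mono) simp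
        thus ?thesis by (intro mult_mono[OF ennreal_leI]) (auto simp: indicator_def mult.assoc)
      qed simp
    qed
  qed
  also have "\<dots> = ennreal (\<kappa>\<^sup>2 * \<bar>R\<bar> * C\<^sup>2) * sqnorm cyl (fourier2 g)"
    unfolding sqnorm_def by (rule nn_integral_cmult) measurable
  also have "\<dots> = ennreal (\<kappa>\<^sup>2 * \<bar>R\<bar> * C\<^sup>2 * (2 * pi)) * sqnorm cyl g"
    by (simp add: Plancherel2[OF g] ennreal_mult mult.assoc)
  finally show ?thesis .
qed

lemma symbol_L2:
  assumes g: "g \<in> L2 cyl"
  shows "symbol \<kappa> g \<in> L2 lborel"
  using sqnorm_symbol_le[OF g, of \<kappa>] L2_finite[OF g] symbol_measurable[OF g, of \<kappa>]
  by (auto simp: L2_def ennreal_mult_less_top intro: le_less_trans)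

lemma radon_adj_conv2:
  assumes g: "g \<in> L2 cyl" and v: "v = (\<lambda>p. complex_of_real \<kappa> * riesz (radon u) p)"
  shows "radon_adj (conv2 (invol2 v) g) \<in> L2 lborel"
    "AE \<xi> in lborel. fourier (radon_adj (conv2 (invol2 v) g)) \<xi> = symbol \<kappa> g \<xi>"
proof -
  have v2: "v \<in> L2 cyl" unfolding v by (rule L2_cmult[OF riesz_radon(1)])
  have fv: "AE p in cyl. fourier2 (invol2 v) p = complex_of_real \<kappa> * complex_of_real \<bar>snd p\<bar>
      * cnj (fourier u (cart p))"
    using fourier2_invol2[OF v2] fourier2_cmult[OF riesz_radon(1), of "complex_of_real \<kappa>", folded
        v] riesz_radon(2)
    by eventually_elim simp
  have Cu: "AE p in cyl. \<bar>snd p\<bar> * cmod (fourier u (cart p)) \<le> \<bar>R\<bar> * C \<and> cmod (fourier u (cart p))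
      \<le> C"
    using supp_cart AE_cart[OF bound]
  proof eventually_elim
    case (elim p)
    have "0 \<le> C" using elim norm_ge_zero[of "fourier u (cart p)"] by linarith
    show ?case
    proof (cases "fourier u (cart p) = 0")
      case False
      thus ?thesis using elim by (auto intro!: mult_mono)
    qed (use \<open>0 \<le> C\<close> in auto)
  qed
  have vb: "AE p in cyl. cmod (fourier2 (invol2 v) p) \<le> \<bar>\<kappa>\<bar> * (\<bar>R\<bar> * C)"
    using fv Cu by eventually_elim (auto simp: norm_mult mult.assoc intro!: mult_left_mono)
  define G where "G = conv2 (invol2 v) g"
  have G: "G \<in> L2 cyl" and fG: "AE p in cyl. fourier2 G p = fourier2 (invol2 v) p * fourier2 g p"
    unfolding G_def by (rule fourier2_conv2[OF invol2_L2[OF v2] vb g])+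
  have [measurable]: "fourier2 G \<in> borel_measurable cyl" "fourier2 g \<in> borel_measurable cyl"
    by (intro L2_measurable fourier2_L2 G g)+
  have "(\<lambda>p. complex_of_real (\<bar>snd p\<bar> powr (-1/2)) * fourier2 G p) \<in> L2 cyl"
  proof (rule L2_dominated)
    show "(\<lambda>p. complex_of_real (r powr (-1/2) * (\<kappa> * (\<bar>R\<bar> * C))) * fourier2 g p) \<in> L2 cyl"
      by (rule L2_cmult[OF fourier2_L2[OF g]])
    show "AE p in cyl. cmod (complex_of_real (\<bar>snd p\<bar> powr (-1/2)) * fourier2 G p)
        \<le> cmod (complex_of_real (r powr (-1/2) * (\<kappa> * (\<bar>R\<bar> * C))) * fourier2 g p)"
      using fG fv Cu supp_cart
    proof eventually_elim
      case (elim p)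
      show ?case
      proof (cases "fourier u (cart p) = 0")
        case False
        have "\<bar>snd p\<bar> powr (-1/2) \<le> r powr (-1/2)" using elim False r by (intro powr_mono2') auto
        hence "\<bar>snd p\<bar> powr (-1/2) * (\<bar>\<kappa>\<bar> * (\<bar>snd p\<bar> * cmod (fourier u (cart p))))
            \<le> r powr (-1/2) * (\<bar>\<kappa>\<bar> * (\<bar>R\<bar> * C))"
          using elim by (intro mult_mono[OF _ mult_left_mono]) auto
        also have "\<dots> \<le> \<bar>r powr (-1/2) * (\<kappa> * (\<bar>R\<bar> * C))\<bar>"
          by (simp add: abs_mult mult_left_mono)
        finally have "\<bar>snd p\<bar> powr (-1/2) * (\<bar>\<kappa>\<bar> * (\<bar>snd p\<bar> * cmod (fourier u (cart p))))
            * cmod (fourier2 g p) \<le> \<bar>r powr (-1/2) * (\<kappa> * (\<bar>R\<bar> * C))\<bar> * cmod (fourier2 g p)"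
          by (rule mult_right_mono) simp
        thus ?thesis using elim by (simp only: norm_mult norm_of_real) (simp add: norm_mult mult_ac)
      qed (simp add: elim)
    qed
  qed measurable
  hence "G \<in> radon_adj_dom" using G by (simp add: radon_adj_dom_def case_prod_unfold)
  hence V: "radon_adj G = fourier_inv (\<lambda>\<xi>. complex_of_real (inverse (norm \<xi>))
      * fourier2 G (\<xi> /\<^sub>R norm \<xi>, norm \<xi>))"
    by (simp add: radon_adj_def)
  have "AE \<xi> in lborel. complex_of_real (inverse (norm \<xi>)) * fourier2 G (\<xi> /\<^sub>R norm \<xi>, norm \<xi>)
      = symbol \<kappa> g \<xi>"
    using AE_polar[OF fG] AE_polar[OF fv] AE_lborel_singleton[of "0::real^2"]
  proof eventually_elim
    case (elim \<xi>)
    have "polar \<xi> = (\<xi> /\<^sub>R norm \<xi>, norm \<xi>)" using elim by (simp add: polar_def)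
    hence "fourier2 G (\<xi> /\<^sub>R norm \<xi>, norm \<xi>) = complex_of_real \<kappa> * complex_of_real (norm \<xi>)
        * cnj (fourier u \<xi>) * fourier2 g (polar \<xi>)"
      using elim(1,2) cart_polar[of \<xi>] by (simp only: snd_conv abs_norm_cancel)
    thus ?case using elim(3) by (simp add: symbol_def)
  qed
  from fourier_inv_spec[OF symbol_L2[OF g] this] this
  show "radon_adj (conv2 (invol2 v) g) \<in> L2 lborel"
    "AE \<xi> in lborel. fourier (radon_adj (conv2 (invol2 v) g)) \<xi> = symbol \<kappa> g \<xi>"
    unfolding V[symmetric] unfolding G_def by (auto elim!: eventually_elim2)
qed

lemma L2_bounded_op_symbol:
  assumes V: "\<And>g. g \<in> L2 cyl \<Longrightarrow> V g \<in> L2 lborel" "\<And>g. g \<in> L2 cyl \<Longrightarrow> AE \<xi> in lborel. fourier (V g) \<xi>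
      = symbol \<kappa> g \<xi>"
  shows "L2_bounded_op cyl lborel V"
proof -
  have lin: "L2_linear_op cyl lborel (L2 cyl) V"
    unfolding L2_linear_op_def
  proof (intro conjI ballI impI allI)
    fix f g assume f: "f \<in> L2 cyl" and g: "g \<in> L2 cyl" and "AE p in cyl. f p = g p"
    hence "fourier2 f = fourier2 g" by (intro fourier2_cong_AE)
    hence sy: "symbol \<kappa> f = symbol \<kappa> g" by (intro ext) (simp add: symbol_def)
    have "AE \<xi> in lborel. fourier (V f) \<xi> = fourier (V g) \<xi>"
      using V(2)[OF f] V(2)[OF g] by eventually_elim (simp add: sy)
    thus "AE x in lborel. V f x = V g x" by (rule fourier_inj[OF V(1)[OF f] V(1)[OF g]])
  next
    fix f g assume f: "f \<in> L2 cyl" and g: "g \<in> L2 cyl"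
    show "(\<lambda>p. f p + g p) \<in> L2 cyl" by (rule L2_add[OF f g])
    have "AE \<xi> in lborel. fourier (V (\<lambda>p. f p + g p)) \<xi> = fourier (\<lambda>x. V f x + V g x) \<xi>"
      using V(2)[OF f] V(2)[OF g] V(2)[OF L2_add[OF f g]] AE_polar[OF fourier2_add[OF f g]]
          fourier_add[OF V(1)[OF f] V(1)[OF g]]
      by eventually_elim (simp add: symbol_def algebra_simps)
    thus "AE x in lborel. V (\<lambda>p. f p + g p) x = V f x + V g x"
      by (rule fourier_inj[OF V(1)[OF L2_add[OF f g]] L2_add[OF V(1)[OF f] V(1)[OF g]]])
  next
    fix c f assume f: "f \<in> L2 cyl"
    show "(\<lambda>p. c * f p) \<in> L2 cyl" by (rule L2_cmult[OF f])
    have "AE \<xi> in lborel. fourier (V (\<lambda>p. c * f p)) \<xi> = fourier (\<lambda>x. c * V f x) \<xi>"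
      using V(2)[OF f] V(2)[OF L2_cmult[OF f, of c]] AE_polar[OF fourier2_cmult[OF f, of c]]
          fourier_cmult[OF V(1)[OF f], of c]
      by eventually_elim (simp add: symbol_def algebra_simps)
    thus "AE x in lborel. V (\<lambda>p. c * f p) x = c * V f x"
      by (rule fourier_inj[OF V(1)[OF L2_cmult[OF f]] L2_cmult[OF V(1)[OF f]]])
  qed (use V in auto)
  let ?K = "\<kappa>\<^sup>2 * \<bar>R\<bar> * C\<^sup>2 * (2 * pi)"
  have "sqnorm lborel (V g) \<le> ennreal ((sqrt ?K)\<^sup>2) * sqnorm cyl g" if g: "g \<in> L2 cyl" for g
  proof -
    have "sqnorm lborel (V g) \<le> ennreal ((2 * pi) ^ 2) * sqnorm lborel (V g)"
    proof -
      have "1 \<le> (2 * pi) ^ 2" using pi_gt3 by (intro one_le_power) auto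
      hence "ennreal 1 * sqnorm lborel (V g) \<le> ennreal ((2 * pi) ^ 2) * sqnorm lborel (V g)"
        by (intro mult_right_mono ennreal_leI) auto
      thus ?thesis by simp
    qed
    also have "\<dots> = sqnorm lborel (symbol \<kappa> g)"
      using Plancherel[OF V(1)[OF g]] sqnorm_cong_AE[OF V(2)[OF g]] by simp
    also have "\<dots> \<le> ennreal ?K * sqnorm cyl g" by (rule sqnorm_symbol_le[OF g])
    also have "?K = (sqrt ?K)\<^sup>2" by (rule real_sqrt_pow2[symmetric]) simp
    finally show ?thesis .
  qed
  with lin show ?thesis unfolding L2_bounded_op_def
    by (intro conjI exI[of _ "sqrt ?K"]) auto
qed

end

text \<open>\<open>F\<^sub>2 (R f) (\<theta>, \<sigma>)\<close> depends on \<open>\<sigma>\<theta>\<close> only, which is invariant under \<open>(\<theta>, \<sigma>) \<mapsto> (-\<theta>, -\<sigma>)\<close>.\<close>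

lemma even_fourier2_radon_closure:
  assumes g: "g \<in> L2_closure cyl (radon ` radon_dom)"
  shows "AE p in cyl. fourier2 g (- p) = fourier2 g p"
proof -
  have g2: "g \<in> L2 cyl" using g by (simp add: L2_closure_def)
  obtain G where G: "\<And>n. G n \<in> radon ` radon_dom" and lG: "L2_tendsto cyl G g"
    using g by (auto simp: L2_closure_def)
  then obtain F where F: "\<And>n. F n \<in> radon_dom" "\<And>n. G n
      = radon (F n)" by (auto simp: image_iff) metis
  have G2: "G n \<in> L2 cyl" for n unfolding F(2) by (rule radon_spec(1)[OF F(1)])
  define H where "H n p = fourier (F n) (cart p)" for n p
  have Heven: "H n (- p) = H n p" for n p by (simp add: H_def)
  have eq: "AE p in cyl. fourier2 (G n) p = H n p" for n
    unfolding F(2) H_def by (rule radon_spec(2)[OF F(1)])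
  have Hm [measurable]: "H n \<in> borel_measurable cyl" for n
  proof -
    have [measurable]: "fourier (F n) \<in> borel_measurable borel"
      using L2_measurable[OF fourier_L2[of "F n"]] F(1)[of n] by (simp add: radon_dom_def)
    show ?thesis unfolding H_def[abs_def] by measurable
  qed
  have [measurable]: "fourier2 g \<in> borel_measurable cyl"
      by (rule L2_measurable[OF fourier2_L2[OF g2]])
  have [measurable]: "(\<lambda>p. fourier2 g (- p)) \<in> borel_measurable cyl"
    by (rule measurable_compose[OF uminus_cyl]) simp
  have "sqnorm cyl (\<lambda>p. fourier2 (G n) p - fourier2 g p)
      = sqnorm cyl (\<lambda>p. H n p - fourier2 g p)" for n
    using eq[of n] by (intro sqnorm_cong_AE) auto
  with fourier2_tendsto[OF G2 g2 lG] have 1: "L2_tendsto cyl H (fourier2 g)"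
    by (simp add: L2_tendsto_def)
  have "sqnorm cyl (\<lambda>p. H n p - fourier2 g (- p)) = sqnorm cyl (\<lambda>p. H n p - fourier2 g p)" for n
  proof -
    have "sqnorm cyl (\<lambda>p. H n p - fourier2 g p) = (\<integral>\<^sup>+p. (\<lambda>p.
        ennreal ((cmod (H n p - fourier2 g p))\<^sup>2)) (- p) \<partial>cyl)"
      unfolding sqnorm_def by (rule nn_integral_cyl_uminus[symmetric]) measurable
    thus ?thesis by (simp add: Heven sqnorm_def)
  qed
  with 1 have 2: "L2_tendsto cyl H (\<lambda>p. fourier2 g (- p))" by (simp add: L2_tendsto_def)
  show ?thesis by (rule L2_tendsto_unique[OF Hm _ _ 2 1]) measurable
qed

lemma infinite_scales: "infinite (UNIV :: (int \<times> orientation) set)"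
proof
  assume "finite (UNIV :: (int \<times> orientation) set)"
  hence "finite (fst ` (UNIV :: (int \<times> orientation) set))" by (rule finite_imageI)
  moreover have "fst ` (UNIV :: (int \<times> orientation) set) = UNIV" by (auto simp: image_def)
  ultimately show False using infinite_UNIV_int by simp
qed

theorem theorem3p5:
  fixes u :: "int \<times> orientation \<Rightarrow> real^2 \<Rightarrow> complex"
    and v :: "int \<times> orientation \<Rightarrow> (real^2) \<times> real \<Rightarrow> complex"
    and V :: "int \<times> orientation \<Rightarrow> ((real^2) \<times> real \<Rightarrow> complex) \<Rightarrow> real^2 \<Rightarrow> complex"
    and a b :: real
  assumes frame: "TI_frame (UNIV :: (int \<times> orientation) set) u"
    and multiscale: "\<And>j l. AE x in lborel.
          u (j, l) x = complex_of_real (2 powi (2 * j)) * u (0, l) ((2 powi j) *\<^sub>R x)"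
    and "a > 0" and "b > 0"
    and supp: "\<And>l. ess_support (fourier (u (0, l))) = {\<xi>. a \<le> norm \<xi> \<and> norm \<xi> \<le> b}"
    and v: "\<And>j l. v (j, l) =
          (\<lambda>p. complex_of_real (2 powr (- real_of_int j / 2)) * riesz (radon (u (j, l))) p)"
    and V: "\<And>j l g. g \<in> L2 cyl \<Longrightarrow> V (j, l) g = radon_adj (conv2 (invol2 (v (j, l))) g)"
  shows "TI_DFD cyl radon_dom radon UNIV u V (\<lambda>(j, l). 2 powr (- real_of_int j / 2))"
proof -
  define \<kappa> where "\<kappa> i = 2 powr (- real_of_int (fst i) / 2)" for i :: "int \<times> orientation"
  define s where "s i = (2::real) powi (fst i)" for i :: "int \<times> orientation"
  have s: "s i > 0" for i by (simp add: s_def)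
  have \<kappa>: "\<kappa> i > 0" "(\<kappa> i)\<^sup>2 = 1 / s i" for i
  proof -
    have "(\<kappa> i)\<^sup>2 = 2 powr (- real_of_int (fst i))"
      by (simp add: \<kappa>_def power2_eq_square powr_add[symmetric])
    also have "\<dots> = 1 / s i"
      by (simp add: s_def powr_minus powr_real_of_int' divide_inverse)
    finally show "(\<kappa> i)\<^sup>2 = 1 / s i" .
  qed (simp add: \<kappa>_def)
  have cnt: "countable (UNIV :: (int \<times> orientation) set)"
    and uL: "u i \<in> L2 lborel" and uI: "fourier (u i) \<in> Linfty lborel" for i
    using frame unfolding TI_frame_def by blast+
  obtain A B where A: "A > 0" "\<And>f. f \<in> L2 lborel \<Longrightarrow> ennreal A * sqnorm lborel f
      \<le> (\<Sum>\<^sub>\<infinity>i. sqnorm lborel (conv (invol (u i)) f))"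
    and B: "B > 0" "\<And>f. f \<in> L2 lborel \<Longrightarrow> (\<Sum>\<^sub>\<infinity>i. sqnorm lborel (conv (invol (u i)) f))
        \<le> ennreal B * sqnorm lborel f"
    using frame unfolding TI_frame_def by blast
  define h where "h = from_nat_into (UNIV :: (int \<times> orientation) set)"
  have h: "bij h" unfolding h_def by (rule bij_betw_from_nat_into[OF cnt infinite_scales])
  have supp_i: "AE \<xi> in lborel. fourier (u i) \<xi> \<noteq> 0 \<longrightarrow> a * s i \<le> norm \<xi> \<and> norm \<xi> \<le> b * s i" for i
  proof (cases i)
    case (Pair j l)
    have "2 powi (2 * j) = (s i)\<^sup>2" by (simp add: Pair s_def power_int_mult mult.commute[of 2])
    hence w: "AE x in lborel. u (j, l) x = complex_of_real ((s i)\<^sup>2) * u (0, l) (s i *\<^sub>R x)"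
      using multiscale[of j l] by (simp add: Pair s_def)
    have "inverse (s i) \<noteq> 0" using s[of i] by simp
    from AE_lborel_affine[OF ess_support_null[of "fourier (u (0, l))"] this, of 0]
    have "AE \<xi> in lborel. fourier (u (0, l)) (\<xi> /\<^sub>R s i) \<noteq> 0 \<longrightarrow> a
        \<le> norm (\<xi> /\<^sub>R s i) \<and> norm (\<xi> /\<^sub>R s i) \<le> b"
      unfolding supp by (auto elim!: eventually_mono)
    with fourier_dilation[OF uL s w] show ?thesis unfolding Pair[symmetric]
    proof eventually_elim
      case (elim \<xi>)
      have "norm (\<xi> /\<^sub>R s i) = norm \<xi> / s i" using s[of i]
          by (simp add: divide_inverse mult.commute)
      thus ?case using elim s[of i] by (auto simp: field_simps)
    qed
  qed
  have "\<exists>C. AE \<xi> in lborel. cmod (fourier (u i) \<xi>) \<le> C" for i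
    using uI[of i] by (auto simp: Linfty_def)
  then obtain C where C: "\<And>i. AE \<xi> in lborel. cmod (fourier (u i) \<xi>) \<le> C i" by metis
  have filt: "radial_filter (u i) (C i) (a * s i) (b * s i)" for i
    by unfold_locales (use uL C supp_i s[of i] \<open>a > 0\<close> in auto)
  define m where "m i = radial_filter.symbol (u i) (\<kappa> i)" for i
  have VL: "V i g \<in> L2 lborel" and Vm: "AE \<xi> in lborel. fourier (V i g) \<xi>
      = m i g \<xi>" if "g \<in> L2 cyl" for i g
  proof -
    interpret radial_filter "u i" "C i" "a * s i" "b * s i" by (rule filt)
    have "v i = (\<lambda>p. complex_of_real (\<kappa> i) * riesz (radon (u i)) p)"
      using v[of "fst i" "snd i"] by (simp add: \<kappa>_def)
    note r = radon_adj_conv2[OF that this]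
    have "V i g = radon_adj (conv2 (invol2 (v i)) g)" using V[OF that, of "fst i" "snd i"] by simp
    with r show "V i g \<in> L2 lborel" "AE \<xi> in lborel. fourier (V i g) \<xi>
        = m i g \<xi>" by (simp_all add: m_def)
  qed
  have bdd: "L2_bounded_op cyl lborel (V i)" for i
  proof -
    interpret radial_filter "u i" "C i" "a * s i" "b * s i" by (rule filt)
    show ?thesis using VL Vm unfolding m_def by (rule L2_bounded_op_symbol)
  qed
  have TI3: "AE x in lborel. V i (radon f) x = complex_of_real (\<kappa> i)
      * conv (invol (u i)) f x" if f: "f \<in> radon_dom" for i f
  proof -
    interpret radial_filter "u i" "C i" "a * s i" "b * s i" by (rule filt)
    have fL: "f \<in> L2 lborel" using f by (simp add: radon_dom_def)
    note c = fourier_conv_invol[OF uL[of i] uI[of i] fL]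
    note R = radon_spec[OF f]
    have "AE \<xi> in lborel. fourier (V i (radon f)) \<xi>
        = fourier (\<lambda>x. complex_of_real (\<kappa> i) * conv (invol (u i)) f x) \<xi>"
      using Vm[OF R(1), of i] AE_polar[OF R(2)] c(2) fourier_cmult[OF c(1), of "complex_of_real (\<kappa>
          i)"]
    proof eventually_elim
      case (elim \<xi>)
      have "fourier2 (radon f) (polar \<xi>) = fourier f \<xi>" using elim(2) by (simp only: cart_polar)
      thus ?case using elim by (simp add: m_def symbol_def)
    qed
    thus ?thesis by (rule fourier_inj[OF VL[OF R(1)] L2_cmult[OF c(1)]])
  qed
  have TI2: "ennreal (a * A / (4 * pi)) * sqnorm cyl g \<le> (\<Sum>\<^sub>\<infinity>i. sqnorm lborel (V i g)) \<and>
      (\<Sum>\<^sub>\<infinity>i. sqnorm lborel (V i g)) \<le> ennreal (b * B / (4 * pi)) * sqnorm cyl g"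
    if g: "g \<in> L2_closure cyl (radon ` radon_dom)" for g
  proof -
    have gL: "g \<in> L2 cyl" using g by (simp add: L2_closure_def)
    have [measurable]: "fourier2 g \<in> borel_measurable cyl"
        by (rule L2_measurable[OF fourier2_L2[OF gL]])
    have [measurable]: "fourier (u i) \<in> borel_measurable borel" for i
      using L2_measurable[OF fourier_L2[OF uL[of i]]] by simp
    define q where "q p = ennreal ((cmod (fourier2 g p))\<^sup>2) * indicator {0<..} (snd p)" for p
    have [measurable]: "q \<in> borel_measurable cyl" unfolding q_def[abs_def] by measurable
    define w where "w i p = ennreal ((\<kappa> i)\<^sup>2 * snd p * (cmod (fourier (u i) (cart p)))\<^sup>2)" for i p
    have [measurable]: "w i \<in> borel_measurable cyl" for i unfolding w_def[abs_def] by measurable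
    have sq: "ennreal ((2 * pi)\<^sup>2) * sqnorm lborel (V i g) = (\<integral>\<^sup>+p. w i p * q p \<partial>cyl)" for i
    proof -
      interpret radial_filter "u i" "C i" "a * s i" "b * s i" by (rule filt)
      have "ennreal ((2 * pi)\<^sup>2) * sqnorm lborel (V i g) = sqnorm lborel (m i g)"
        using Plancherel[OF VL[OF gL, of i]] sqnorm_cong_AE[OF Vm[OF gL, of i]] by simp
      thus ?thesis by (simp add: m_def sqnorm_symbol[OF gL] w_def q_def)
    qed
    have sum: "ennreal ((2 * pi)\<^sup>2) * (\<Sum>\<^sub>\<infinity>i. sqnorm lborel (V i g))
        = (\<integral>\<^sup>+p. (\<Sum>n. w (h n) p) * q p \<partial>cyl)"
    proof -
      have "ennreal ((2 * pi)\<^sup>2) * (\<Sum>\<^sub>\<infinity>i. sqnorm lborel (V i g))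
          = (\<Sum>n. ennreal ((2 * pi)\<^sup>2) * sqnorm lborel (V (h n) g))"
        unfolding infsum_ennreal_bij[OF h] by (rule ennreal_suminf_cmult[symmetric])
      also have "\<dots> = (\<integral>\<^sup>+p. (\<Sum>n. w (h n) p * q p) \<partial>cyl)"
        unfolding sq by (rule nn_integral_suminf[symmetric]) measurable
      finally show ?thesis by (simp add: ennreal_suminf_multc)
    qed
    have half: "(\<integral>\<^sup>+p. q p \<partial>cyl) = ennreal pi * sqnorm cyl g"
    proof -
      have "2 * (\<integral>\<^sup>+p. q p \<partial>cyl) = sqnorm cyl (fourier2 g)"
        unfolding sqnorm_def q_def using even_fourier2_radon_closure[OF g]
        by (intro nn_integral_half_cyl[symmetric]) (auto elim!: eventually_mono)
      also have "\<dots> = 2 * (ennreal pi * sqnorm cyl g)"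
        by (simp add: Plancherel2[OF gL] ennreal_mult mult.assoc)
      finally show ?thesis by (simp add: ennreal_mult_cancel_left)
    qed
    have symb: "AE p in cyl. ennreal A \<le> (\<Sum>n. ennreal ((cmod (fourier (u (h n)) (cart p)))\<^sup>2))
        \<and> (\<Sum>n. ennreal ((cmod (fourier (u (h n)) (cart p)))\<^sup>2)) \<le> ennreal B"
      by (rule AE_cart[OF frame_symbol_bounds[OF h uL uI A(2) B(2)]])
    have "AE p in cyl. \<forall>n. fourier (u (h n)) (cart p) \<noteq> 0 \<longrightarrow> a * s (h n) \<le> \<bar>snd p\<bar> \<and> \<bar>snd p\<bar>
        \<le> b * s (h n)"
      unfolding AE_all_countable by (intro allI radial_filter.supp_cart[OF filt])
    with symb have bounds: "AE p in cyl. ennreal (a * A) * q p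
        \<le> (\<Sum>n. w (h n) p) * q p \<and> (\<Sum>n. w (h n) p) * q p \<le> ennreal (b * B) * q p"
    proof eventually_elim
      case (elim p)
      show ?case
      proof (cases "snd p > 0")
        case True
        let ?x = "\<lambda>n. (cmod (fourier (u (h n)) (cart p)))\<^sup>2"
        have le: "ennreal a * ennreal (?x n) \<le> w (h n) p \<and> w (h n) p
            \<le> ennreal b * ennreal (?x n)" for n
        proof -
          have "a * ?x n \<le> (\<kappa> (h n))\<^sup>2 * snd p * ?x n \<and> (\<kappa> (h n))\<^sup>2 * snd p * ?x n \<le> b * ?x n"
          proof (cases "fourier (u (h n)) (cart p) = 0")
            case False
            hence "a * s (h n) \<le> snd p" "snd p \<le> b * s (h n)" using elim True by auto
            hence "a \<le> (\<kappa> (h n))\<^sup>2 * snd p" "(\<kappa> (h n))\<^sup>2 * snd p \<le> b"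
              unfolding \<kappa> using s[of "h n"] by (simp_all add: field_simps)
            thus ?thesis by (intro conjI mult_right_mono) auto
          qed simp
          thus ?thesis unfolding w_def using \<open>a > 0\<close> \<open>b > 0\<close>
            by (auto simp flip: ennreal_mult intro!: ennreal_leI)
        qed
        have "ennreal (a * A) \<le> ennreal a * (\<Sum>n. ennreal (?x n))"
          using elim \<open>a > 0\<close> A(1) by (auto simp: ennreal_mult intro!: mult_left_mono)
        also have "\<dots> = (\<Sum>n. ennreal a * ennreal (?x n))" by (rule ennreal_suminf_cmult[symmetric])
        also have "\<dots> \<le> (\<Sum>n. w (h n) p)" using le by (intro suminf_le) auto
        finally have 1: "ennreal (a * A) \<le> (\<Sum>n. w (h n) p)" .
        have "(\<Sum>n. w (h n) p) \<le> (\<Sum>n. ennreal b * ennreal (?x n))" using le by (intro suminf_le) auto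
        also have "\<dots> = ennreal b * (\<Sum>n. ennreal (?x n))" by (rule ennreal_suminf_cmult)
        also have "\<dots> \<le> ennreal (b * B)"
          using elim \<open>b > 0\<close> B(1) by (auto simp: ennreal_mult intro!: mult_left_mono)
        finally have 2: "(\<Sum>n. w (h n) p) \<le> ennreal (b * B)" .
        from 1 2 show ?thesis by (intro conjI mult_right_mono) auto
      qed (simp add: q_def)
    qed
    have c: "ennreal ((2 * pi)\<^sup>2) * (ennreal (x / (4 * pi)) * sqnorm cyl g)
        = ennreal x * (ennreal pi * sqnorm cyl g)" if "x > 0" for x
    proof -
      have "(2 * pi)\<^sup>2 * (x / (4 * pi)) = x * pi" by (simp add: power2_eq_square)
      hence "ennreal ((2 * pi)\<^sup>2) * ennreal (x / (4 * pi)) = ennreal x * ennreal pi"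
        using that by (simp flip: ennreal_mult)
      thus ?thesis by (simp add: mult.assoc[symmetric])
    qed
    have cancel: "X \<le> Y" if "ennreal ((2 * pi)\<^sup>2) * X \<le> ennreal ((2 * pi)\<^sup>2) * Y" for X Y :: ennreal
      using that by (subst (asm) ennreal_mult_le_mult_iff) (auto simp: ennreal_eq_0_iff not_le)
    have low: "ennreal (a * A) * (ennreal pi * sqnorm cyl g) \<le> (\<integral>\<^sup>+p. (\<Sum>n. w (h n) p) * q p \<partial>cyl)"
      unfolding half[symmetric]
      by (subst nn_integral_cmult[symmetric], simp, rule nn_integral_mono_AE) (use bounds in \<open>auto
          elim: eventually_mono\<close>)
    have up: "(\<integral>\<^sup>+p. (\<Sum>n. w (h n) p) * q p \<partial>cyl) \<le> ennreal (b * B) * (ennreal pi * sqnorm cyl g)"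
      unfolding half[symmetric]
      by (subst nn_integral_cmult[symmetric], simp, rule nn_integral_mono_AE) (use bounds in \<open>auto
          elim: eventually_mono\<close>)
    show ?thesis
    proof
      have "a * A > 0" "b * B > 0" using \<open>a > 0\<close> \<open>b > 0\<close> A(1) B(1) by simp_all
      note c = c[OF this(1)] c[OF this(2)]
      show "ennreal (a * A / (4 * pi)) * sqnorm cyl g \<le> (\<Sum>\<^sub>\<infinity>i. sqnorm lborel (V i g))"
        by (rule cancel) (use low in \<open>simp only: sum c\<close>)
      show "(\<Sum>\<^sub>\<infinity>i. sqnorm lborel (V i g)) \<le> ennreal (b * B / (4 * pi)) * sqnorm cyl g"
        by (rule cancel) (use up in \<open>simp only: sum c\<close>)
    qed
  qed
  have "a * A / (4 * pi) > 0" "b * B / (4 * pi) > 0"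
    using \<open>a > 0\<close> \<open>b > 0\<close> A(1) B(1) by simp_all
  hence "\<exists>c1>0. \<exists>c2>0. \<forall>g\<in>L2_closure cyl (radon ` radon_dom).
     ennreal c1 * sqnorm cyl g \<le> (\<Sum>\<^sub>\<infinity>i. sqnorm lborel (V i g)) \<and>
     (\<Sum>\<^sub>\<infinity>i. sqnorm lborel (V i g)) \<le> ennreal c2 * sqnorm cyl g"
    using TI2 by blast
  moreover have "(\<lambda>(j, l). 2 powr (- real_of_int j / 2)) = \<kappa>" by (auto simp: \<kappa>_def)
  ultimately show ?thesis
    unfolding TI_DFD_def using radon_closed frame bdd TI3 \<kappa>(1) by simp
qed

end
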